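(* Let $n\ge 1$ and let $b_1<\dots<b_n<d_1<\dots<d_n$ be non-negative integers; write $\boldsymbol b=(b_1,\dots,b_n)$ and $\boldsymbol d=(d_1,\dots,d_n)$. Let $F_0$, $\mathcal K(\boldsymbol b,\boldsymbol d)$ and the cell decomposition $\mathcal K(\boldsymbol b,\boldsymbol d)=\bigsqcup_{w\in S_n}\mathcal K^\circ_w(\boldsymbol b,\boldsymbol d)$ be as defined in the context. Then this decomposition parametrizes the isomorphism classes of persistence modules with birth sequence $\boldsymbol b$ and death sequence $\boldsymbol d$. That is: every persistence module with birth sequence $\boldsymbol b$ and death sequence $\boldsymbol d$ is isomorphic to $F_0/K$ for some $K\in\mathcal K(\boldsymbol b,\boldsymbol d)$; for $K,K'\in\mathcal K(\boldsymbol b,\boldsymbol d)$ one has $F_0/K\cong F_0/K'$ (as graded modules) if and only if $K$ and $K'$ lie in the same cell $\mathcal K^\circ_w(\boldsymbol b,\boldsymbol d)$; and consequently, assigning to each $w\in S_n$ the common isomorphism class of the modules $F_0/K$ with $K\in\mathcal K^\circ_w(\boldsymbol b,\boldsymbol d)$ gives a bijection between the Schubert cells $X^\circ_w$ ($w\in S_n$) and the isomorphism classes of persistence modules with birth sequence $\boldsymbol b$ and death sequence $\boldsymbol d$.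
   Context: $\mathbb C[z]$ is the polynomial ring in one variable, graded by $\deg z=1$. A persistence module is a finitely generated non-negatively graded $\mathbb C[z]$-module; morphisms and isomorphisms are degree-preserving $\mathbb C[z]$-linear maps, and submodules are graded submodules. For an integer $b\ge 0$, $z^b\mathbb C[z]$ denotes the graded free module of rank one generated in degree $b$. A persistence module $M$ has birth sequence $\boldsymbol b=(b_1,\dots,b_n)$ and death sequence $\boldsymbol d=(d_1,\dots,d_n)$ if it has a minimal graded free resolution $0\to F_1\to F_0\to M\to 0$ with $F_0\cong\bigoplus_{i=1}^n z^{b_i}\mathbb C[z]$ and $F_1\cong\bigoplus_{i=1}^n z^{d_i}\mathbb C[z]$. Fix the graded free module $F_0\cong\bigoplus_{i=1}^n z^{b_i}\mathbb C[z]$ with a homogeneous basis $\xi_1,\dots,\xi_n$, $\deg\xi_i=b_i$. Let $\mathcal K(\boldsymbol b,\boldsymbol d)$ be the set of graded submodules $K\subseteq F_0$ such that $K\cong\bigoplus_{i=1}^n z^{d_i}\mathbb C[z]$ as graded modules. For $A=(a_{ij})\in \mathrm{GL}_n(\mathbb C)$, put $\eta_j=\sum_{i=1}^n a_{ij}z^{d_j-b_i}\xi_i$ for $1\le j\le n$ and let $\varphi(A)=K_A\subseteq F_0$ be the submodule generated by $\eta_1,\dots,\eta_n$; this defines a map $\varphi:\mathrm{GL}_n(\mathbb C)\to\mathcal K(\boldsymbol b,\boldsymbol d)$. $\mathcal F_n$ is the set of complete flags $\{0\}=V_0\subset V_1\subset\dots\subset V_n=\mathbb C^n$, $\dim V_i=i$,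 and $\pi:\mathrm{GL}_n(\mathbb C)\to\mathcal F_n$ sends a matrix with columns $v_1,\dots,v_n$ to the flag with $V_i=\langle v_1,\dots,v_i\rangle$. $S_n$ is the symmetric group on $\{1,\dots,n\}$. For $w\in S_n$, let $U_w^+\subset \mathrm{GL}_n(\mathbb C)$ be the set of matrices $\xi=(\xi_{ij})$ with $\xi_{w(j),j}=1$ for $1\le j\le n$, $\xi_{i,k}=0$ whenever $k>w^{-1}(i)$, and $\xi_{j,k}=0$ whenever $j>w(k)$. The Schubert cell of $w$ is $X_w^\circ=\pi(U_w^+)$; one has $\mathcal F_n=\bigsqcup_{w\in S_n}X_w^\circ$. Define $\mathcal K^\circ_w(\boldsymbol b,\boldsymbol d)=\varphi(\pi^{-1}(X^\circ_w))$; these sets form the decomposition $\mathcal K(\boldsymbol b,\boldsymbol d)=\bigsqcup_{w\in S_n}\mathcal K^\circ_w(\boldsymbol b,\boldsymbol d)$. *)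

theory Defs
  imports "Jordan_Normal_Form.VS_Connect" "HOL-Algebra.AbelCoset" "HOL-Combinatorics.Permutations"
    "HOL-Library.Disjoint_Sets"
begin

text \<open>
  Indices run over \<open>{..<n}\<close> instead of \<open>{1, \<dots>, n}\<close>. The ring \<open>\<complex>[z]\<close> is
  \<open>class_ring\<close> at type \<^typ>\<open>complex poly\<close>, and \<open>z\<close> is \<open>monom 1 1\<close>.
\<close>

abbreviation Cz :: "complex poly ring" where
  "Cz \<equiv> class_ring"


section \<open>Graded modules\<close>

text \<open>
  The fields \<open>mult\<close> and \<open>one\<close>, inherited from the record of modules, carry no meaning.
\<close>

record 'm gmodule = "(complex poly, 'm) module" +
  hcomp :: "nat \<Rightarrow> 'm set"

locale graded_module = Module.module Cz M for M :: "'m gmodule" (structure) +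
  assumes additive_subgroup_hcomp: "additive_subgroup (hcomp M k) M"
    and smult_hcomp: "x \<in> hcomp M k \<Longrightarrow> monom c j \<odot>\<^bsub>M\<^esub> x \<in> hcomp M (j + k)"
    and homogeneous_decomposition:
      "x \<in> carrier M \<Longrightarrow>
        \<exists>!c. (\<forall>k. c k \<in> hcomp M k) \<and> finite {k. c k \<noteq> \<zero>\<^bsub>M\<^esub>}
          \<and> x = (\<Oplus>\<^bsub>M\<^esub>k\<in>{k. c k \<noteq> \<zero>\<^bsub>M\<^esub>}. c k)"

definition persistence_module :: "'m gmodule \<Rightarrow> bool" where
  "persistence_module M \<longleftrightarrow> graded_module M \<and>
    (\<exists>S. finite S \<and> S \<subseteq> carrier M \<and> LinearCombinations.module.span Cz M S = carrier M)"

definition graded_hom :: "'m gmodule \<Rightarrow> 'n gmodule \<Rightarrow> ('m \<Rightarrow> 'n) set" where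
  "graded_hom M N = {f \<in> LinearCombinations.module_hom Cz M N. \<forall>k. f ` hcomp M k \<subseteq> hcomp N k}"

definition graded_iso :: "'m gmodule \<Rightarrow> 'n gmodule \<Rightarrow> bool" (infix \<open>\<cong>\<^sub>g\<close> 50) where
  "M \<cong>\<^sub>g N \<longleftrightarrow> (\<exists>f \<in> graded_hom M N. bij_betw f (carrier M) (carrier N))"

definition restrict_gmodule :: "'m gmodule \<Rightarrow> 'm set \<Rightarrow> 'm gmodule" where
  "restrict_gmodule M K = M\<lparr>carrier := K, hcomp := (\<lambda>k. hcomp M k \<inter> K)\<rparr>"

definition graded_submodule :: "'m set \<Rightarrow> 'm gmodule \<Rightarrow> bool" where
  "graded_submodule K M \<longleftrightarrow>
    LinearCombinations.submodule Cz K M \<and> graded_module (restrict_gmodule M K)"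

definition quotient_gmodule :: "'m gmodule \<Rightarrow> 'm set \<Rightarrow> 'm set gmodule" (infixl \<open>'/\<^sub>g\<close> 65) where
  "M /\<^sub>g K =
    \<lparr>carrier = a_rcosets\<^bsub>M\<^esub> K, mult = undefined, one = undefined,
     zero = K, add = set_add M,
     smult = (\<lambda>r X. \<Union>x\<in>X. K +>\<^bsub>M\<^esub> (r \<odot>\<^bsub>M\<^esub> x)),
     hcomp = (\<lambda>k. (\<lambda>x. K +>\<^bsub>M\<^esub> x) ` hcomp M k)\<rparr>"

text \<open>
  The direct sum of the ideals \<open>z^(b i) \<complex>[z]\<close> for \<open>i < n\<close>, each graded as a subset of \<open>\<complex>[z]\<close>.
\<close>

definition free_gmodule :: "nat \<Rightarrow> (nat \<Rightarrow> nat) \<Rightarrow> (nat \<Rightarrow> complex poly) gmodule" where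
  "free_gmodule n b =
    \<lparr>carrier = {p. (\<forall>i<n. monom 1 (b i) dvd p i) \<and> (\<forall>i\<ge>n. p i = 0)},
     mult = undefined, one = undefined,
     zero = (\<lambda>i. 0), add = (\<lambda>p q i. p i + q i),
     smult = (\<lambda>r p i. r * p i),
     hcomp = (\<lambda>k. {p. (\<forall>i<n. monom 1 (b i) dvd p i \<and> (\<exists>c. p i = monom c k)) \<and> (\<forall>i\<ge>n. p i = 0)})\<rparr>"

definition homogeneous_basis :: "'m gmodule \<Rightarrow> nat \<Rightarrow> (nat \<Rightarrow> nat) \<Rightarrow> (nat \<Rightarrow> 'm) \<Rightarrow> bool" where
  "homogeneous_basis F n b \<xi> \<longleftrightarrow>
    (\<forall>i<n. \<xi> i \<in> hcomp F (b i)) \<and>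
    (\<forall>x\<in>carrier F. \<exists>!p. p \<in> {..<n} \<rightarrow>\<^sub>E carrier Cz \<and> x = (\<Oplus>\<^bsub>F\<^esub>i\<in>{..<n}. p i \<odot>\<^bsub>F\<^esub> \<xi> i))"


section \<open>Birth and death sequences\<close>

text \<open>
  Exactness of \<open>0 \<rightarrow> F1 \<rightarrow> F0 \<rightarrow> M \<rightarrow> 0\<close>, with minimality expressed as \<open>im f \<subseteq> z F0\<close>.
  Freeness of \<open>F1\<close> and \<open>F0\<close> is imposed in \<open>has_births_deaths\<close>.
\<close>

definition minimal_graded_resolution ::
    "'k gmodule \<Rightarrow> 'l gmodule \<Rightarrow> 'm gmodule \<Rightarrow> ('k \<Rightarrow> 'l) \<Rightarrow> ('l \<Rightarrow> 'm) \<Rightarrow> bool" where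
  "minimal_graded_resolution F1 F0 M f g \<longleftrightarrow>
    graded_module F1 \<and> graded_module F0 \<and> graded_module M \<and>
    f \<in> graded_hom F1 F0 \<and> g \<in> graded_hom F0 M \<and>
    inj_on f (carrier F1) \<and>
    f ` carrier F1 = {x \<in> carrier F0. g x = \<zero>\<^bsub>M\<^esub>} \<and>
    g ` carrier F0 = carrier M \<and>
    f ` carrier F1 \<subseteq> (\<lambda>y. monom 1 1 \<odot>\<^bsub>F0\<^esub> y) ` carrier F0"

text \<open>
  A bound type variable is not available for \<open>F1\<close> and \<open>F0\<close>; letting them range over the type of
  the standard free modules loses nothing, since a resolution can be transported along the
  isomorphisms.
\<close>

definition has_births_deaths :: "'m gmodule \<Rightarrow> nat \<Rightarrow> (nat \<Rightarrow> nat) \<Rightarrow> (nat \<Rightarrow> nat) \<Rightarrow> bool" where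
  "has_births_deaths M n b d \<longleftrightarrow>
    (\<exists>(F1 :: (nat \<Rightarrow> complex poly) gmodule) (F0 :: (nat \<Rightarrow> complex poly) gmodule) f g.
      minimal_graded_resolution F1 F0 M f g \<and>
      F0 \<cong>\<^sub>g free_gmodule n b \<and> F1 \<cong>\<^sub>g free_gmodule n d)"

definition persistence_modules :: "nat \<Rightarrow> (nat \<Rightarrow> nat) \<Rightarrow> (nat \<Rightarrow> nat) \<Rightarrow> 'm gmodule set" where
  "persistence_modules n b d = {M. persistence_module M \<and> has_births_deaths M n b d}"

definition iso_rel :: "nat \<Rightarrow> (nat \<Rightarrow> nat) \<Rightarrow> (nat \<Rightarrow> nat) \<Rightarrow> ('m gmodule \<times> 'm gmodule) set" where
  "iso_rel n b d =
    {(M, N). M \<in> persistence_modules n b d \<and> N \<in> persistence_modules n b d \<and> M \<cong>\<^sub>g N}"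


section \<open>Flags and Schubert cells\<close>

definition GL :: "nat \<Rightarrow> complex mat set" where
  "GL n = {A \<in> carrier_mat n n. invertible_mat A}"

text \<open>
  A complete flag \<open>V_0 \<subset> \<dots> \<subset> V_n\<close> in \<open>\<complex>^n\<close> is a function on \<open>{..n}\<close>; the columns of \<open>A\<close> are
  numbered from \<open>0\<close>, so \<open>V_i\<close> is spanned by the columns \<open>0, \<dots>, i - 1\<close>.
\<close>

definition flag_of :: "nat \<Rightarrow> complex mat \<Rightarrow> nat \<Rightarrow> complex vec set" where
  "flag_of n A = (\<lambda>i\<in>{..n}.
    LinearCombinations.module.span class_ring (module_vec TYPE(complex) n) (col A ` {..<i}))"

abbreviation perms :: "nat \<Rightarrow> (nat \<Rightarrow> nat) set" where
  "perms n \<equiv> {w. w permutes {..<n}}"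

definition U_plus :: "nat \<Rightarrow> (nat \<Rightarrow> nat) \<Rightarrow> complex mat set" where
  "U_plus n w = {A \<in> GL n.
    (\<forall>j<n. A $$ (w j, j) = 1) \<and>
    (\<forall>i<n. \<forall>k<n. inv_into UNIV w i < k \<longrightarrow> A $$ (i, k) = 0) \<and>
    (\<forall>j<n. \<forall>k<n. w k < j \<longrightarrow> A $$ (j, k) = 0)}"

definition schubert_cell :: "nat \<Rightarrow> (nat \<Rightarrow> nat) \<Rightarrow> (nat \<Rightarrow> complex vec set) set" where
  "schubert_cell n w = flag_of n ` U_plus n w"


section \<open>The space of kernels and its cells\<close>

definition kernels :: "'f gmodule \<Rightarrow> nat \<Rightarrow> (nat \<Rightarrow> nat) \<Rightarrow> 'f set set" where
  "kernels F0 n d = {K. graded_submodule K F0 \<and> restrict_gmodule F0 K \<cong>\<^sub>g free_gmodule n d}"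

definition kernel_gen ::
    "'f gmodule \<Rightarrow> nat \<Rightarrow> (nat \<Rightarrow> nat) \<Rightarrow> (nat \<Rightarrow> nat) \<Rightarrow> (nat \<Rightarrow> 'f) \<Rightarrow> complex mat \<Rightarrow> nat \<Rightarrow> 'f" where
  "kernel_gen F0 n b d \<xi> A j =
    (\<Oplus>\<^bsub>F0\<^esub>i\<in>{..<n}. monom (A $$ (i, j)) (d j - b i) \<odot>\<^bsub>F0\<^esub> \<xi> i)"

definition kernel_of ::
    "'f gmodule \<Rightarrow> nat \<Rightarrow> (nat \<Rightarrow> nat) \<Rightarrow> (nat \<Rightarrow> nat) \<Rightarrow> (nat \<Rightarrow> 'f) \<Rightarrow> complex mat \<Rightarrow> 'f set" where
  "kernel_of F0 n b d \<xi> A =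
    LinearCombinations.module.span Cz F0 (kernel_gen F0 n b d \<xi> A ` {..<n})"

definition kernel_cell ::
    "'f gmodule \<Rightarrow> nat \<Rightarrow> (nat \<Rightarrow> nat) \<Rightarrow> (nat \<Rightarrow> nat) \<Rightarrow> (nat \<Rightarrow> 'f) \<Rightarrow> (nat \<Rightarrow> nat) \<Rightarrow> 'f set set" where
  "kernel_cell F0 n b d \<xi> w =
    kernel_of F0 n b d \<xi> ` {A \<in> GL n. flag_of n A \<in> schubert_cell n w}"

end

theory Submission
  imports Defs "Jordan_Normal_Form.Column_Operations"
begin

text \<open>
  Both sides of the correspondence are double cosets \<open>B \<setminus> GL_n / B\<close> of the group \<open>B\<close> of invertible
  upper triangular matrices.

  Write \<open>E\<close> and \<open>D\<close> for the standard free modules with generators in degrees \<open>b\<close> and \<open>d\<close>. An element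
  of either is a vector of polynomials, and homogeneous elements of degree \<open>k\<close> are vectors of
  multiples of \<open>z^k\<close>. In these coordinates every graded homomorphism between free modules is
  multiplication by a constant matrix, and the entry \<open>(i, j)\<close> may be nonzero only if the
  target degree of \<open>i\<close> does not exceed the source degree of \<open>j\<close> (\<open>act_graded_hom\<close>,
  \<open>graded_hom_free_matrix\<close>). All births precede all deaths, so every matrix defines a homomorphism
  \<open>D \<rightarrow> E\<close>; it is injective exactly for matrices in \<open>GL_n\<close> (\<open>act_inj\<close>, \<open>act_inj_imp_GL\<close>). Identifying
  \<open>E\<close> with \<open>F0\<close> by the basis \<open>\<xi>\<close>, the elements of \<open>kernels F0 n d\<close> are therefore the images \<open>A D\<close>
  with \<open>A \<in> GL_n\<close> (\<open>kernelsE\<close>, \<open>kernel_of_eq\<close>). Since degrees increase strictly, the matrices of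
  automorphisms of \<open>D\<close>, and likewise of \<open>E\<close>, are those of \<open>B\<close> (\<open>Borel_iff_act_closed\<close>). Hence
  \<open>A D = A' D\<close> forces \<open>A' \<in> A B\<close> (\<open>ker_eq_imp\<close>).

  An isomorphism \<open>F0 / A D \<cong> F0 / A' D\<close> lifts to an endomorphism of \<open>F0\<close>. In the degrees of the
  generators the submodules vanish, because deaths come later, so the lift is invertible and
  given by some \<open>C \<in> B\<close> with \<open>C A D \<subseteq> A' D\<close>. Thus the quotients are isomorphic if and only if
  \<open>A' \<in> B A B\<close> (\<open>quotient_iso_of_double_coset\<close>, \<open>double_coset_of_quotient_iso\<close>).

  On the other side, \<open>flag_of n A\<close> depends exactly on the coset \<open>A B\<close>, and lies in the Schubert cell
  of \<open>w\<close> if and only if \<open>A \<in> B w B\<close> (\<open>flag_in_schubert_cell_iff\<close>). Column reduction shows that the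
  \<open>B w B\<close> cover \<open>GL_n\<close> (\<open>U_plus_normal_form\<close>). They are disjoint because a common element of \<open>B w B\<close>
  and \<open>B w' B\<close> yields \<open>w j \<le> w' j\<close> for all \<open>j\<close>, and by symmetry equality (\<open>bruhat_cell_le\<close>).

  Finally, the quotients \<open>F0 / K\<close> exhaust the persistence modules with the given births and deaths,
  by the first isomorphism theorem applied to the map of a resolution onto its module
  (\<open>persistence_module_is_quotient\<close>), and each of them is such a module (\<open>quotient_births_deaths\<close>).
\<close>


section \<open>The Bruhat decomposition\<close>

lemma mult_mat_entry:
  assumes "A \<in> carrier_mat n n" "B \<in> carrier_mat n n" "i < n" "j < n"
  shows "(A * B) $$ (i, j) = (\<Sum>l<n. A $$ (i, l) * B $$ (l, j))"
  using assms by (auto simp: scalar_prod_def atLeast0LessThan)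

lemma GL_iff_det: "A \<in> GL n \<longleftrightarrow> A \<in> carrier_mat n n \<and> det A \<noteq> 0"
proof
  assume A: "A \<in> GL n"
  then obtain B where B: "A * B = 1\<^sub>m n" "B * A = 1\<^sub>m (dim_row B)" and Ac: "A \<in> carrier_mat n n"
    by (auto simp: GL_def invertible_mat_def inverts_mat_def)
  have "dim_col B = n" using arg_cong[OF B(1), of dim_col] by simp
  moreover have "dim_row B = n" using arg_cong[OF B(2), of dim_col] Ac by simp
  ultimately have Bc: "B \<in> carrier_mat n n" by auto
  show "A \<in> carrier_mat n n \<and> det A \<noteq> 0"
    using det_mult[OF Ac Bc, unfolded B(1)] Ac by (metis det_one mult_zero_left zero_neq_one)
next
  assume A: "A \<in> carrier_mat n n \<and> det A \<noteq> 0"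
  then have "A \<in> Units (ring_mat TYPE(complex) n ())" by (intro det_non_zero_imp_unit) auto
  then obtain B where "B \<in> carrier_mat n n" "A * B = 1\<^sub>m n" "B * A = 1\<^sub>m n"
    by (auto simp: Units_def ring_mat_def)
  then have "inverts_mat A B" "inverts_mat B A" using A by (auto simp: inverts_mat_def)
  then show "A \<in> GL n" using A unfolding GL_def invertible_mat_def by auto
qed

lemma GL_carrier [dest]: "A \<in> GL n \<Longrightarrow> A \<in> carrier_mat n n"
  by (simp add: GL_def)

lemma GL_mult: "A \<in> GL n \<Longrightarrow> B \<in> GL n \<Longrightarrow> A * B \<in> GL n"
  by (auto simp: GL_iff_det det_mult)

lemma GL_inverse:
  assumes "A \<in> GL n"
  obtains B where "B \<in> GL n" "A * B = 1\<^sub>m n" "B * A = 1\<^sub>m n"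
proof -
  have A: "A \<in> carrier_mat n n" "det A \<noteq> 0" using assms by (auto simp: GL_iff_det)
  then have "A \<in> Units (ring_mat TYPE(complex) n ())" by (intro det_non_zero_imp_unit) auto
  then obtain B where B: "B \<in> carrier_mat n n" "A * B = 1\<^sub>m n" "B * A = 1\<^sub>m n"
    by (auto simp: Units_def ring_mat_def)
  moreover have "B \<in> GL n" using B A det_mult[OF A(1) B(1)] by (auto simp: GL_iff_det)
  ultimately show thesis using that by blast
qed

text \<open>The group of invertible upper triangular matrices.\<close>

definition Borel :: "nat \<Rightarrow> complex mat set" where
  "Borel n = {C \<in> GL n. upper_triangular C}"

lemma Borel_GL [dest]: "C \<in> Borel n \<Longrightarrow> C \<in> GL n"
  by (simp add: Borel_def)

lemma Borel_carrier [dest]: "C \<in> Borel n \<Longrightarrow> C \<in> carrier_mat n n"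
  by blast

lemma Borel_entry: "C \<in> Borel n \<Longrightarrow> j < i \<Longrightarrow> i < n \<Longrightarrow> C $$ (i, j) = 0"
  by (auto simp: Borel_def GL_def)

lemma BorelI:
  assumes "C \<in> GL n" "\<And>i j. j < i \<Longrightarrow> i < n \<Longrightarrow> C $$ (i, j) = 0"
  shows "C \<in> Borel n"
  using assms GL_carrier[OF assms(1)] by (auto simp: Borel_def simp del: index_mult_mat)

lemma Borel_diag: "C \<in> Borel n \<Longrightarrow> i < n \<Longrightarrow> C $$ (i, i) \<noteq> 0"
  using upper_triangular_imp_det_eq_0_iff[of C n]
  by (auto simp: Borel_def GL_iff_det diag_mat_def)

lemma Borel_one: "1\<^sub>m n \<in> Borel n"
  by (auto simp: Borel_def GL_iff_det)

lemma Borel_mult: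
  assumes "C \<in> Borel n" "C' \<in> Borel n"
  shows "C * C' \<in> Borel n"
proof -
  have c: "C \<in> carrier_mat n n" "C' \<in> carrier_mat n n" using assms by blast+
  have "(C * C') $$ (i, j) = 0" if "j < i" "i < n" for i j
  proof -
    have "C $$ (i, l) * C' $$ (l, j) = 0" if "l < n" for l
      using Borel_entry[OF assms(1), of l i] Borel_entry[OF assms(2), of j l] that \<open>j < i\<close> \<open>i < n\<close>
      by (cases "l < i") auto
    then show ?thesis using that c by (subst mult_mat_entry[where n = n]) (auto intro!: sum.neutral)
  qed
  then show ?thesis using assms c by (auto simp: Borel_def GL_mult)
qed

lemma Borel_inverse:
  assumes "C \<in> Borel n"
  obtains D where "D \<in> Borel n" "C * D = 1\<^sub>m n" "D * C = 1\<^sub>m n"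
proof -
  have C: "C \<in> carrier_mat n n" using assms by blast
  obtain D where D: "D \<in> GL n" "C * D = 1\<^sub>m n" "D * C = 1\<^sub>m n"
    using GL_inverse assms by blast
  have Dc: "D \<in> carrier_mat n n" using D by blast
  \<comment> \<open>The lowest nonzero entry of column \<open>j\<close> of \<open>D\<close> is not cancelled in \<open>C * D\<close>.\<close>
  have "D $$ (i, j) = 0" if ij: "j < i" "i < n" for i j
  proof (rule ccontr)
    assume nz: "D $$ (i, j) \<noteq> 0"
    define I where "I = {i. j < i \<and> i < n \<and> D $$ (i, j) \<noteq> 0}"
    define m where "m = Max I"
    have I: "finite I" "I \<noteq> {}" using nz ij by (auto simp: I_def)
    have m: "j < m" "m < n" "D $$ (m, j) \<noteq> 0" using Max_in[OF I] by (auto simp: I_def m_def)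
    have above: "D $$ (l, j) = 0" if "m < l" "l < n" for l
      using that Max_ge[OF I(1), of l] m unfolding m_def[symmetric] by (auto simp: I_def)
    have "(C * D) $$ (m, j) = (\<Sum>l<n. C $$ (m, l) * D $$ (l, j))"
      using C Dc m by (intro mult_mat_entry) auto
    also have "\<dots> = (\<Sum>l<n. if l = m then C $$ (m, m) * D $$ (m, j) else 0)"
      using above Borel_entry[OF assms, of _ m] m
      by (intro sum.cong) (auto, metis linorder_neqE_nat)
    also have "\<dots> = C $$ (m, m) * D $$ (m, j)" using m by simp
    finally show False using D(2) m Borel_diag[OF assms] by simp
  qed
  then have "D \<in> Borel n" using D Dc by (auto simp: Borel_def)
  then show thesis using that D by blast
qed

text \<open>The permutation matrix that sends the basis vector \<open>j\<close> to the basis vector \<open>w j\<close>.\<close>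

definition perm_mat :: "nat \<Rightarrow> (nat \<Rightarrow> nat) \<Rightarrow> complex mat" where
  "perm_mat n w = mat n n (\<lambda>(i, j). if i = w j then 1 else 0)"

lemma perm_mat_carrier [simp]: "perm_mat n w \<in> carrier_mat n n"
  by (simp add: perm_mat_def)

lemma mult_perm_mat_entry:
  assumes "w permutes {..<n}" "A \<in> carrier_mat n n" "i < n" "j < n"
  shows "(A * perm_mat n w) $$ (i, j) = A $$ (i, w j)"
proof -
  have "w j < n" using assms permutes_in_image by fastforce
  have "(A * perm_mat n w) $$ (i, j) = (\<Sum>l<n. A $$ (i, l) * perm_mat n w $$ (l, j))"
    using assms by (intro mult_mat_entry) auto
  also have "\<dots> = (\<Sum>l<n. if l = w j then A $$ (i, l) else 0)"
    using assms by (intro sum.cong) (auto simp: perm_mat_def)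
  finally show ?thesis using \<open>w j < n\<close> by simp
qed

lemma perm_mat_mult_entry:
  assumes "w permutes {..<n}" "A \<in> carrier_mat n n" "i < n" "j < n"
  shows "(perm_mat n w * A) $$ (w i, j) = A $$ (i, j)"
proof -
  have "w i < n" using assms permutes_in_image by fastforce
  have "(perm_mat n w * A) $$ (w i, j) = (\<Sum>l<n. perm_mat n w $$ (w i, l) * A $$ (l, j))"
    using assms \<open>w i < n\<close> by (intro mult_mat_entry) auto
  also have "\<dots> = (\<Sum>l<n. if l = i then A $$ (l, j) else 0)"
    using assms \<open>w i < n\<close> permutes_inj[OF assms(1)]
    by (intro sum.cong) (auto simp: perm_mat_def inj_eq)
  finally show ?thesis using \<open>i < n\<close> by simp
qed

lemma perm_mat_inverse:
  assumes "w permutes {..<n}"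
  shows "perm_mat n (inv_into UNIV w) * perm_mat n w = 1\<^sub>m n"
proof (rule eq_matI)
  fix i j assume "i < dim_row (1\<^sub>m n :: complex mat)" "j < dim_col (1\<^sub>m n :: complex mat)"
  then have ij: "i < n" "j < n" by auto
  have "w j < n" using assms ij permutes_in_image by fastforce
  then show "(perm_mat n (inv_into UNIV w) * perm_mat n w) $$ (i, j) = 1\<^sub>m n $$ (i, j)"
    using ij assms by (subst mult_perm_mat_entry) (auto simp: perm_mat_def permutes_inverses)
qed (auto simp: perm_mat_def)

lemma perm_mat_GL:
  assumes "w permutes {..<n}"
  shows "perm_mat n w \<in> GL n"
proof -
  have "det (perm_mat n (inv_into UNIV w)) * det (perm_mat n w) = 1"
    using perm_mat_inverse[OF assms] det_mult[of "perm_mat n (inv_into UNIV w)" n "perm_mat n w"] by simp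
  then show ?thesis by (auto simp: GL_iff_det)
qed

text \<open>The double coset \<open>B w B\<close>.\<close>

definition bruhat_cell :: "nat \<Rightarrow> (nat \<Rightarrow> nat) \<Rightarrow> complex mat set" where
  "bruhat_cell n w = {C * perm_mat n w * C' | C C'. C \<in> Borel n \<and> C' \<in> Borel n}"

lemma bruhat_cell_mult:
  assumes "A \<in> bruhat_cell n w" "C \<in> Borel n" "C' \<in> Borel n"
  shows "C * A * C' \<in> bruhat_cell n w"
proof -
  obtain D D' where D: "D \<in> Borel n" "D' \<in> Borel n" "A = D * perm_mat n w * D'"
    using assms by (auto simp: bruhat_cell_def)
  note [simp] = Borel_carrier[OF D(1)] Borel_carrier[OF D(2)] Borel_carrier[OF assms(2)]
    Borel_carrier[OF assms(3)]
  have 1: "C * A = (C * D) * perm_mat n w * D'"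
    unfolding D(3) by (simp add: assoc_mult_mat[of _ n n _ n _ n] mult_carrier_mat[of _ n n _ n] del: carrier_matD)
  have "C * A * C' = (C * D) * perm_mat n w * (D' * C')"
    unfolding 1 by (rule assoc_mult_mat[of _ n n _ n _ n])
      (simp_all add: mult_carrier_mat[of _ n n _ n] del: carrier_matD)
  then show ?thesis using D assms Borel_mult unfolding bruhat_cell_def by blast
qed

lemma bruhat_cell_same:
  assumes "A \<in> bruhat_cell n w" "A' \<in> bruhat_cell n w"
  obtains C C' where "C \<in> Borel n" "C' \<in> Borel n" "A' = C * A * C'"
proof -
  obtain D D' where D: "D \<in> Borel n" "D' \<in> Borel n" "A = D * perm_mat n w * D'"
    using assms by (auto simp: bruhat_cell_def)
  obtain G G' where G: "G \<in> Borel n" "G' \<in> Borel n" "A' = G * perm_mat n w * G'"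
    using assms by (auto simp: bruhat_cell_def)
  obtain E where E: "E \<in> Borel n" "E * D = 1\<^sub>m n" using Borel_inverse[OF D(1)] by blast
  obtain E' where E': "E' \<in> Borel n" "D' * E' = 1\<^sub>m n" using Borel_inverse[OF D(2)] by blast
  note [simp] = Borel_carrier[OF D(1)] Borel_carrier[OF D(2)] Borel_carrier[OF G(1)]
    Borel_carrier[OF G(2)] Borel_carrier[OF E(1)] Borel_carrier[OF E'(1)]
  have "(G * E) * A * (E' * G') = G * (E * D) * perm_mat n w * (D' * E') * G'"
    unfolding D(3) by (simp add: assoc_mult_mat[of _ n n _ n _ n] mult_carrier_mat[of _ n n _ n] del: carrier_matD)
  also have "\<dots> = A'" unfolding E(2) E'(2) G(3)
    by (simp add: right_mult_one_mat[of _ n n] mult_carrier_mat[of _ n n _ n] del: carrier_matD)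
  finally show thesis using that E E' G Borel_mult by metis
qed

text \<open>
  From \<open>P_w C = C' P_w'\<close> with \<open>C\<close>, \<open>C'\<close> upper triangular, the nonzero diagonal entry \<open>(j, j)\<close> of \<open>C\<close>
  is the entry \<open>(w j, w' j)\<close> of \<open>C'\<close>.
\<close>

lemma bruhat_cell_le:
  assumes w: "w permutes {..<n}" "w' permutes {..<n}"
    and A: "A \<in> bruhat_cell n w" "A \<in> bruhat_cell n w'" and j: "j < n"
  shows "w j \<le> w' j"
proof -
  obtain D D' where D: "D \<in> Borel n" "D' \<in> Borel n" "A = D * perm_mat n w * D'"
    using A by (auto simp: bruhat_cell_def)
  obtain G G' where G: "G \<in> Borel n" "G' \<in> Borel n" "A = G * perm_mat n w' * G'"
    using A by (auto simp: bruhat_cell_def)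
  obtain E where E: "E \<in> Borel n" "E * D = 1\<^sub>m n" using Borel_inverse[OF D(1)] by blast
  obtain E' where E': "E' \<in> Borel n" "G' * E' = 1\<^sub>m n" using Borel_inverse[OF G(2)] by blast
  note [simp] = Borel_carrier[OF D(1)] Borel_carrier[OF D(2)] Borel_carrier[OF G(1)]
    Borel_carrier[OF G(2)] Borel_carrier[OF E(1)] Borel_carrier[OF E'(1)]
  have l: "E * A * E' = (E * D) * (perm_mat n w * (D' * E'))"
    unfolding D(3) by (simp add: assoc_mult_mat[of _ n n _ n _ n] mult_carrier_mat[of _ n n _ n] del: carrier_matD)
  have r: "E * A * E' = (E * G * perm_mat n w') * (G' * E')"
    unfolding G(3) by (simp add: assoc_mult_mat[of _ n n _ n _ n] mult_carrier_mat[of _ n n _ n] del: carrier_matD)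
  have eq: "perm_mat n w * (D' * E') = E * G * perm_mat n w'"
    using trans[OF l[symmetric] r] unfolding E(2) E'(2)
    by (simp add: left_mult_one_mat[of _ n n] right_mult_one_mat[of _ n n] mult_carrier_mat[of _ n n _ n]
        del: carrier_matD)
  have wj: "w j < n" "w' j < n" using w j permutes_in_image by fastforce+
  have "(D' * E') $$ (j, j) = (perm_mat n w * (D' * E')) $$ (w j, j)"
    using w j Borel_carrier[OF Borel_mult[OF D(2) E'(1)]] by (intro perm_mat_mult_entry[symmetric]) auto
  also have "\<dots> = (E * G) $$ (w j, w' j)"
    unfolding eq using w j wj Borel_carrier[OF Borel_mult[OF E(1) G(1)]]
    by (intro mult_perm_mat_entry) auto
  finally have "(E * G) $$ (w j, w' j) \<noteq> 0"
    using Borel_diag[OF Borel_mult[OF D(2) E'(1)] j] by simp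
  then show ?thesis
    using Borel_entry[OF Borel_mult[OF E(1) G(1)], of "w' j" "w j"] wj by (meson not_le)
qed

lemma bruhat_cell_disjoint:
  assumes "w permutes {..<n}" "w' permutes {..<n}" "A \<in> bruhat_cell n w" "A \<in> bruhat_cell n w'"
  shows "w = w'"
proof
  fix j
  show "w j = w' j"
    using bruhat_cell_le[OF assms, of j] bruhat_cell_le[OF assms(2,1,4,3), of j]
      permutes_not_in[OF assms(1), of j] permutes_not_in[OF assms(2), of j]
    by (cases "j < n") auto
qed

lemma bruhat_cell_GL:
  assumes "w permutes {..<n}" "A \<in> bruhat_cell n w" shows "A \<in> GL n"
proof -
  obtain C C' where "C \<in> Borel n" "C' \<in> Borel n" "A = C * perm_mat n w * C'"
    using assms(2) by (auto simp: bruhat_cell_def)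
  then show ?thesis using GL_mult[OF GL_mult[OF Borel_GL perm_mat_GL[OF assms(1)]] Borel_GL] by simp
qed

lemma perm_mat_bruhat_cell: "perm_mat n w \<in> bruhat_cell n w"
  unfolding bruhat_cell_def using Borel_one
  by (intro CollectI exI[of _ "1\<^sub>m n"]) (auto simp: left_mult_one_mat[of _ n n] right_mult_one_mat[of _ n n])

text \<open>Permuting the columns of a matrix in \<open>U_plus n w\<close> by \<open>w\<close> makes it upper triangular.\<close>

lemma U_plus_bruhat_cell:
  assumes w: "w permutes {..<n}" and U: "U \<in> U_plus n w"
  shows "U \<in> bruhat_cell n w"
proof -
  let ?v = "inv_into UNIV w"
  have v: "?v permutes {..<n}" using w by (rule permutes_inv)
  have UG: "U \<in> GL n" and Uc: "U \<in> carrier_mat n n" using U by (auto simp: U_plus_def)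
  have "(U * perm_mat n ?v) $$ (i, j) = 0" if "j < i" "i < n" for i j
  proof -
    have "?v j < n" using v that permutes_in_image by fastforce
    then have "U $$ (i, ?v j) = 0" using U that w by (auto simp: U_plus_def permutes_inverses)
    then show ?thesis using mult_perm_mat_entry[OF v Uc] that by simp
  qed
  then have B: "U * perm_mat n ?v \<in> Borel n"
    using GL_mult[OF UG perm_mat_GL[OF v]] by (intro BorelI) auto
  have "U * perm_mat n ?v * perm_mat n w * 1\<^sub>m n = U * (perm_mat n ?v * perm_mat n w)"
    using Uc by (simp add: assoc_mult_mat[of _ n n _ n _ n] right_mult_one_mat[of _ n n] mult_carrier_mat[of _ n n _ n])
  also have "\<dots> = U" using Uc perm_mat_inverse[OF w] by simp
  finally have "U = U * perm_mat n ?v * perm_mat n w * 1\<^sub>m n" by simp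
  then show ?thesis unfolding bruhat_cell_def using B Borel_one by blast
qed

lemma perm_mat_U_plus:
  assumes "w permutes {..<n}"
  shows "perm_mat n w \<in> U_plus n w"
proof -
  have "w j < n" if "j < n" for j using assms that permutes_in_image by fastforce
  then show ?thesis using perm_mat_GL[OF assms] assms
    by (auto simp: U_plus_def perm_mat_def permutes_inverses)
qed


section \<open>Column reduction\<close>

text \<open>
  The first \<open>k\<close> columns of \<open>A\<close> satisfy the defining conditions of \<open>U_plus n w\<close>: column \<open>j\<close> has a pivot 1
  in row \<open>w j\<close>, zeros below it, and zeros in the pivot rows of the earlier columns.
\<close>

definition col_reduced :: "nat \<Rightarrow> nat \<Rightarrow> complex mat \<Rightarrow> (nat \<Rightarrow> nat) \<Rightarrow> bool" where
  "col_reduced n k A w \<longleftrightarrow> inj_on w {..<k} \<and> w ` {..<k} \<subseteq> {..<n} \<and>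
    (\<forall>j<k. A $$ (w j, j) = 1 \<and> (\<forall>i<n. w j < i \<longrightarrow> A $$ (i, j) = 0) \<and> (\<forall>l<j. A $$ (w l, j) = 0))"

lemma addrow_mat_Borel: "m < k \<Longrightarrow> k < n \<Longrightarrow> addrow_mat n a m k \<in> Borel n"
  by (intro BorelI) (auto simp: GL_iff_det det_addrow_mat)

lemma multrow_mat_Borel:
  assumes "k < n" "a \<noteq> 0" shows "multrow_mat n k a \<in> Borel n"
proof -
  have "det (multrow_mat n k a) * det (multrow_mat n k (inverse a)) = 1"
    using multrow_mat_inv[OF assms] det_mult[of "multrow_mat n k a" n] by (metis det_one multrow_mat_carrier)
  then show ?thesis by (auto simp: Borel_def GL_iff_det)
qed

text \<open>
  Subtracting multiples of the columns \<open>0, 1, \<dots>\<close> in this order clears column \<open>k\<close> in the first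
  pivot rows one after another: column \<open>m\<close> vanishes in the pivot rows of the columns before \<open>m\<close>, so
  entries already cleared remain zero.
\<close>

lemma clear_pivot_rows:
  assumes A: "A \<in> carrier_mat n n" and k: "k < n" and red: "col_reduced n k A w" and "m \<le> k"
  shows "\<exists>C\<in>Borel n. (\<forall>i<n. \<forall>j<n. j \<noteq> k \<longrightarrow> (A * C) $$ (i, j) = A $$ (i, j)) \<and>
    (\<forall>l<m. (A * C) $$ (w l, k) = 0)"
  using \<open>m \<le> k\<close>
proof (induction m)
  case 0
  then show ?case using A Borel_one right_mult_one_mat[OF A] by (intro bexI[of _ "1\<^sub>m n"]) auto
next
  case (Suc m)
  then obtain C where C: "C \<in> Borel n" "\<And>i j. i < n \<Longrightarrow> j < n \<Longrightarrow> j \<noteq> k \<Longrightarrow> (A * C) $$ (i, j) = A $$ (i, j)"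
    "\<And>l. l < m \<Longrightarrow> (A * C) $$ (w l, k) = 0" by auto
  have Cc: "C \<in> carrier_mat n n" using C by blast
  let ?a = "- (A * C) $$ (w m, k)"
  let ?E = "addrow_mat n ?a m k"
  have m: "m < k" "m < n" using Suc k by auto
  have AC: "A * C \<in> carrier_mat n n" using A Cc by simp
  have *: "A * (C * ?E) = addcol ?a k m (A * C)"
    using addcol_mat[OF AC, of m ?a k] m A Cc by (simp add: assoc_mult_mat[of _ n n _ n _ n])
  have w: "w l < n" if "l \<le> m" for l
    using red le_less_trans[OF that m(1)] by (auto simp: col_reduced_def)
  have pos: "A $$ (w l, m) = (if l = m then 1 else 0)" if "l \<le> m" for l
    using red that m le_less_trans[OF that m(1)] by (auto simp: col_reduced_def)
  have ent: "(A * (C * ?E)) $$ (i, j) = (if j = k then ?a * (A * C) $$ (i, m) + (A * C) $$ (i, j) else (A * C) $$ (i, j))"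
    if "i < n" "j < n" for i j
    unfolding * using that AC A Cc by (subst index_mat_addcol) auto
  have "(A * (C * ?E)) $$ (w l, k) = 0" if "l < Suc m" for l
  proof -
    have "(A * C) $$ (w l, m) = A $$ (w l, m)" using C(2)[of "w l" m] w m that by simp
    then show ?thesis
      using that w[of l] k ent[of "w l" k] pos[of l] C(3)[of l] by (cases "l = m") auto
  qed
  moreover have "C * ?E \<in> Borel n" using C addrow_mat_Borel m k Borel_mult by blast
  moreover have "(A * (C * ?E)) $$ (i, j) = A $$ (i, j)" if "i < n" "j < n" "j \<noteq> k" for i j
    using ent[OF that(1,2)] C(2)[OF that] that by simp
  ultimately show ?case by blast
qed

lemma GL_col_nonzero:
  assumes "A \<in> GL n" "k < n" shows "\<exists>i<n. A $$ (i, k) \<noteq> 0"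
proof (rule ccontr)
  assume z: "\<not> ?thesis"
  obtain B where B: "B \<in> GL n" "B * A = 1\<^sub>m n" using GL_inverse[OF assms(1)] by blast
  have "(B * A) $$ (k, k) = (\<Sum>l<n. B $$ (k, l) * A $$ (l, k))"
    using B assms by (intro mult_mat_entry) auto
  also have "\<dots> = 0" using z by auto
  finally show False using B assms by simp
qed

lemma col_reduced_step:
  assumes A: "A \<in> GL n" and k: "k < n" and red: "col_reduced n k A w"
  shows "\<exists>C\<in>Borel n. \<exists>w'. col_reduced n (Suc k) (A * C) w'"
proof -
  obtain C where C: "C \<in> Borel n" "\<And>i j. i < n \<Longrightarrow> j < n \<Longrightarrow> j \<noteq> k \<Longrightarrow> (A * C) $$ (i, j) = A $$ (i, j)"
    "\<And>l. l < k \<Longrightarrow> (A * C) $$ (w l, k) = 0"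
    using clear_pivot_rows[OF GL_carrier[OF A] k red order_refl] by auto
  have c [simp]: "A \<in> carrier_mat n n" "C \<in> carrier_mat n n" using A C by blast+
  \<comment> \<open>The new pivot is the lowest nonzero entry of the cleared column.\<close>
  define I where "I = {i. i < n \<and> (A * C) $$ (i, k) \<noteq> 0}"
  define r where "r = Max I"
  have I: "finite I" "I \<noteq> {}"
    using GL_col_nonzero[OF GL_mult[OF A Borel_GL[OF C(1)]] k] by (auto simp: I_def)
  have r: "r < n" "(A * C) $$ (r, k) \<noteq> 0" using Max_in[OF I] by (auto simp: I_def r_def)
  have above: "(A * C) $$ (l, k) = 0" if "r < l" "l < n" for l
    using that Max_ge[OF I(1), of l] r unfolding r_def[symmetric] by (auto simp: I_def)
  define x where "x = inverse ((A * C) $$ (r, k))"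
  let ?E = "multrow_mat n k x"
  have *: "A * (C * ?E) = multcol k x (A * C)"
    using multcol_mat[of "A * C" n n k x] GL_carrier[OF GL_mult[OF A Borel_GL[OF C(1)]]]
    by (simp add: assoc_mult_mat[of _ n n _ n _ n])
  have ent: "(A * (C * ?E)) $$ (i, j) = (if j = k then x * (A * C) $$ (i, j) else A $$ (i, j))"
    if "i < n" "j < n" for i j
    unfolding * using that GL_carrier[OF GL_mult[OF A Borel_GL[OF C(1)]]] C(2)[of i j]
    by (subst index_mat_multcol) (auto simp del: index_mult_mat)
  have w: "w l < n" if "l < k" for l using red that by (auto simp: col_reduced_def)
  have rw: "r \<noteq> w l" if "l < k" for l using C(3)[OF that] r by auto
  have "col_reduced n (Suc k) (A * (C * ?E)) (w(k := r))"
    unfolding col_reduced_def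
  proof (intro conjI allI impI)
    show "inj_on (w(k := r)) {..<Suc k}"
      using red by (auto simp: col_reduced_def inj_on_def less_Suc_eq) (metis rw)+
    show "(w(k := r)) ` {..<Suc k} \<subseteq> {..<n}" using w r by (auto simp: less_Suc_eq)
    fix j assume "j < Suc k"
    then consider "j = k" | "j < k" by linarith
    note jk = this
    show "(A * (C * ?E)) $$ ((w(k := r)) j, j) = 1"
      using jk by cases (use ent r k w red in \<open>auto simp: x_def col_reduced_def\<close>)
    show "(A * (C * ?E)) $$ (i, j) = 0" if "i < n" "(w(k := r)) j < i" for i
      using jk by cases (use that ent above k w red in \<open>auto simp: col_reduced_def\<close>)
    show "(A * (C * ?E)) $$ ((w(k := r)) l, j) = 0" if "l < j" for l
      using jk by cases (use that ent C(3) k w red in \<open>auto simp: col_reduced_def\<close>)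
  qed
  moreover have "C * ?E \<in> Borel n"
    using C(1) r multrow_mat_Borel[OF k, of x] by (auto simp: x_def intro: Borel_mult)
  ultimately show ?thesis by blast
qed

lemma col_reduced_exists:
  assumes A: "A \<in> GL n" and "k \<le> n"
  shows "\<exists>C\<in>Borel n. \<exists>w. col_reduced n k (A * C) w"
  using \<open>k \<le> n\<close>
proof (induction k)
  case 0
  then show ?case using Borel_one by (auto simp: col_reduced_def)
next
  case (Suc k)
  then obtain C w where C: "C \<in> Borel n" "col_reduced n k (A * C) w" by auto
  obtain D w' where D: "D \<in> Borel n" "col_reduced n (Suc k) (A * C * D) w'"
    using col_reduced_step[OF GL_mult[OF A Borel_GL[OF C(1)]] _ C(2)] Suc.prems by auto
  have "A * C * D = A * (C * D)"
    using A C D by (intro assoc_mult_mat[of _ n n _ n _ n] GL_carrier Borel_carrier)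
  then show ?case using C D Borel_mult by metis
qed

lemma U_plus_normal_form:
  assumes A: "A \<in> GL n"
  obtains C w where "C \<in> Borel n" "w permutes {..<n}" "A * C \<in> U_plus n w"
proof -
  obtain C w where C: "C \<in> Borel n" and red: "col_reduced n n (A * C) w"
    using col_reduced_exists[OF A order_refl] by blast
  \<comment> \<open>\<open>w\<close> is arbitrary outside \<open>{..<n}\<close>, whereas a permutation of \<open>{..<n}\<close> is the identity there.\<close>
  define w' where "w' = (\<lambda>i. if i < n then w i else i)"
  have "inj_on w' {..<n}" "w' ` {..<n} \<subseteq> {..<n}"
    using red by (auto simp: col_reduced_def w'_def inj_on_def)
  then have "bij_betw w' {..<n} {..<n}"
    by (simp add: bij_betw_def endo_inj_surj)
  then have w': "w' permutes {..<n}" by (rule bij_imp_permutes) (simp add: w'_def)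
  have "(A * C) $$ (i, k) = 0" if "i < n" "k < n" "inv_into UNIV w' i < k" for i k
  proof -
    have "w' (inv_into UNIV w' i) = i" using permutes_inverses[OF w'] by simp
    moreover have "inv_into UNIV w' i < n" using that by simp
    ultimately have "w (inv_into UNIV w' i) = i" by (simp add: w'_def)
    then show ?thesis using red that by (metis col_reduced_def)
  qed
  then have "A * C \<in> U_plus n w'"
    using red GL_mult[OF A Borel_GL[OF C]]
    by (auto simp: U_plus_def col_reduced_def w'_def simp del: index_mult_mat)
  then show thesis using that C w' by blast
qed


section \<open>Flags and Schubert cells\<close>

lemma span_cols:
  assumes A: "A \<in> carrier_mat n n" and "i \<le> n"
  shows "LinearCombinations.module.span class_ring (module_vec TYPE(complex) n) (col A ` {..<i}) =
    {A *\<^sub>v c | c. c \<in> carrier_vec n \<and> (\<forall>l<n. i \<le> l \<longrightarrow> c $ l = 0)}" (is "?S = ?R")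
proof
  interpret V: vec_module "TYPE(complex)" n .
  have S: "col A ` {..<i} \<subseteq> carrier_vec n" using A by auto
  have colA: "col A l = A *\<^sub>v unit_vec n l" if "l < n" for l
    using A that by (intro eq_vecI) auto
  have sub: "LinearCombinations.submodule class_ring ?R (module_vec TYPE(complex) n)"
  proof
    show "?R \<subseteq> carrier (module_vec TYPE(complex) n)" using A by (auto simp: module_vec_simps)
    show "\<zero>\<^bsub>module_vec TYPE(complex) n\<^esub> \<in> ?R"
      using A by (auto simp: module_vec_simps intro!: exI[of _ "0\<^sub>v n"] eq_vecI)
  next
    fix x y assume "x \<in> ?R" "y \<in> ?R"
    then obtain c d where "x = A *\<^sub>v c" "y = A *\<^sub>v d" "c \<in> carrier_vec n" "d \<in> carrier_vec n"
      "\<forall>l<n. i \<le> l \<longrightarrow> c $ l = 0" "\<forall>l<n. i \<le> l \<longrightarrow> d $ l = 0" by blast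
    then show "x \<oplus>\<^bsub>module_vec TYPE(complex) n\<^esub> y \<in> ?R"
      using A by (auto simp: module_vec_simps mult_add_distrib_mat_vec intro!: exI[of _ "c + d"])
  next
    fix a x assume "x \<in> ?R"
    then obtain c where "x = A *\<^sub>v c" "c \<in> carrier_vec n" "\<forall>l<n. i \<le> l \<longrightarrow> c $ l = 0" by blast
    then show "a \<odot>\<^bsub>module_vec TYPE(complex) n\<^esub> x \<in> ?R"
      using A by (auto simp: module_vec_simps mult_mat_vec intro!: exI[of _ "a \<cdot>\<^sub>v c"])
  qed
  have gens: "col A ` {..<i} \<subseteq> ?R"
  proof
    fix x assume "x \<in> col A ` {..<i}"
    then obtain l where "l < i" "x = A *\<^sub>v unit_vec n l" using colA \<open>i \<le> n\<close> by auto
    then show "x \<in> ?R" by (auto intro!: exI[of _ "unit_vec n l"])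
  qed
  show "?S \<subseteq> ?R"
    by (rule V.span_is_subset[OF gens sub])
  have sub: "LinearCombinations.submodule class_ring ?S (module_vec TYPE(complex) n)"
    using V.span_is_submodule[OF S] .
  show "?R \<subseteq> ?S"
  proof
    fix x assume "x \<in> ?R"
    then obtain c where c: "x = A *\<^sub>v c" "c \<in> carrier_vec n" "\<And>l. l < n \<Longrightarrow> i \<le> l \<Longrightarrow> c $ l = 0"
      by blast
    define p where "p m = vec n (\<lambda>l. if l < m then c $ l else 0)" for m
    have "A *\<^sub>v p m \<in> ?S" if "m \<le> i" for m
      using that
    proof (induction m)
      case 0
      have "A *\<^sub>v p 0 = 0\<^sub>v n" using A by (intro eq_vecI) (auto simp: p_def scalar_prod_def)
      then show ?case using LinearCombinations.submodule.zero_closed[OF sub] by (simp add: module_vec_simps)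
    next
      case (Suc m)
      have "p (Suc m) = p m + c $ m \<cdot>\<^sub>v unit_vec n m" using Suc \<open>i \<le> n\<close>
        by (intro eq_vecI) (auto simp: p_def less_Suc_eq)
      then have "A *\<^sub>v p (Suc m) = A *\<^sub>v p m + c $ m \<cdot>\<^sub>v col A m"
        using A Suc \<open>i \<le> n\<close> colA[of m]
        by (simp add: mult_add_distrib_mat_vec[of _ n n] mult_mat_vec[of _ n n] p_def)
      moreover have "col A m \<in> ?S" using V.in_own_span[OF S] Suc by auto
      ultimately show ?case
        using Suc LinearCombinations.submodule.m_closed[OF sub]
          LinearCombinations.submodule.smult_closed[OF sub] by (auto simp: module_vec_simps)
    qed
    moreover have "p i = c" using c by (intro eq_vecI) (auto simp: p_def not_less)
    ultimately show "x \<in> ?S" using c by auto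
  qed
qed

lemma flag_of_eq:
  assumes "A \<in> carrier_mat n n" "i \<le> n"
  shows "flag_of n A i = {A *\<^sub>v c | c. c \<in> carrier_vec n \<and> (\<forall>l<n. i \<le> l \<longrightarrow> c $ l = 0)}"
  using span_cols[OF assms] assms(2) by (simp add: flag_of_def)

lemma flag_of_mult_subset:
  assumes A: "A \<in> GL n" and C: "C \<in> Borel n" and "i \<le> n"
  shows "flag_of n (A * C) i \<subseteq> flag_of n A i"
proof -
  have c: "A \<in> carrier_mat n n" "C \<in> carrier_mat n n" using assms by blast+
  have "\<exists>c'. A * C *\<^sub>v c = A *\<^sub>v c' \<and> c' \<in> carrier_vec n \<and> (\<forall>l<n. i \<le> l \<longrightarrow> c' $ l = 0)"
    if "c \<in> carrier_vec n" "\<forall>l<n. i \<le> l \<longrightarrow> c $ l = 0" for c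
  proof (intro exI[of _ "C *\<^sub>v c"] conjI allI impI)
    fix l assume "l < n" "i \<le> l"
    have "(C *\<^sub>v c) $ l = (\<Sum>m<n. C $$ (l, m) * c $ m)"
      using \<open>l < n\<close> c that by (auto simp: scalar_prod_def atLeast0LessThan)
    also have "\<dots> = 0"
      using that Borel_entry[OF C, of _ l] \<open>l < n\<close> \<open>i \<le> l\<close>
      by (intro sum.neutral) (metis lessThan_iff mult_zero_left mult_zero_right not_le order_trans)
    finally show "(C *\<^sub>v c) $ l = 0" .
  qed (use c that in auto)
  then show ?thesis
    unfolding flag_of_eq[OF c(1) \<open>i \<le> n\<close>] flag_of_eq[OF mult_carrier_mat[OF c] \<open>i \<le> n\<close>] by auto
qed

lemma flag_of_mult:
  assumes A: "A \<in> GL n" and C: "C \<in> Borel n"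
  shows "flag_of n (A * C) = flag_of n A"
proof
  fix i
  obtain D where D: "D \<in> Borel n" "C * D = 1\<^sub>m n" using Borel_inverse[OF C] by blast
  have c: "A \<in> carrier_mat n n" "C \<in> carrier_mat n n" "D \<in> carrier_mat n n" using assms D by blast+
  have "A * C * D = A" using c D by (simp add: assoc_mult_mat[of _ n n _ n _ n])
  then have "flag_of n A i \<subseteq> flag_of n (A * C) i" if "i \<le> n"
    using flag_of_mult_subset[OF GL_mult[OF A Borel_GL[OF C]] D(1) that] by simp
  then show "flag_of n (A * C) i = flag_of n A i"
    using flag_of_mult_subset[OF A C, of i] by (cases "i \<le> n") (auto simp: flag_of_def)
qed

text \<open>
  With \<open>flag_of_mult\<close>: two invertible matrices have the same flag if and only if they lie in the same
  coset of the group of upper triangular matrices.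
\<close>

lemma flag_of_eq_imp_Borel:
  assumes A: "A \<in> GL n" and A': "A' \<in> GL n" and eq: "flag_of n A = flag_of n A'"
  obtains C where "C \<in> Borel n" "A' = A * C"
proof -
  have c: "A \<in> carrier_mat n n" "A' \<in> carrier_mat n n" using assms by blast+
  obtain B where B: "B \<in> GL n" "A * B = 1\<^sub>m n" "B * A = 1\<^sub>m n" using GL_inverse[OF A] by blast
  have Bc: "B \<in> carrier_mat n n" using B by blast
  have *: "(B * A') $$ (l, j) = 0" if "j < l" "l < n" for l j
  proof -
    have jn: "Suc j \<le> n" using that by simp
    have "col A' j = A' *\<^sub>v unit_vec n j" using c that by (intro eq_vecI) auto
    then have "col A' j \<in> flag_of n A' (Suc j)"
      using that by (subst flag_of_eq[OF c(2)]) (auto intro!: exI[of _ "unit_vec n j"])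
    then have "col A' j \<in> flag_of n A (Suc j)" using eq by simp
    then obtain v where v: "col A' j = A *\<^sub>v v" "v \<in> carrier_vec n" "\<forall>l<n. Suc j \<le> l \<longrightarrow> v $ l = 0"
      using flag_of_eq[OF c(1) jn] by auto
    have "col (B * A') j = B *\<^sub>v col A' j" using that c by (intro col_mult2[of _ n n _ n]) (use Bc in auto)
    also have "\<dots> = (B * A) *\<^sub>v v" unfolding v(1) using c Bc v(2) by (intro assoc_mult_mat_vec[symmetric, of _ n n _ n]) auto
    finally have "col (B * A') j = v" unfolding B using v by simp
    moreover have "(B * A') $$ (l, j) = col (B * A') j $ l" using that c Bc by simp
    ultimately show ?thesis using v that by simp
  qed
  have "B * A' \<in> Borel n" using GL_mult[OF B(1) A'] Bc * by (auto simp: Borel_def)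
  moreover have "A' = A * (B * A')"
    using c Bc B(2) by (simp flip: assoc_mult_mat[of _ n n _ n _ n])
  ultimately show thesis using that by blast
qed

lemma flag_in_schubert_cell_iff:
  assumes A: "A \<in> GL n" and w: "w permutes {..<n}"
  shows "flag_of n A \<in> schubert_cell n w \<longleftrightarrow> A \<in> bruhat_cell n w"
proof
  assume "flag_of n A \<in> schubert_cell n w"
  then obtain U where U: "U \<in> U_plus n w" "flag_of n U = flag_of n A"
    by (auto simp: schubert_cell_def)
  then obtain C where "C \<in> Borel n" "A = U * C"
    using flag_of_eq_imp_Borel[OF _ A] by (metis (no_types, lifting) U_plus_def mem_Collect_eq)
  moreover have "U \<in> carrier_mat n n" using U by (auto simp: U_plus_def)
  ultimately show "A \<in> bruhat_cell n w"
    using bruhat_cell_mult[OF U_plus_bruhat_cell[OF w U(1)] Borel_one, of C] by simp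
next
  assume Aw: "A \<in> bruhat_cell n w"
  obtain C w' where C: "C \<in> Borel n" and w': "w' permutes {..<n}" and U: "A * C \<in> U_plus n w'"
    using U_plus_normal_form[OF A] by blast
  have "A * C \<in> bruhat_cell n w"
    using bruhat_cell_mult[OF Aw Borel_one C] A by auto
  then have "w' = w" using bruhat_cell_disjoint[OF w' w] U_plus_bruhat_cell[OF w' U] by blast
  then show "flag_of n A \<in> schubert_cell n w"
    using U flag_of_mult[OF A C] unfolding schubert_cell_def by (metis image_eqI)
qed

lemma bruhat_cell_cover:
  assumes A: "A \<in> GL n"
  obtains w where "w permutes {..<n}" "A \<in> bruhat_cell n w"
proof -
  obtain C w where C: "C \<in> Borel n" and w: "w permutes {..<n}" and U: "A * C \<in> U_plus n w"
    using U_plus_normal_form[OF A] by blast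
  have "flag_of n A \<in> schubert_cell n w"
    using U flag_of_mult[OF A C] unfolding schubert_cell_def by (metis image_eqI)
  then show thesis using that w flag_in_schubert_cell_iff[OF A w] by blast
qed

lemma inj_on_schubert_cell: "inj_on (schubert_cell n) (perms n)"
proof (rule inj_onI)
  fix w w' assume w: "w \<in> perms n" "w' \<in> perms n" and eq: "schubert_cell n w = schubert_cell n w'"
  have "flag_of n (perm_mat n w) \<in> schubert_cell n w"
    using perm_mat_U_plus w by (simp add: schubert_cell_def)
  then have "flag_of n (perm_mat n w) \<in> schubert_cell n w'" using eq by simp
  then have "perm_mat n w \<in> bruhat_cell n w'"
    using flag_in_schubert_cell_iff[OF perm_mat_GL] w by simp
  then show "w = w'"
    using bruhat_cell_disjoint[OF _ _ perm_mat_bruhat_cell] w by simp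
qed


section \<open>Graded homomorphisms and homogeneous parts\<close>

lemma cring_Cz: "cring Cz"
  by unfold_locales

lemma graded_homI:
  assumes "\<And>x. x \<in> carrier M \<Longrightarrow> f x \<in> carrier N"
    and "\<And>x y. x \<in> carrier M \<Longrightarrow> y \<in> carrier M \<Longrightarrow> f (x \<oplus>\<^bsub>M\<^esub> y) = f x \<oplus>\<^bsub>N\<^esub> f y"
    and "\<And>r x. x \<in> carrier M \<Longrightarrow> f (r \<odot>\<^bsub>M\<^esub> x) = r \<odot>\<^bsub>N\<^esub> f x"
    and "\<And>k x. x \<in> hcomp M k \<Longrightarrow> f x \<in> hcomp N k"
  shows "f \<in> graded_hom M N"
  using assms by (auto simp: graded_hom_def LinearCombinations.module_hom_def)

lemma graded_hom_closed: "f \<in> graded_hom M N \<Longrightarrow> x \<in> carrier M \<Longrightarrow> f x \<in> carrier N"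
  by (auto simp: graded_hom_def LinearCombinations.module_hom_def)

lemma graded_hom_add:
  "f \<in> graded_hom M N \<Longrightarrow> x \<in> carrier M \<Longrightarrow> y \<in> carrier M \<Longrightarrow> f (x \<oplus>\<^bsub>M\<^esub> y) = f x \<oplus>\<^bsub>N\<^esub> f y"
  by (auto simp: graded_hom_def LinearCombinations.module_hom_def)

lemma graded_hom_smult:
  "f \<in> graded_hom M N \<Longrightarrow> x \<in> carrier M \<Longrightarrow> f (r \<odot>\<^bsub>M\<^esub> x) = r \<odot>\<^bsub>N\<^esub> f x"
  by (auto simp: graded_hom_def LinearCombinations.module_hom_def)

lemma graded_hom_hcomp: "f \<in> graded_hom M N \<Longrightarrow> x \<in> hcomp M k \<Longrightarrow> f x \<in> hcomp N k"
  by (auto simp: graded_hom_def)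

lemma graded_hom_comp:
  assumes "f \<in> graded_hom M N" "g \<in> graded_hom N P"
  shows "(\<lambda>x. g (f x)) \<in> graded_hom M P"
  using assms by (intro graded_homI) (simp_all add: graded_hom_closed graded_hom_add graded_hom_smult graded_hom_hcomp)

lemma graded_hom_id: "(\<lambda>x. x) \<in> graded_hom M M"
  by (intro graded_homI) auto

lemma additive_zero:
  assumes "abelian_group M" "abelian_group N" "f \<in> carrier M \<rightarrow> carrier N"
    and add: "\<And>x y. x \<in> carrier M \<Longrightarrow> y \<in> carrier M \<Longrightarrow> f (x \<oplus>\<^bsub>M\<^esub> y) = f x \<oplus>\<^bsub>N\<^esub> f y"
  shows "f \<zero>\<^bsub>M\<^esub> = \<zero>\<^bsub>N\<^esub>"
proof -
  interpret M: abelian_group M by fact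
  interpret N: abelian_group N by fact
  have c: "f \<zero>\<^bsub>M\<^esub> \<in> carrier N" using assms(3) by auto
  have "f \<zero>\<^bsub>M\<^esub> \<oplus>\<^bsub>N\<^esub> f \<zero>\<^bsub>M\<^esub> = f \<zero>\<^bsub>M\<^esub>" using add[of "\<zero>\<^bsub>M\<^esub>" "\<zero>\<^bsub>M\<^esub>"] by simp
  then show ?thesis using c N.add.l_cancel_one by blast
qed

lemma additive_finsum:
  assumes "abelian_group M" "abelian_group N" "f \<in> carrier M \<rightarrow> carrier N"
    and add: "\<And>x y. x \<in> carrier M \<Longrightarrow> y \<in> carrier M \<Longrightarrow> f (x \<oplus>\<^bsub>M\<^esub> y) = f x \<oplus>\<^bsub>N\<^esub> f y"
    and "finite S" "c \<in> S \<rightarrow> carrier M"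
  shows "f (\<Oplus>\<^bsub>M\<^esub>i\<in>S. c i) = (\<Oplus>\<^bsub>N\<^esub>i\<in>S. f (c i))"
proof -
  interpret M: abelian_group M by fact
  interpret N: abelian_group N by fact
  have z: "f \<zero>\<^bsub>M\<^esub> = \<zero>\<^bsub>N\<^esub>" by (rule additive_zero) fact+
  show ?thesis using \<open>finite S\<close> \<open>c \<in> S \<rightarrow> carrier M\<close>
  proof (induction S rule: finite_induct)
    case empty
    then show ?case using z by simp
  next
    case (insert x F)
    have "(\<lambda>i. f (c i)) \<in> F \<rightarrow> carrier N" "f (c x) \<in> carrier N" using insert assms(3) by auto
    then show ?case using insert add M.finsum_closed[of c F] by (simp add: Pi_iff)
  qed
qed

lemma (in abelian_group) finsum_superset:
  assumes "finite T" "S \<subseteq> T" "\<And>i. i \<in> T - S \<Longrightarrow> c i = \<zero>" "c \<in> T \<rightarrow> carrier G"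
  shows "(\<Oplus>i\<in>S. c i) = (\<Oplus>i\<in>T. c i)"
  using assms by (intro add.finprod_mono_neutral_cong_left) auto

lemma (in graded_module) is_module: "Module.module Cz M"
  by (rule module_axioms)

lemma (in graded_module) is_abelian_group: "abelian_group M"
  by unfold_locales

lemma (in graded_module) hcomp_carrier: "x \<in> hcomp M k \<Longrightarrow> x \<in> carrier M"
  using additive_subgroup.a_subset[OF additive_subgroup_hcomp] by blast

lemma (in graded_module) hcomp_zero: "\<zero> \<in> hcomp M k"
  using additive_subgroup.zero_closed[OF additive_subgroup_hcomp] .

lemma (in graded_module) hcomp_add: "x \<in> hcomp M k \<Longrightarrow> y \<in> hcomp M k \<Longrightarrow> x \<oplus> y \<in> hcomp M k"
  using additive_subgroup.a_closed[OF additive_subgroup_hcomp] by blast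

lemma graded_hom_zero:
  assumes "graded_module M" "graded_module N" "f \<in> graded_hom M N"
  shows "f \<zero>\<^bsub>M\<^esub> = \<zero>\<^bsub>N\<^esub>"
  using assms by (intro additive_zero graded_module.is_abelian_group)
    (auto simp: graded_hom_closed graded_hom_add)

text \<open>
  The family of homogeneous parts of \<open>x\<close>: \<open>hpart M x k\<close> is the component of \<open>x\<close> in degree \<open>k\<close>. It is
  meaningful for \<open>x\<close> in the carrier of a graded module.
\<close>

definition hpart :: "'m gmodule \<Rightarrow> 'm \<Rightarrow> nat \<Rightarrow> 'm" where
  "hpart M x = (THE c. (\<forall>k. c k \<in> hcomp M k) \<and> finite {k. c k \<noteq> \<zero>\<^bsub>M\<^esub>}
     \<and> x = (\<Oplus>\<^bsub>M\<^esub>k\<in>{k. c k \<noteq> \<zero>\<^bsub>M\<^esub>}. c k))"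

context graded_module
begin

lemma hpart:
  assumes "x \<in> carrier M"
  shows hpart_hcomp: "hpart M x k \<in> hcomp M k"
    and finite_hpart: "finite {k. hpart M x k \<noteq> \<zero>}"
    and sum_hpart: "(\<Oplus>k\<in>{k. hpart M x k \<noteq> \<zero>}. hpart M x k) = x"
  using theI'[OF homogeneous_decomposition[OF assms]] unfolding hpart_def[symmetric] by auto

lemma hpart_carrier: "x \<in> carrier M \<Longrightarrow> hpart M x k \<in> carrier M"
  using hpart_hcomp hcomp_carrier by blast

lemma hpart_eqI:
  assumes "\<And>k. c k \<in> hcomp M k" "finite T" "\<And>k. k \<notin> T \<Longrightarrow> c k = \<zero>" "x = (\<Oplus>k\<in>T. c k)"
  shows "hpart M x = c"
proof -
  have c: "c \<in> T \<rightarrow> carrier M" using assms(1) hcomp_carrier by auto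
  then have x: "x \<in> carrier M" using assms(4) by simp
  have sub: "{k. c k \<noteq> \<zero>} \<subseteq> T" using assms(3) by auto
  have "(\<Oplus>k\<in>{k. c k \<noteq> \<zero>}. c k) = (\<Oplus>k\<in>T. c k)"
    using assms(2) sub c by (intro finsum_superset) auto
  then show ?thesis
    unfolding hpart_def using finite_subset[OF sub assms(2)] assms(1,4)
    by (intro the1_equality[OF homogeneous_decomposition[OF x]]) simp
qed

lemma hpart_add:
  assumes "x \<in> carrier M" "y \<in> carrier M"
  shows "hpart M (x \<oplus> y) k = hpart M x k \<oplus> hpart M y k"
proof -
  let ?S = "\<lambda>x. {k. hpart M x k \<noteq> \<zero>}"
  let ?T = "?S x \<union> ?S y"
  have T: "finite ?T" using finite_hpart assms by simp
  have c: "hpart M x \<in> ?T \<rightarrow> carrier M" "hpart M y \<in> ?T \<rightarrow> carrier M"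
    using hpart_carrier assms by auto
  have "(\<Oplus>k\<in>?S x. hpart M x k) = (\<Oplus>k\<in>?T. hpart M x k)"
    by (rule finsum_superset[OF T _ _ c(1)]) auto
  then have x: "(\<Oplus>k\<in>?T. hpart M x k) = x" unfolding sum_hpart[OF assms(1)] by (rule sym)
  have "(\<Oplus>k\<in>?S y. hpart M y k) = (\<Oplus>k\<in>?T. hpart M y k)"
    by (rule finsum_superset[OF T _ _ c(2)]) auto
  then have y: "(\<Oplus>k\<in>?T. hpart M y k) = y" unfolding sum_hpart[OF assms(2)] by (rule sym)
  have "x \<oplus> y = (\<Oplus>k\<in>?T. hpart M x k \<oplus> hpart M y k)"
    unfolding finsum_addf[OF c] x y ..
  then have "hpart M (x \<oplus> y) = (\<lambda>k. hpart M x k \<oplus> hpart M y k)"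
    using T assms by (intro hpart_eqI[of _ ?T]) (auto simp: hpart_hcomp hcomp_add)
  then show ?thesis by simp
qed

lemma hpart_homogeneous:
  assumes "x \<in> hcomp M j"
  shows "hpart M x k = (if k = j then x else \<zero>)"
proof -
  have "hpart M x = (\<lambda>k. if k = j then x else \<zero>)"
    using assms hcomp_carrier[OF assms] by (intro hpart_eqI[of _ "{j}"]) (auto simp: hcomp_zero)
  then show ?thesis by simp
qed

end

lemma hpart_graded_hom:
  assumes "graded_module M" "graded_module N" "f \<in> graded_hom M N" "x \<in> carrier M"
  shows "hpart N (f x) k = f (hpart M x k)"
proof -
  interpret M: graded_module M by fact
  interpret N: graded_module N by fact
  let ?S = "{k. hpart M x k \<noteq> \<zero>\<^bsub>M\<^esub>}"
  have "f x = f (\<Oplus>\<^bsub>M\<^esub>k\<in>?S. hpart M x k)" using M.sum_hpart[OF assms(4)] by simp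
  also have "\<dots> = (\<Oplus>\<^bsub>N\<^esub>k\<in>?S. f (hpart M x k))"
    using assms M.finite_hpart[OF assms(4)] M.hpart_carrier[OF assms(4)]
    by (intro additive_finsum M.is_abelian_group N.is_abelian_group)
      (auto simp: graded_hom_add graded_hom_closed)
  finally have "hpart N (f x) = (\<lambda>k. f (hpart M x k))"
    using M.finite_hpart[OF assms(4)] graded_hom_hcomp[OF assms(3) M.hpart_hcomp[OF assms(4)]]
      graded_hom_zero[OF assms(1-3)]
    by (intro N.hpart_eqI[of _ ?S]) auto
  then show ?thesis by simp
qed

text \<open>
  This makes inverses of bijective graded homomorphisms graded, and determines the grading of the
  image of an injective one.
\<close>

lemma graded_hom_reflects_hcomp:
  assumes "graded_module M" "graded_module N" "f \<in> graded_hom M N" "inj_on f (carrier M)"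
    and "x \<in> carrier M" "f x \<in> hcomp N k"
  shows "x \<in> hcomp M k"
proof -
  interpret M: graded_module M by fact
  interpret N: graded_module N by fact
  have "f (hpart M x k) = f x"
    using hpart_graded_hom[OF assms(1,2,3,5), of k] N.hpart_homogeneous[OF assms(6)] by simp
  then have "hpart M x k = x" using assms M.hpart_carrier by (meson inj_onD)
  then show ?thesis using M.hpart_hcomp[OF assms(5), of k] by simp
qed

lemma graded_inverse:
  assumes M: "graded_module M" and N: "graded_module N" and f: "f \<in> graded_hom M N"
    and bij: "bij_betw f (carrier M) (carrier N)"
  obtains g where "g \<in> graded_hom N M" "bij_betw g (carrier N) (carrier M)"
    "\<And>x. x \<in> carrier M \<Longrightarrow> g (f x) = x" "\<And>y. y \<in> carrier N \<Longrightarrow> f (g y) = y"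
proof -
  interpret M: graded_module M by fact
  interpret N: graded_module N by fact
  let ?g = "inv_into (carrier M) f"
  have g: "bij_betw ?g (carrier N) (carrier M)" using bij by (rule bij_betw_inv_into)
  have gf: "?g (f x) = x" if "x \<in> carrier M" for x using bij that by (rule bij_betw_inv_into_left)
  have fg: "f (?g y) = y" if "y \<in> carrier N" for y using bij that by (rule bij_betw_inv_into_right)
  have gc: "?g y \<in> carrier M" if "y \<in> carrier N" for y using g that by (auto simp: bij_betw_def)
  have inj: "inj_on f (carrier M)" using bij by (simp add: bij_betw_def)
  have "?g \<in> graded_hom N M"
  proof (rule graded_homI)
    fix x y assume xy: "x \<in> carrier N" "y \<in> carrier N"
    have "?g (x \<oplus>\<^bsub>N\<^esub> y) = ?g (f (?g x \<oplus>\<^bsub>M\<^esub> ?g y))" using xy fg gc graded_hom_add[OF f] by simp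
    then show "?g (x \<oplus>\<^bsub>N\<^esub> y) = ?g x \<oplus>\<^bsub>M\<^esub> ?g y" using gf gc xy by simp
  next
    fix r x assume x: "x \<in> carrier N"
    have "?g (r \<odot>\<^bsub>N\<^esub> x) = ?g (f (r \<odot>\<^bsub>M\<^esub> ?g x))" using x fg gc graded_hom_smult[OF f] by simp
    then show "?g (r \<odot>\<^bsub>N\<^esub> x) = r \<odot>\<^bsub>M\<^esub> ?g x" using gf gc x M.smult_closed by simp
  next
    fix k x assume x: "x \<in> hcomp N k"
    then have "x \<in> carrier N" by (rule N.hcomp_carrier)
    then show "?g x \<in> hcomp M k"
      using x gc fg by (intro graded_hom_reflects_hcomp[OF M N f inj]) auto
  qed (use gc in auto)
  then show thesis using that g gf fg by blast
qed

lemma graded_iso_refl: "M \<cong>\<^sub>g M"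
  unfolding graded_iso_def by (intro bexI[OF _ graded_hom_id]) (simp add: bij_betw_def)

lemma graded_iso_sym:
  assumes "graded_module M" "graded_module N" "M \<cong>\<^sub>g N"
  shows "N \<cong>\<^sub>g M"
  using assms(3) graded_inverse[OF assms(1,2)] unfolding graded_iso_def by metis

lemma graded_iso_trans:
  assumes "M \<cong>\<^sub>g N" "N \<cong>\<^sub>g P"
  shows "M \<cong>\<^sub>g P"
proof -
  obtain f g where "f \<in> graded_hom M N" "bij_betw f (carrier M) (carrier N)"
    "g \<in> graded_hom N P" "bij_betw g (carrier N) (carrier P)"
    using assms by (auto simp: graded_iso_def)
  then show ?thesis unfolding graded_iso_def
    using graded_hom_comp[of f M N g P] bij_betw_trans[of f "carrier M" "carrier N" g "carrier P"]
    by (intro bexI[of _ "\<lambda>x. g (f x)"]) (auto simp: comp_def)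
qed

text \<open>
  A grading is most easily given by the projections \<open>p k\<close> onto its components: additivity of the
  projections yields uniqueness of the decomposition.
\<close>

lemma graded_moduleI:
  assumes M: "Module.module Cz M"
    and sub: "\<And>k. additive_subgroup (hcomp M k) M"
    and smult: "\<And>k j c x. x \<in> hcomp M k \<Longrightarrow> monom c j \<odot>\<^bsub>M\<^esub> x \<in> hcomp M (j + k)"
    and proj_hcomp: "\<And>k x. x \<in> carrier M \<Longrightarrow> p k x \<in> hcomp M k"
    and proj_fin: "\<And>x. x \<in> carrier M \<Longrightarrow> finite {k. p k x \<noteq> \<zero>\<^bsub>M\<^esub>}"
    and proj_sum: "\<And>x. x \<in> carrier M \<Longrightarrow> x = (\<Oplus>\<^bsub>M\<^esub>k\<in>{k. p k x \<noteq> \<zero>\<^bsub>M\<^esub>}. p k x)"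
    and proj_add: "\<And>k x y. x \<in> carrier M \<Longrightarrow> y \<in> carrier M \<Longrightarrow> p k (x \<oplus>\<^bsub>M\<^esub> y) = p k x \<oplus>\<^bsub>M\<^esub> p k y"
    and proj_homog: "\<And>j k x. x \<in> hcomp M j \<Longrightarrow> p k x = (if k = j then x else \<zero>\<^bsub>M\<^esub>)"
  shows "graded_module M"
proof -
  interpret Module.module Cz M by fact
  have hc: "x \<in> carrier M" if "x \<in> hcomp M k" for x k
    using additive_subgroup.a_subset[OF sub] that by blast
  show ?thesis
  proof (intro graded_module.intro graded_module_axioms.intro)
    fix x assume x: "x \<in> carrier M"
    show "\<exists>!c. (\<forall>k. c k \<in> hcomp M k) \<and> finite {k. c k \<noteq> \<zero>\<^bsub>M\<^esub>}
          \<and> x = (\<Oplus>\<^bsub>M\<^esub>k\<in>{k. c k \<noteq> \<zero>\<^bsub>M\<^esub>}. c k)"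
    proof (rule ex1I[of _ "\<lambda>k. p k x"])
      fix c assume c: "(\<forall>k. c k \<in> hcomp M k) \<and> finite {k. c k \<noteq> \<zero>\<^bsub>M\<^esub>}
          \<and> x = (\<Oplus>\<^bsub>M\<^esub>k\<in>{k. c k \<noteq> \<zero>\<^bsub>M\<^esub>}. c k)"
      let ?S = "{k. c k \<noteq> \<zero>\<^bsub>M\<^esub>}"
      have cM: "c k \<in> carrier M" for k using c hc by blast
      have "c k = p k x" for k
      proof -
        have "p k x = p k (\<Oplus>\<^bsub>M\<^esub>j\<in>?S. c j)" using c by simp
        also have "\<dots> = (\<Oplus>\<^bsub>M\<^esub>j\<in>?S. p k (c j))"
          using c hc[OF proj_hcomp] cM proj_add
          by (intro additive_finsum abelian_group_axioms) auto
        also have "\<dots> = (\<Oplus>\<^bsub>M\<^esub>j\<in>?S. if k = j then c j else \<zero>\<^bsub>M\<^esub>)"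
          using c cM proj_homog by (intro finsum_cong') auto
        also have "\<dots> = c k"
        proof (cases "k \<in> ?S")
          case True
          then show ?thesis using c cM by (intro finsum_singleton) auto
        next
          case False
          have "(\<Oplus>\<^bsub>M\<^esub>j\<in>?S. if k = j then c j else \<zero>\<^bsub>M\<^esub>) = (\<Oplus>\<^bsub>M\<^esub>j\<in>?S. \<zero>\<^bsub>M\<^esub>)"
            using False by (intro finsum_cong') auto
          then show ?thesis using False by simp
        qed
        finally show ?thesis by simp
      qed
      then show "c = (\<lambda>k. p k x)" by auto
    qed (use x proj_hcomp proj_fin proj_sum in auto)
  qed (use M sub smult in auto)
qed


section \<open>Graded submodules\<close>

lemma restrict_simps [simp]:
  "carrier (restrict_gmodule M K) = K" "add (restrict_gmodule M K) = add M"
  "zero (restrict_gmodule M K) = zero M" "smult (restrict_gmodule M K) = smult M"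
  "hcomp (restrict_gmodule M K) k = hcomp M k \<inter> K"
  by (simp_all add: restrict_gmodule_def)

lemma restrict_module:
  assumes "Module.module Cz M" "LinearCombinations.submodule Cz K M"
  shows "Module.module Cz (restrict_gmodule M K)"
proof -
  interpret Module.module Cz "M\<lparr>carrier := K\<rparr>"
    using LinearCombinations.module.submodule_is_module[OF assms] .
  have "abelian_group (restrict_gmodule M K)"
    using a_comm_group by (intro comm_group_abelian_groupI) (simp add: restrict_gmodule_def)
  then show ?thesis
    using smult_closed smult_l_distr smult_r_distr smult_assoc1 smult_one
    by (intro moduleI) (auto simp: cring_Cz)
qed

lemma closed_subset_submodule:
  assumes "graded_module M" "K \<subseteq> carrier M" "\<zero>\<^bsub>M\<^esub> \<in> K"
    and "\<And>x y. x \<in> K \<Longrightarrow> y \<in> K \<Longrightarrow> x \<oplus>\<^bsub>M\<^esub> y \<in> K"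
    and "\<And>r x. x \<in> K \<Longrightarrow> r \<odot>\<^bsub>M\<^esub> x \<in> K"
  shows "LinearCombinations.submodule Cz K M"
  using assms graded_module.is_module by (intro submodule.intro) auto

lemma submodule_additive_subgroup:
  assumes "graded_module M" "LinearCombinations.submodule Cz K M"
  shows "additive_subgroup K M"
proof -
  interpret M: graded_module M by fact
  interpret K: LinearCombinations.submodule Cz K M by fact
  have "\<ominus>\<^bsub>M\<^esub> x \<in> K" if "x \<in> K" for x
  proof -
    have "x \<in> carrier M" using that K.subset by blast
    then have "(-1) \<odot>\<^bsub>M\<^esub> x = \<ominus>\<^bsub>M\<^esub> x"
      using M.smult_l_minus[of 1 x] M.smult_one[of x] by (simp add: class_ring_simps)
    then show ?thesis using K.smult_closed[of "-1" x] that by simp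
  qed
  moreover have "K \<noteq> {}" using K.zero_closed by blast
  ultimately have "subgroup K (add_monoid M)"
    using K.subset by (intro M.add.subgroupI) auto
  then show ?thesis by (rule additive_subgroupI)
qed

text \<open>A submodule is graded if and only if it contains the homogeneous parts of its elements.\<close>

lemma graded_submodule_iff:
  assumes M: "graded_module M"
  shows "graded_submodule K M \<longleftrightarrow>
    LinearCombinations.submodule Cz K M \<and> (\<forall>x\<in>K. \<forall>k. hpart M x k \<in> K)"
proof
  assume K: "graded_submodule K M"
  then interpret K: graded_module "restrict_gmodule M K" by (simp add: graded_submodule_def)
  have sub: "K \<subseteq> carrier M" using K submodule.subset by (auto simp: graded_submodule_def)
  have "(\<lambda>x. x) \<in> graded_hom (restrict_gmodule M K) M"
    using sub by (intro graded_homI) auto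
  then have "hpart M x k = hpart (restrict_gmodule M K) x k" if "x \<in> K" for x k
    using hpart_graded_hom[OF K.graded_module_axioms M, of "\<lambda>x. x" x k] that by simp
  then show "LinearCombinations.submodule Cz K M \<and> (\<forall>x\<in>K. \<forall>k. hpart M x k \<in> K)"
    using K.hpart_carrier K by (simp add: graded_submodule_def)
next
  assume K: "LinearCombinations.submodule Cz K M \<and> (\<forall>x\<in>K. \<forall>k. hpart M x k \<in> K)"
  interpret M: graded_module M by fact
  interpret KS: LinearCombinations.submodule Cz K M using K by simp
  interpret add: additive_subgroup K M using submodule_additive_subgroup[OF M] K by simp
  have mod: "Module.module Cz (restrict_gmodule M K)"
    using restrict_module[OF M.is_module] K by simp
  interpret K: Module.module Cz "restrict_gmodule M K" by (rule mod)
  have finsum_eq: "(\<Oplus>\<^bsub>restrict_gmodule M K\<^esub>i\<in>S. c i) = (\<Oplus>\<^bsub>M\<^esub>i\<in>S. c i)" if "finite S" "c \<in> S \<rightarrow> K"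
    for S and c :: "nat \<Rightarrow> 'a"
    using additive_finsum[OF K.abelian_group_axioms M.is_abelian_group, of "\<lambda>x. x" S c] KS.subset that
    by auto
  have "graded_module (restrict_gmodule M K)"
  proof (rule graded_moduleI[where p = "\<lambda>k x. hpart M x k"])
    fix k
    have "subgroup (hcomp M k \<inter> K) (add_monoid M)"
      using M.add.subgroups_Inter_pair additive_subgroup.a_subgroup[OF M.additive_subgroup_hcomp]
        add.a_subgroup by blast
    then have h: "additive_subgroup (hcomp M k \<inter> K) M" by (rule additive_subgroupI)
    have inv: "\<ominus>\<^bsub>restrict_gmodule M K\<^esub> x = \<ominus>\<^bsub>M\<^esub> x" if "x \<in> K" for x
      using that add.a_inv_closed[OF that] M.l_neg[of x] KS.subset
      by (intro K.minus_equality) auto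
    show "additive_subgroup (hcomp (restrict_gmodule M K) k) (restrict_gmodule M K)"
      using additive_subgroup.zero_closed[OF h] additive_subgroup.a_closed[OF h]
        additive_subgroup.a_inv_closed[OF h] inv
      by (intro additive_subgroupI K.add.subgroupI) (auto simp: a_inv_def[symmetric])
  next
    fix x assume x: "x \<in> carrier (restrict_gmodule M K)"
    then have xM: "x \<in> carrier M" using KS.subset by auto
    show "finite {k. hpart M x k \<noteq> \<zero>\<^bsub>restrict_gmodule M K\<^esub>}" using M.finite_hpart[OF xM] by simp
    then show "x = (\<Oplus>\<^bsub>restrict_gmodule M K\<^esub>k\<in>{k. hpart M x k \<noteq> \<zero>\<^bsub>restrict_gmodule M K\<^esub>}. hpart M x k)"
      using x K M.sum_hpart[OF xM] by (subst finsum_eq) auto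
  next
    fix k x y assume "x \<in> carrier (restrict_gmodule M K)" "y \<in> carrier (restrict_gmodule M K)"
    then show "hpart M (x \<oplus>\<^bsub>restrict_gmodule M K\<^esub> y) k = hpart M x k \<oplus>\<^bsub>restrict_gmodule M K\<^esub> hpart M y k"
      using M.hpart_add KS.subset by auto
  qed (use K KS.subset mod in \<open>auto simp: M.smult_hcomp M.hpart_hcomp M.hpart_homogeneous\<close>)
  then show "graded_submodule K M" using K by (simp add: graded_submodule_def)
qed

lemma graded_submodule_image:
  assumes F: "graded_module F" and M: "graded_module M" and f: "f \<in> graded_hom F M"
  shows "graded_submodule (f ` carrier F) M"
proof -
  interpret F: graded_module F by fact
  interpret M: graded_module M by fact
  have z: "f \<zero>\<^bsub>F\<^esub> = \<zero>\<^bsub>M\<^esub>" using graded_hom_zero[OF F M f] .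
  have "LinearCombinations.submodule Cz (f ` carrier F) M"
  proof (rule closed_subset_submodule[OF M])
    show "\<zero>\<^bsub>M\<^esub> \<in> f ` carrier F" using z F.zero_closed by (metis image_eqI)
    show "x \<oplus>\<^bsub>M\<^esub> y \<in> f ` carrier F" if xy: "x \<in> f ` carrier F" "y \<in> f ` carrier F" for x y
    proof -
      obtain u v where "u \<in> carrier F" "v \<in> carrier F" "x = f u" "y = f v" using xy by blast
      then show ?thesis using graded_hom_add[OF f, of u v] F.a_closed by (metis image_eqI)
    qed
    show "r \<odot>\<^bsub>M\<^esub> x \<in> f ` carrier F" if x: "x \<in> f ` carrier F" for r x
    proof -
      obtain u where "u \<in> carrier F" "x = f u" using x by blast
      then have "r \<odot>\<^bsub>M\<^esub> x = f (r \<odot>\<^bsub>F\<^esub> u)" "r \<odot>\<^bsub>F\<^esub> u \<in> carrier F"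
        using graded_hom_smult[OF f, of u r] F.smult_closed[of r u] by simp_all
      then show ?thesis by blast
    qed
  qed (use graded_hom_closed[OF f] in auto)
  moreover have "hpart M (f x) k \<in> f ` carrier F" if "x \<in> carrier F" for x k
    using hpart_graded_hom[OF F M f that] F.hpart_carrier[OF that] by simp
  ultimately show ?thesis using graded_submodule_iff[OF M] by auto
qed

lemma graded_iso_image:
  assumes F: "graded_module F" and M: "graded_module M" and f: "f \<in> graded_hom F M"
    and inj: "inj_on f (carrier F)"
  shows "F \<cong>\<^sub>g restrict_gmodule M (f ` carrier F)"
  unfolding graded_iso_def
proof (rule bexI)
  show "f \<in> graded_hom F (restrict_gmodule M (f ` carrier F))"
    using f graded_module.hcomp_carrier[OF F]
    by (intro graded_homI) (auto simp: graded_hom_add graded_hom_smult graded_hom_hcomp)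
qed (use inj in \<open>simp add: bij_betw_def\<close>)

lemma graded_submodule_kernel:
  assumes M: "graded_module M" and N: "graded_module N" and g: "g \<in> graded_hom M N"
  shows "graded_submodule {x \<in> carrier M. g x = \<zero>\<^bsub>N\<^esub>} M"
proof -
  interpret M: graded_module M by fact
  interpret N: graded_module N by fact
  have z: "g \<zero>\<^bsub>M\<^esub> = \<zero>\<^bsub>N\<^esub>" using graded_hom_zero[OF M N g] .
  have "LinearCombinations.submodule Cz {x \<in> carrier M. g x = \<zero>\<^bsub>N\<^esub>} M"
    using z by (intro closed_subset_submodule[OF M]) (auto simp: graded_hom_add[OF g] graded_hom_smult[OF g])
  moreover have "g (hpart M x k) = \<zero>\<^bsub>N\<^esub>" if "x \<in> carrier M" "g x = \<zero>\<^bsub>N\<^esub>" for x k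
    using hpart_graded_hom[OF M N g that(1), of k] that N.hpart_homogeneous[OF N.hcomp_zero]
    by (metis (full_types))
  ultimately show ?thesis using graded_submodule_iff[OF M] M.hpart_carrier by auto
qed


section \<open>Graded quotients\<close>

text \<open>A graded module together with a graded submodule to divide by.\<close>

locale graded_quotient = graded_module M for M :: "'m gmodule" (structure) +
  fixes K
  assumes K: "graded_submodule K M"
begin

lemma submodule_K: "LinearCombinations.submodule Cz K M"
  using K by (simp add: graded_submodule_def)

sublocale abelian_subgroup K M
  by (rule abelian_subgroupI3[OF submodule_additive_subgroup[OF graded_module_axioms submodule_K] is_abelian_group])

lemma K_smult: "x \<in> K \<Longrightarrow> r \<odot> x \<in> K"
  using submodule.smult_closed[OF submodule_K, of r x] by simp

lemma quotient_carrier: "carrier (M /\<^sub>g K) = (\<lambda>x. K +> x) ` carrier M"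
  by (auto simp: quotient_gmodule_def A_RCOSETS_def')

lemma quotient_add: "x \<in> carrier M \<Longrightarrow> y \<in> carrier M \<Longrightarrow>
    (K +> x) \<oplus>\<^bsub>M /\<^sub>g K\<^esub> (K +> y) = K +> (x \<oplus> y)"
  by (simp add: quotient_gmodule_def a_rcos_sum)

lemma quotient_zero: "\<zero>\<^bsub>M /\<^sub>g K\<^esub> = K"
  by (simp add: quotient_gmodule_def)

lemma quotient_hcomp: "hcomp (M /\<^sub>g K) k = (\<lambda>x. K +> x) ` hcomp M k"
  by (simp add: quotient_gmodule_def)

lemma coset_eq_iff:
  assumes "x \<in> carrier M" "y \<in> carrier M"
  shows "K +> x = K +> y \<longleftrightarrow> x \<ominus> y \<in> K"
  using a_rcos_module[OF assms(2,1)] a_repr_independence'[of x y] a_rcos_self[OF assms(1)] assms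
  by (auto simp: minus_eq)

lemma coset_eq_K_iff: "x \<in> carrier M \<Longrightarrow> K +> x = K \<longleftrightarrow> x \<in> K"
  using a_rcos_const a_rcos_self by blast

lemma coset_elem:
  assumes "x \<in> carrier M" "y \<in> K +> x"
  obtains h where "h \<in> K" "y = h \<oplus> x"
  using assms by (auto simp: a_r_coset_def')

lemma quotient_smult:
  assumes "x \<in> carrier M"
  shows "r \<odot>\<^bsub>M /\<^sub>g K\<^esub> (K +> x) = K +> (r \<odot> x)"
proof -
  have "K +> (r \<odot> y) = K +> (r \<odot> x)" if y: "y \<in> K +> x" for y
  proof -
    obtain h where h: "h \<in> K" "y = h \<oplus> x" using coset_elem[OF assms y] .
    have "r \<odot> y = r \<odot> h \<oplus> r \<odot> x" using h assms smult_r_distr[of r h x] by simp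
    then have "r \<odot> y \<in> K +> (r \<odot> x)" using K_smult[OF h(1)] by (auto simp: a_r_coset_def')
    then show ?thesis using a_repr_independence' assms by simp
  qed
  then have "(\<Union>y\<in>K +> x. K +> (r \<odot> y)) = (\<Union>y\<in>K +> x. K +> (r \<odot> x))"
    by (rule SUP_cong[OF refl])
  also have "\<dots> = K +> (r \<odot> x)" using a_rcos_self[OF assms] by blast
  finally show ?thesis by (simp add: quotient_gmodule_def)
qed

lemma quotient_module: "Module.module Cz (M /\<^sub>g K)"
proof (rule moduleI)
  show "cring Cz" by (rule cring_Cz)
  have z: "\<zero>\<^bsub>M /\<^sub>g K\<^esub> = K +> \<zero>" using a_subset by (simp add: quotient_zero)
  show "abelian_group (M /\<^sub>g K)"
  proof (rule abelian_groupI)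
    fix X assume "X \<in> carrier (M /\<^sub>g K)"
    then obtain x where x: "x \<in> carrier M" "X = K +> x" by (auto simp: quotient_carrier)
    then have "(K +> (\<ominus> x)) \<oplus>\<^bsub>M /\<^sub>g K\<^esub> X = \<zero>\<^bsub>M /\<^sub>g K\<^esub>"
      unfolding z by (simp add: quotient_add l_neg)
    then show "\<exists>Y\<in>carrier (M /\<^sub>g K). Y \<oplus>\<^bsub>M /\<^sub>g K\<^esub> X = \<zero>\<^bsub>M /\<^sub>g K\<^esub>"
      using x by (auto simp: quotient_carrier)
  qed (auto simp: z quotient_carrier quotient_add a_assoc a_comm a_lcomm simp del: a_coset_add_zero)
qed (auto simp: quotient_carrier quotient_smult quotient_add smult_l_distr[simplified]
    smult_r_distr smult_assoc1[simplified] smult_one[simplified])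

text \<open>The coset of the part of degree \<open>k\<close> does not depend on the representative.\<close>

lemma hpart_coset:
  assumes "x \<in> carrier M"
  shows "K +> hpart M (SOME y. y \<in> K +> x) k = K +> hpart M x k"
proof -
  let ?y = "SOME y. y \<in> K +> x"
  have "?y \<in> K +> x" using a_rcos_self[OF assms] by (rule someI)
  then obtain h where h: "h \<in> K" "?y = h \<oplus> x" using coset_elem assms by blast
  have "hpart M ?y k = hpart M h k \<oplus> hpart M x k" using h assms hpart_add by simp
  moreover have "hpart M h k \<in> K"
    using h K graded_submodule_iff[OF graded_module_axioms] by blast
  ultimately have "hpart M ?y k \<in> K +> hpart M x k" by (auto simp: a_r_coset_def')
  then show ?thesis using a_repr_independence' hpart_carrier[OF assms] by simp
qed

lemma quotient_graded_module: "graded_module (M /\<^sub>g K)"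
proof -
  interpret Q: Module.module Cz "M /\<^sub>g K" by (rule quotient_module)
  let ?p = "\<lambda>k X. K +> hpart M (SOME y. y \<in> X) k"
  show ?thesis
  proof (rule graded_moduleI[where p = ?p])
    fix k
    have inv: "\<ominus>\<^bsub>M /\<^sub>g K\<^esub> (K +> x) = K +> (\<ominus> x)" if "x \<in> carrier M" for x
      using that by (intro Q.minus_equality) (auto simp: quotient_carrier quotient_add quotient_zero l_neg a_coset_add_zero a_subset)
    have "subgroup (hcomp (M /\<^sub>g K) k) (add_monoid (M /\<^sub>g K))"
    proof (rule Q.add.subgroupI)
      show "hcomp (M /\<^sub>g K) k \<subseteq> carrier (M /\<^sub>g K)"
        using hcomp_carrier by (auto simp: quotient_hcomp quotient_carrier)
      show "hcomp (M /\<^sub>g K) k \<noteq> {}" using hcomp_zero by (auto simp: quotient_hcomp)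
      show "\<ominus>\<^bsub>M /\<^sub>g K\<^esub> a \<in> hcomp (M /\<^sub>g K) k" if "a \<in> hcomp (M /\<^sub>g K) k" for a
        using that inv hcomp_carrier additive_subgroup.a_inv_closed[OF additive_subgroup_hcomp]
        by (auto simp: quotient_hcomp)
      show "a \<oplus>\<^bsub>M /\<^sub>g K\<^esub> b \<in> hcomp (M /\<^sub>g K) k"
        if "a \<in> hcomp (M /\<^sub>g K) k" "b \<in> hcomp (M /\<^sub>g K) k" for a b
        using that hcomp_carrier hcomp_add by (auto simp: quotient_hcomp quotient_add)
    qed
    then show "additive_subgroup (hcomp (M /\<^sub>g K) k) (M /\<^sub>g K)" by (rule additive_subgroupI)
  next
    show "monom c j \<odot>\<^bsub>M /\<^sub>g K\<^esub> x \<in> hcomp (M /\<^sub>g K) (j + k)" if "x \<in> hcomp (M /\<^sub>g K) k" for k j c x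
      using that hcomp_carrier smult_hcomp by (auto simp: quotient_hcomp quotient_smult)
    show "?p k X \<in> hcomp (M /\<^sub>g K) k" if "X \<in> carrier (M /\<^sub>g K)" for k X
      using that hpart_coset hpart_hcomp by (auto simp: quotient_carrier quotient_hcomp)
  next
    fix X assume "X \<in> carrier (M /\<^sub>g K)"
    then obtain x where x: "x \<in> carrier M" "X = K +> x" by (auto simp: quotient_carrier)
    have p: "?p k X = K +> hpart M x k" for k using hpart_coset x by simp
    let ?S = "{k. hpart M x k \<noteq> \<zero>}"
    have sub: "{k. ?p k X \<noteq> \<zero>\<^bsub>M /\<^sub>g K\<^esub>} \<subseteq> ?S"
      unfolding p by (auto simp: quotient_zero a_coset_add_zero a_subset)
    then show "finite {k. ?p k X \<noteq> \<zero>\<^bsub>M /\<^sub>g K\<^esub>}" using finite_hpart[OF x(1)] finite_subset by blast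
    have "X = K +> (\<Oplus>k\<in>?S. hpart M x k)" using x sum_hpart by simp
    also have "\<dots> = (\<Oplus>\<^bsub>M /\<^sub>g K\<^esub>k\<in>?S. K +> hpart M x k)"
      using hpart_carrier[OF x(1)] finite_hpart[OF x(1)]
      by (intro additive_finsum[OF is_abelian_group Q.abelian_group_axioms]) (auto simp: quotient_carrier quotient_add)
    also have "\<dots> = (\<Oplus>\<^bsub>M /\<^sub>g K\<^esub>k\<in>?S. ?p k X)" unfolding p ..
    also have "\<dots> = (\<Oplus>\<^bsub>M /\<^sub>g K\<^esub>k\<in>{k. ?p k X \<noteq> \<zero>\<^bsub>M /\<^sub>g K\<^esub>}. ?p k X)"
      using finite_hpart[OF x(1)] sub hpart_carrier[OF x(1)] unfolding p
      by (intro Q.finsum_superset[symmetric]) (auto simp: quotient_carrier)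
    finally show "X = (\<Oplus>\<^bsub>M /\<^sub>g K\<^esub>k\<in>{k. ?p k X \<noteq> \<zero>\<^bsub>M /\<^sub>g K\<^esub>}. ?p k X)" .
  next
    fix k X Y assume "X \<in> carrier (M /\<^sub>g K)" "Y \<in> carrier (M /\<^sub>g K)"
    then obtain x y where x: "x \<in> carrier M" "X = K +> x" and y: "y \<in> carrier M" "Y = K +> y"
      by (auto simp: quotient_carrier)
    show "?p k (X \<oplus>\<^bsub>M /\<^sub>g K\<^esub> Y) = ?p k X \<oplus>\<^bsub>M /\<^sub>g K\<^esub> ?p k Y"
      using x y hpart_coset[of x] hpart_coset[of y] hpart_coset[of "x \<oplus> y"] hpart_carrier
      by (simp add: quotient_add hpart_add)
  next
    fix j k X assume "X \<in> hcomp (M /\<^sub>g K) j"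
    then obtain x where x: "x \<in> hcomp M j" "X = K +> x" by (auto simp: quotient_hcomp)
    show "?p k X = (if k = j then X else \<zero>\<^bsub>M /\<^sub>g K\<^esub>)"
      using x hpart_coset[OF hcomp_carrier[OF x(1)]] hpart_homogeneous[OF x(1)]
      by (auto simp: quotient_zero a_coset_add_zero a_subset)
  qed (rule quotient_module)
qed

lemma coset_graded_hom: "(\<lambda>x. K +> x) \<in> graded_hom M (M /\<^sub>g K)"
  by (intro graded_homI) (auto simp: quotient_carrier quotient_add quotient_smult quotient_hcomp)

end

lemma graded_first_isomorphism:
  assumes M: "graded_module M" and N: "graded_module N" and g: "g \<in> graded_hom M N"
    and surj: "g ` carrier M = carrier N" and K: "K = {x \<in> carrier M. g x = \<zero>\<^bsub>N\<^esub>}"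
  shows "M /\<^sub>g K \<cong>\<^sub>g N"
proof -
  interpret N: graded_module N by fact
  interpret Q: graded_quotient M K
    using graded_submodule_kernel[OF M N g] M K
    by (auto intro!: graded_quotient.intro simp: graded_quotient_axioms_def)
  define h where "h X = g (SOME x. x \<in> X)" for X
  have h: "h (K +>\<^bsub>M\<^esub> x) = g x" if x: "x \<in> carrier M" for x
  proof -
    have "(SOME y. y \<in> K +>\<^bsub>M\<^esub> x) \<in> K +>\<^bsub>M\<^esub> x" using Q.a_rcos_self[OF x] by (rule someI)
    then obtain k where k: "k \<in> K" "(SOME y. y \<in> K +>\<^bsub>M\<^esub> x) = k \<oplus>\<^bsub>M\<^esub> x"
      using Q.coset_elem[OF x] by blast
    have kM: "k \<in> carrier M" "g k = \<zero>\<^bsub>N\<^esub>" using k(1) unfolding K by blast+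
    have "h (K +>\<^bsub>M\<^esub> x) = g (k \<oplus>\<^bsub>M\<^esub> x)" unfolding h_def k(2) ..
    also have "\<dots> = g k \<oplus>\<^bsub>N\<^esub> g x" by (rule graded_hom_add[OF g kM(1) x])
    also have "\<dots> = g x" using kM(2) graded_hom_closed[OF g x] by simp
    finally show ?thesis .
  qed
  have sub: "g (x \<ominus>\<^bsub>M\<^esub> y) = \<zero>\<^bsub>N\<^esub>" if "x \<in> carrier M" "y \<in> carrier M" "g x = g y" for x y
  proof -
    have "g (x \<ominus>\<^bsub>M\<^esub> y) \<oplus>\<^bsub>N\<^esub> g y = g (x \<ominus>\<^bsub>M\<^esub> y \<oplus>\<^bsub>M\<^esub> y)"
      using that graded_hom_add[OF g] by simp
    also have "\<dots> = g y" using that by (simp add: Q.minus_eq Q.a_assoc Q.l_neg)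
    finally show ?thesis using that graded_hom_closed[OF g] N.add.r_cancel_one by simp
  qed
  show ?thesis unfolding graded_iso_def
  proof (rule bexI)
    show "h \<in> graded_hom (M /\<^sub>g K) N"
      using Q.hcomp_carrier
      by (intro graded_homI) (auto simp: Q.quotient_carrier Q.quotient_add Q.quotient_smult Q.quotient_hcomp
        h graded_hom_closed[OF g] graded_hom_add[OF g] graded_hom_smult[OF g] graded_hom_hcomp[OF g])
    have "inj_on h (carrier (M /\<^sub>g K))"
    proof (rule inj_onI)
      fix X Y assume X: "X \<in> carrier (M /\<^sub>g K)" and Y: "Y \<in> carrier (M /\<^sub>g K)" and eq: "h X = h Y"
      obtain x where x: "x \<in> carrier M" "X = K +>\<^bsub>M\<^esub> x" using X unfolding Q.quotient_carrier by blast
      obtain y where y: "y \<in> carrier M" "Y = K +>\<^bsub>M\<^esub> y" using Y unfolding Q.quotient_carrier by blast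
      have "g x = g y" using eq x y h by simp
      then have "x \<ominus>\<^bsub>M\<^esub> y \<in> {x \<in> carrier M. g x = \<zero>\<^bsub>N\<^esub>}" using sub x y by simp
      then show "X = Y" unfolding x(2) y(2) Q.coset_eq_iff[OF x(1) y(1)] unfolding K[symmetric] .
    qed
    moreover have "h ` carrier (M /\<^sub>g K) = carrier N"
      unfolding surj[symmetric] Q.quotient_carrier image_image by (rule image_cong[OF refl h])
    ultimately show "bij_betw h (carrier (M /\<^sub>g K)) (carrier N)" by (simp add: bij_betw_def)
  qed
qed


section \<open>Free graded modules and constant matrices\<close>

lemma free_simps [simp]:
  "carrier (free_gmodule n b) = {p. (\<forall>i<n. monom 1 (b i) dvd p i) \<and> (\<forall>i\<ge>n. p i = 0)}"
  "zero (free_gmodule n b) = (\<lambda>i. 0)"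
  "add (free_gmodule n b) p q = (\<lambda>i. p i + q i)"
  "smult (free_gmodule n b) r p = (\<lambda>i. r * p i)"
  "hcomp (free_gmodule n b) k =
    {p. (\<forall>i<n. monom 1 (b i) dvd p i \<and> (\<exists>c. p i = monom c k)) \<and> (\<forall>i\<ge>n. p i = 0)}"
  by (simp_all add: free_gmodule_def)

lemma free_module: "Module.module Cz (free_gmodule n b)"
proof (rule moduleI)
  show "cring Cz" by (rule cring_Cz)
  show "abelian_group (free_gmodule n b)"
  proof (rule abelian_groupI)
    fix p assume "p \<in> carrier (free_gmodule n b)"
    then show "\<exists>q\<in>carrier (free_gmodule n b). q \<oplus>\<^bsub>free_gmodule n b\<^esub> p = \<zero>\<^bsub>free_gmodule n b\<^esub>"
      by (intro bexI[of _ "\<lambda>i. - p i"]) auto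
  qed (auto simp: algebra_simps)
qed (auto simp: algebra_simps)

lemma free_finsum:
  assumes "finite S" "c \<in> S \<rightarrow> carrier (free_gmodule n b)"
  shows "(\<Oplus>\<^bsub>free_gmodule n b\<^esub>k\<in>S. c k) = (\<lambda>i. \<Sum>k\<in>S. c k i)"
  using assms
proof (induction S rule: finite_induct)
  interpret F: Module.module Cz "free_gmodule n b" by (rule free_module)
  case empty
  then show ?case by simp
next
  interpret F: Module.module Cz "free_gmodule n b" by (rule free_module)
  case (insert x S)
  then have "(\<Oplus>\<^bsub>free_gmodule n b\<^esub>k\<in>insert x S. c k) = c x \<oplus>\<^bsub>free_gmodule n b\<^esub> (\<Oplus>\<^bsub>free_gmodule n b\<^esub>k\<in>S. c k)"
    by (intro F.finsum_insert) auto
  then show ?case using insert by auto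
qed

lemma monom_1_dvd_monom: "monom 1 b dvd monom (c :: complex) k \<longleftrightarrow> c = 0 \<or> b \<le> k"
  by (auto simp: monom_1_dvd_iff')

lemma free_graded: "graded_module (free_gmodule n b)"
proof -
  interpret F: Module.module Cz "free_gmodule n b" by (rule free_module)
  let ?F = "free_gmodule n b"
  let ?p = "\<lambda>k (q :: nat \<Rightarrow> complex poly) i. monom (coeff (q i) k) k"
  show ?thesis
  proof (rule graded_moduleI[where p = ?p])
    fix k
    have inv: "\<ominus>\<^bsub>?F\<^esub> q = (\<lambda>i. - q i)" if "q \<in> carrier ?F" for q
      using that by (intro F.minus_equality) auto
    have sub: "hcomp ?F k \<subseteq> carrier ?F" by auto
    have "subgroup (hcomp ?F k) (add_monoid ?F)"
    proof (rule F.add.subgroupI)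
      show "hcomp ?F k \<noteq> {}" by (auto intro!: exI[of _ "\<lambda>i. 0"] exI[of _ 0])
      show "\<ominus>\<^bsub>?F\<^esub> q \<in> hcomp ?F k" if "q \<in> hcomp ?F k" for q
      proof -
        have "\<exists>c. - q i = monom c k" if "i < n" for i
          using \<open>q \<in> hcomp ?F k\<close> that by (auto simp: minus_monom)
        then show ?thesis using that by (subst inv[OF subsetD[OF sub that]]) auto
      qed
      show "p \<oplus>\<^bsub>?F\<^esub> q \<in> hcomp ?F k" if "p \<in> hcomp ?F k" "q \<in> hcomp ?F k" for p q
      proof -
        have "\<exists>c. p i + q i = monom c k" if "i < n" for i
        proof -
          obtain a where "p i = monom a k" using \<open>p \<in> hcomp ?F k\<close> \<open>i < n\<close> by auto
          moreover obtain c where "q i = monom c k" using \<open>q \<in> hcomp ?F k\<close> \<open>i < n\<close> by auto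
          ultimately show ?thesis by (auto simp: add_monom)
        qed
        then show ?thesis using that by auto
      qed
    qed (rule sub)
    then show "additive_subgroup (hcomp ?F k) ?F" by (rule additive_subgroupI)
  next
    show "monom c j \<odot>\<^bsub>?F\<^esub> x \<in> hcomp ?F (j + k)" if x: "x \<in> hcomp ?F k" for k j c x
    proof -
      have "\<exists>a. monom c j * x i = monom a (j + k)" if "i < n" for i
      proof -
        obtain a where "x i = monom a k" using x \<open>i < n\<close> by auto
        then show ?thesis by (auto simp: mult_monom)
      qed
      then show ?thesis using x by auto
    qed
    show "?p k x \<in> hcomp ?F k" if "x \<in> carrier ?F" for k x
      using that by (auto simp: monom_1_dvd_iff' monom_1_dvd_monom)
  next
    fix x assume x: "x \<in> carrier ?F"
    let ?S = "{k. ?p k x \<noteq> \<zero>\<^bsub>?F\<^esub>}"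
    have "k \<in> (\<Union>i<n. {..degree (x i)})" if "k \<in> ?S" for k
    proof -
      obtain i where "coeff (x i) k \<noteq> 0" using \<open>k \<in> ?S\<close> by (auto simp: fun_eq_iff)
      moreover then have "i < n" using x by (auto simp: not_le[symmetric])
      ultimately show ?thesis by (auto intro: le_degree)
    qed
    then have "?S \<subseteq> (\<Union>i<n. {..degree (x i)})" by blast
    then show fin: "finite ?S" by (rule finite_subset) auto
    have "(\<Oplus>\<^bsub>?F\<^esub>k\<in>?S. ?p k x) = (\<lambda>i. \<Sum>k\<in>?S. ?p k x i)"
      using fin x by (intro free_finsum) (auto simp: monom_1_dvd_iff' monom_1_dvd_monom)
    also have "\<dots> = x"
    proof
      fix i
      show "(\<Sum>k\<in>?S. ?p k x i) = x i"
      proof (rule poly_eqI)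
        fix m
        have "coeff (\<Sum>k\<in>?S. ?p k x i) m = (\<Sum>k\<in>?S. if k = m then coeff (x i) m else 0)"
          by (auto simp: coeff_sum intro!: sum.cong)
        also have "\<dots> = (if m \<in> ?S then coeff (x i) m else 0)"
          using fin by simp
        also have "\<dots> = coeff (x i) m" by (auto simp: fun_eq_iff)
        finally show "coeff (\<Sum>k\<in>?S. ?p k x i) m = coeff (x i) m" .
      qed
    qed
    finally show "x = (\<Oplus>\<^bsub>?F\<^esub>k\<in>?S. ?p k x)" by simp
  next
    fix j k x assume x: "x \<in> hcomp ?F j"
    have "monom (coeff (x i) k) k = (if k = j then x i else 0)" for i
    proof (cases "i < n")
      case True
      then obtain c where "x i = monom c j" using x by auto
      then show ?thesis by auto
    qed (use x in auto)
    then show "?p k x = (if k = j then x else \<zero>\<^bsub>?F\<^esub>)" by auto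
  qed (auto simp: free_module add_monom)
qed

text \<open>The homogeneous generator of degree \<open>b j\<close>; the remaining coordinates are zero.\<close>

definition free_gen :: "(nat \<Rightarrow> nat) \<Rightarrow> nat \<Rightarrow> nat \<Rightarrow> complex poly" where
  "free_gen b j = (\<lambda>i. if i = j then monom 1 (b j) else 0)"

lemma free_gen_hcomp: "j < n \<Longrightarrow> free_gen b j \<in> hcomp (free_gmodule n b) (b j)"
  by (auto simp: free_gen_def intro: exI[of _ 1] exI[of _ 0])

lemma free_gen_carrier: "j < n \<Longrightarrow> free_gen b j \<in> carrier (free_gmodule n b)"
  by (auto simp: free_gen_def)

lemma free_induct [consumes 1, case_names zero add gen]:
  assumes "p \<in> carrier (free_gmodule n b)"
    and zero: "P (\<lambda>i. 0)"
    and add: "\<And>p q. p \<in> carrier (free_gmodule n b) \<Longrightarrow> q \<in> carrier (free_gmodule n b) \<Longrightarrow>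
      P p \<Longrightarrow> P q \<Longrightarrow> P (p \<oplus>\<^bsub>free_gmodule n b\<^esub> q)"
    and gen: "\<And>r j. j < n \<Longrightarrow> P (r \<odot>\<^bsub>free_gmodule n b\<^esub> free_gen b j)"
  shows "P p"
proof -
  define t where "t m = (\<lambda>i. if i < m then p i else 0)" for m
  have tc: "t m \<in> carrier (free_gmodule n b)" for m using assms(1) by (auto simp: t_def)
  have "P (t m)" if "m \<le> n" for m
    using that
  proof (induction m)
    case 0
    then show ?case using zero by (simp add: t_def)
  next
    case (Suc m)
    then have "monom 1 (b m) dvd p m" using assms(1) by simp
    then obtain r where r: "p m = monom 1 (b m) * r" by (rule dvdE)
    let ?g = "r \<odot>\<^bsub>free_gmodule n b\<^esub> free_gen b m"
    have "t (Suc m) = t m \<oplus>\<^bsub>free_gmodule n b\<^esub> ?g"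
      using r by (auto simp: t_def free_gen_def fun_eq_iff less_Suc_eq mult.commute)
    moreover have "?g \<in> carrier (free_gmodule n b)"
      using free_gen_carrier[of m n b] Suc.prems by auto
    ultimately show ?case using add[OF tc[of m]] gen[of m r] Suc by simp
  qed
  moreover have "t n = p" using assms(1) by (auto simp: t_def fun_eq_iff not_less)
  ultimately show ?thesis by auto
qed

text \<open>
  Multiplication of a vector of polynomials by a constant matrix. Coordinates from \<open>n\<close> on are set to
  zero, as in \<open>free_gmodule\<close>.
\<close>

definition act :: "nat \<Rightarrow> complex mat \<Rightarrow> (nat \<Rightarrow> complex poly) \<Rightarrow> nat \<Rightarrow> complex poly" where
  "act n A p = (\<lambda>i. if i < n then \<Sum>j<n. [:A $$ (i, j):] * p j else 0)"

lemma act_add: "act n A (\<lambda>i. p i + q i) = (\<lambda>i. act n A p i + act n A q i)"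
  by (auto simp: act_def fun_eq_iff smult_add_right sum.distrib)

lemma act_scale: "act n A (\<lambda>i. r * p i) = (\<lambda>i. r * act n A p i)"
  by (auto simp: act_def fun_eq_iff sum_distrib_left intro!: sum.cong)

lemma act_zero: "act n A (\<lambda>i. 0) = (\<lambda>i. 0)"
  by (auto simp: act_def)

lemma act_act:
  assumes "A \<in> carrier_mat n n" "B \<in> carrier_mat n n"
  shows "act n A (act n B p) = act n (A * B) p"
proof
  fix i
  show "act n A (act n B p) i = act n (A * B) p i"
  proof (cases "i < n")
    case True
    have "act n A (act n B p) i = (\<Sum>l<n. \<Sum>j<n. [:A $$ (i, l):] * ([:B $$ (l, j):] * p j))"
      using True by (simp add: act_def sum_distrib_left)
    also have "\<dots> = (\<Sum>j<n. \<Sum>l<n. [:A $$ (i, l):] * ([:B $$ (l, j):] * p j))"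
      by (rule sum.swap)
    also have "\<dots> = (\<Sum>j<n. [:\<Sum>l<n. A $$ (i, l) * B $$ (l, j):] * p j)"
    proof (intro sum.cong refl)
      fix j
      have "[:\<Sum>l<n. A $$ (i, l) * B $$ (l, j):] = (\<Sum>l<n. [:A $$ (i, l):] * [:B $$ (l, j):])"
        by (intro poly_eqI) (auto simp: coeff_sum coeff_pCons mult.commute split: nat.split)
      then show "(\<Sum>l<n. [:A $$ (i, l):] * ([:B $$ (l, j):] * p j)) = [:\<Sum>l<n. A $$ (i, l) * B $$ (l, j):] * p j"
        by (simp only: sum_distrib_right mult.assoc)
    qed
    also have "\<dots> = act n (A * B) p i"
      using True assms mult_mat_entry[OF assms] by (simp add: act_def)
    finally show ?thesis .
  qed (simp add: act_def)
qed

lemma act_one: "p \<in> carrier (free_gmodule n b) \<Longrightarrow> act n (1\<^sub>m n) p = p"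
proof
  fix i assume p: "p \<in> carrier (free_gmodule n b)"
  have "(\<Sum>j<n. [:1\<^sub>m n $$ (i, j):] * p j) = (\<Sum>j<n. if i = j then p j else 0)" if "i < n"
    using that by (intro sum.cong) auto
  then show "act n (1\<^sub>m n) p i = p i" using p by (auto simp: act_def)
qed

lemma act_free_gen:
  "i < n \<Longrightarrow> j < n \<Longrightarrow> act n A (free_gen d j) i = monom (A $$ (i, j)) (d j)"
proof -
  assume "i < n" "j < n"
  then have "act n A (free_gen d j) i = (\<Sum>l<n. if l = j then [:A $$ (i, j):] * monom 1 (d j) else 0)"
    unfolding act_def free_gen_def by (auto simp only: if_True intro!: sum.cong) auto
  also have "\<dots> = monom (A $$ (i, j)) (d j)" using \<open>j < n\<close> by (simp add: smult_monom)
  finally show ?thesis .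
qed

lemma act_graded_hom:
  assumes "\<And>i j. i < n \<Longrightarrow> j < n \<Longrightarrow> A $$ (i, j) \<noteq> 0 \<Longrightarrow> b i \<le> d j"
  shows "act n A \<in> graded_hom (free_gmodule n d) (free_gmodule n b)"
proof -
  have dvd: "monom 1 (b i) dvd act n A x i" if "i < n" "\<And>j. j < n \<Longrightarrow> monom 1 (d j) dvd x j" for i x
  proof -
    have "monom 1 (b i) dvd [:A $$ (i, j):] * x j" if "j < n" for j
    proof (cases "A $$ (i, j) = 0")
      case False
      then have "monom (1::complex) (b i) dvd monom 1 (d j)"
        using assms \<open>i < n\<close> \<open>j < n\<close> by (simp add: monom_1_dvd_monom)
      then show ?thesis using \<open>\<And>j. j < n \<Longrightarrow> monom 1 (d j) dvd x j\<close>[OF \<open>j < n\<close>] dvd_trans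
        by (intro dvd_mult) blast
    qed simp
    then show ?thesis using \<open>i < n\<close> by (auto simp: act_def intro!: dvd_sum)
  qed
  have hom: "\<exists>c. act n A x i = monom c k" if "i < n" and x: "\<And>j. j < n \<Longrightarrow> \<exists>c. x j = monom c k" for i x k
  proof -
    obtain c where c: "\<And>j. j < n \<Longrightarrow> x j = monom (c j) k" using x by metis
    have "act n A x i = (\<Sum>j<n. monom (A $$ (i, j) * c j) k)"
      using \<open>i < n\<close> c by (auto simp: act_def smult_monom intro!: sum.cong)
    also have "\<dots> = monom (\<Sum>j<n. A $$ (i, j) * c j) k"
      by (intro poly_eqI) (auto simp: coeff_sum)
    finally show ?thesis by blast
  qed
  have z: "act n A x i = 0" if "n \<le> i" for i x using that by (simp add: act_def)
  show ?thesis
    by (intro graded_homI) (auto simp: act_add act_scale dvd hom z)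
qed

lemma graded_hom_free_eqI:
  assumes M: "graded_module M"
    and f: "f \<in> graded_hom (free_gmodule n d) M" and g: "g \<in> graded_hom (free_gmodule n d) M"
    and eq: "\<And>j. j < n \<Longrightarrow> f (free_gen d j) = g (free_gen d j)" and p: "p \<in> carrier (free_gmodule n d)"
  shows "f p = g p"
  using p
proof (induction rule: free_induct)
  case zero
  then show ?case using graded_hom_zero[OF free_graded M f] graded_hom_zero[OF free_graded M g] by simp
next
  case (add p q)
  then show ?case using graded_hom_add[OF f] graded_hom_add[OF g] by metis
next
  case (gen r j)
  then show ?case
    using graded_hom_smult[OF f free_gen_carrier] graded_hom_smult[OF g free_gen_carrier] eq by metis
qed

text \<open>
  Prescribed images of the generators in the right degrees are realised by a constant matrix,
  which automatically respects the degrees.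
\<close>

lemma matrix_of_images:
  assumes "\<And>j. j < n \<Longrightarrow> y j \<in> hcomp (free_gmodule n b) (d j)"
  obtains A where "A \<in> carrier_mat n n" "\<And>i j. i < n \<Longrightarrow> j < n \<Longrightarrow> A $$ (i, j) \<noteq> 0 \<Longrightarrow> b i \<le> d j"
    "\<And>j. j < n \<Longrightarrow> act n A (free_gen d j) = y j"
proof -
  define A where "A = mat n n (\<lambda>(i, j). coeff (y j i) (d j))"
  have ent: "monom (A $$ (i, j)) (d j) = y j i" if ij: "i < n" "j < n" for i j
  proof -
    obtain c where "y j i = monom c (d j)" using assms[OF ij(2)] ij by auto
    then show ?thesis using that by (simp add: A_def)
  qed
  show thesis
  proof (rule that)
    show "A \<in> carrier_mat n n" by (simp add: A_def)
    show "b i \<le> d j" if "i < n" "j < n" "A $$ (i, j) \<noteq> 0" for i j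
    proof -
      have "monom 1 (b i) dvd monom (A $$ (i, j)) (d j)" using assms[OF that(2)] that ent by auto
      then show ?thesis using that by (simp add: monom_1_dvd_monom)
    qed
    show "act n A (free_gen d j) = y j" if j: "j < n" for j
    proof
      fix i
      show "act n A (free_gen d j) i = y j i"
        using act_free_gen[of i n j] ent[of i j] assms[OF j] j
        by (cases "i < n") (auto simp: act_def)
    qed
  qed
qed

lemma graded_hom_free_matrix:
  assumes f: "f \<in> graded_hom (free_gmodule n d) (free_gmodule n b)"
  obtains A where "A \<in> carrier_mat n n" "\<And>p. p \<in> carrier (free_gmodule n d) \<Longrightarrow> f p = act n A p"
proof -
  obtain A where A: "A \<in> carrier_mat n n" "\<And>i j. i < n \<Longrightarrow> j < n \<Longrightarrow> A $$ (i, j) \<noteq> 0 \<Longrightarrow> b i \<le> d j"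
    "\<And>j. j < n \<Longrightarrow> act n A (free_gen d j) = f (free_gen d j)"
    using matrix_of_images[of n "\<lambda>j. f (free_gen d j)" b d] graded_hom_hcomp[OF f free_gen_hcomp]
    by metis
  have g: "act n A \<in> graded_hom (free_gmodule n d) (free_gmodule n b)"
    using A(2) by (rule act_graded_hom)
  have "f p = act n A p" if "p \<in> carrier (free_gmodule n d)" for p
    by (rule graded_hom_free_eqI[OF free_graded f g _ that]) (simp add: A(3))
  then show thesis using that A by blast
qed

lemma act_inj_imp_GL:
  assumes A: "A \<in> carrier_mat n n" and inj: "inj_on (act n A) (carrier (free_gmodule n d))"
  shows "A \<in> GL n"
proof (rule ccontr)
  assume "A \<notin> GL n"
  then obtain v where v: "v \<in> carrier_vec n" "v \<noteq> 0\<^sub>v n" "A *\<^sub>v v = 0\<^sub>v n"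
    using A det_0_iff_vec_prod_zero[OF A] by (auto simp: GL_iff_det)
  \<comment> \<open>\<open>N\<close> bounds all degrees \<open>d i\<close>, so that \<open>z^N v\<close> lies in the free module.\<close>
  define N where "N = (\<Sum>i<n. d i)"
  define p where "p = (\<lambda>i. if i < n then monom (v $ i) N else 0)"
  have "d i \<le> N" if "i < n" for i using that by (auto simp: N_def intro: member_le_sum)
  then have pc: "p \<in> carrier (free_gmodule n d)" by (auto simp: p_def monom_1_dvd_monom)
  have "act n A p i = 0" for i
  proof (cases "i < n")
    case True
    have "(\<Sum>j<n. A $$ (i, j) * v $ j) = (A *\<^sub>v v) $ i"
      using True A v(1) by (auto simp: scalar_prod_def atLeast0LessThan)
    then have "(\<Sum>j<n. A $$ (i, j) * v $ j) = 0" using v True by simp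
    moreover have "act n A p i = monom (\<Sum>j<n. A $$ (i, j) * v $ j) N"
      using True by (intro poly_eqI) (auto simp: act_def p_def coeff_sum smult_monom intro!: sum.cong)
    ultimately show ?thesis by simp
  qed (simp add: act_def)
  then have "act n A p = act n A (\<lambda>i. 0)" by (simp add: act_zero fun_eq_iff)
  then have p0: "p = (\<lambda>i. 0)" using inj pc by (auto dest: inj_onD)
  have "v $ i = 0" if "i < n" for i using fun_cong[OF p0, of i] that by (simp add: p_def)
  then have "v = 0\<^sub>v n" using v(1) by (intro eq_vecI) auto
  then show False using v by simp
qed

lemma act_inj:
  assumes A: "A \<in> GL n"
  shows "inj_on (act n A) (carrier (free_gmodule n d))"
proof -
  obtain B where B: "B \<in> GL n" "B * A = 1\<^sub>m n" using GL_inverse[OF A] by blast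
  have "act n B (act n A p) = p" if "p \<in> carrier (free_gmodule n d)" for p
    using act_act[OF GL_carrier[OF B(1)] GL_carrier[OF A]] act_one[OF that] B(2) by simp
  then show ?thesis by (intro inj_on_inverseI[of _ "act n B"])
qed

text \<open>The invertible matrices that define endomorphisms of a free module with increasing degrees.\<close>

lemma Borel_iff_act_closed:
  assumes C: "C \<in> GL n" and d: "strict_mono_on {..<n} d"
  shows "C \<in> Borel n \<longleftrightarrow> act n C ` carrier (free_gmodule n d) \<subseteq> carrier (free_gmodule n d)"
proof
  assume B: "C \<in> Borel n"
  have "d i \<le> d j" if "i < n" "j < n" "C $$ (i, j) \<noteq> 0" for i j
    using Borel_entry[OF B, of j i] that strict_mono_on_leD[OF d, of i j] by (meson lessThan_iff not_le)
  then have h: "act n C \<in> graded_hom (free_gmodule n d) (free_gmodule n d)" by (rule act_graded_hom)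
  show "act n C ` carrier (free_gmodule n d) \<subseteq> carrier (free_gmodule n d)"
    by (rule image_subsetI) (rule graded_hom_closed[OF h])
next
  assume sub: "act n C ` carrier (free_gmodule n d) \<subseteq> carrier (free_gmodule n d)"
  show "C \<in> Borel n"
  proof (rule BorelI[OF C])
    fix i j assume ij: "j < i" "i < n"
    have "act n C (free_gen d j) \<in> carrier (free_gmodule n d)"
      by (rule subsetD[OF sub imageI[OF free_gen_carrier]]) (use ij in simp)
    then have "monom 1 (d i) dvd act n C (free_gen d j) i" using ij by simp
    then have "monom 1 (d i) dvd monom (C $$ (i, j)) (d j)" using act_free_gen[of i n j C d] ij by simp
    moreover have "d j < d i" using strict_mono_onD[OF d, of j i] ij by simp
    ultimately show "C $$ (i, j) = 0" by (simp add: monom_1_dvd_monom)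
  qed
qed

lemma act_Borel_image:
  assumes C: "C \<in> Borel n" and d: "strict_mono_on {..<n} d"
  shows "act n C ` carrier (free_gmodule n d) = carrier (free_gmodule n d)"
proof
  show "act n C ` carrier (free_gmodule n d) \<subseteq> carrier (free_gmodule n d)"
    by (rule iffD1[OF Borel_iff_act_closed[OF Borel_GL[OF C] d] C])
  obtain D where D: "D \<in> Borel n" "C * D = 1\<^sub>m n" using Borel_inverse[OF C] by blast
  show "carrier (free_gmodule n d) \<subseteq> act n C ` carrier (free_gmodule n d)"
  proof
    fix p assume p: "p \<in> carrier (free_gmodule n d)"
    have "act n C (act n D p) = p"
      using act_act[OF Borel_carrier[OF C] Borel_carrier[OF D(1)]] D(2) act_one[OF p] by simp
    moreover have "act n D p \<in> carrier (free_gmodule n d)"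
      by (rule subsetD[OF iffD1[OF Borel_iff_act_closed[OF Borel_GL[OF D(1)] d] D(1)] imageI[OF p]])
    ultimately show "p \<in> act n C ` carrier (free_gmodule n d)" by (rule image_eqI[OF sym])
  qed
qed


section \<open>Kernels and their quotients\<close>

text \<open>The image of a generating set generates the quotient; generation is stated by submodules.\<close>

lemma (in graded_quotient) quotient_span:
  assumes "\<And>N. LinearCombinations.submodule Cz N M \<Longrightarrow> S \<subseteq> N \<Longrightarrow> N = carrier M"
    and "S \<subseteq> carrier M"
  shows "LinearCombinations.module.span Cz (M /\<^sub>g K) ((\<lambda>x. K +> x) ` S) = carrier (M /\<^sub>g K)"
proof -
  interpret Q: graded_module "M /\<^sub>g K" by (rule quotient_graded_module)
  let ?T = "(\<lambda>x. K +> x) ` S"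
  let ?P = "LinearCombinations.module.span Cz (M /\<^sub>g K) ?T"
  have T: "?T \<subseteq> carrier (M /\<^sub>g K)" using assms(2) by (auto simp: quotient_carrier)
  have P: "LinearCombinations.submodule Cz ?P (M /\<^sub>g K)" by (rule Q.span_is_submodule[OF T])
  let ?N = "{x \<in> carrier M. K +> x \<in> ?P}"
  have "LinearCombinations.submodule Cz ?N M"
  proof (rule closed_subset_submodule[OF graded_module_axioms])
    show "\<zero> \<in> ?N"
      using LinearCombinations.submodule.zero_closed[OF P] a_subset by (simp add: quotient_zero)
    show "x \<oplus> y \<in> ?N" if "x \<in> ?N" "y \<in> ?N" for x y
      using LinearCombinations.submodule.m_closed[OF P, of "K +> x" "K +> y"] that by (simp add: quotient_add)
    show "r \<odot> x \<in> ?N" if "x \<in> ?N" for r x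
      using LinearCombinations.submodule.smult_closed[OF P, of r "K +> x"] that smult_closed[of r x]
      by (simp add: quotient_smult)
  qed auto
  moreover have "S \<subseteq> ?N" using assms(2) Q.in_own_span[OF T] by auto
  ultimately have "?N = carrier M" by (rule assms(1))
  then have "carrier (M /\<^sub>g K) \<subseteq> ?P" by (auto simp: quotient_carrier)
  then show ?thesis using Q.span_is_subset2[OF T] by blast
qed

text \<open>
  The standing hypotheses. \<open>E\<close> and \<open>D\<close> are the free modules on the births and on the deaths, and \<open>F0\<close>
  is isomorphic to \<open>E\<close> by its basis.
\<close>

locale births_deaths =
  fixes n :: nat and b d :: "nat \<Rightarrow> nat" and F0 :: "'f gmodule" and \<xi> :: "nat \<Rightarrow> 'f"
  assumes b: "strict_mono_on {..<n} b" and b_less_d: "b (n - 1) < d 0" and d: "strict_mono_on {..<n} d"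
    and F0: "graded_module F0" and basis: "homogeneous_basis F0 n b \<xi>"
begin

abbreviation "E \<equiv> free_gmodule n b"
abbreviation "D \<equiv> free_gmodule n d"

sublocale F: graded_module F0 by (rule F0)

lemma birth_less_death:
  assumes "i < n" "j < n" shows "b i < d j"
proof -
  have "i \<le> n - 1" "n - 1 < n" using assms by auto
  then have "b i \<le> b (n - 1)" using strict_mono_on_leD[OF b, of i "n - 1"] assms by simp
  moreover have "d 0 \<le> d j" using strict_mono_on_leD[OF d, of 0 j] assms by simp
  ultimately show ?thesis using b_less_d by simp
qed

lemma \<xi>_hcomp: "i < n \<Longrightarrow> \<xi> i \<in> hcomp F0 (b i)"
  using basis by (simp add: homogeneous_basis_def)

lemma \<xi>_carrier: "i < n \<Longrightarrow> \<xi> i \<in> carrier F0"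
  using \<xi>_hcomp F.hcomp_carrier by blast

text \<open>
  The isomorphism \<open>E \<rightarrow> F0\<close> sending the generators of \<open>E\<close> to the basis \<open>\<xi>\<close>. Elements of \<open>E\<close> are divisible
  by \<open>z^(b i)\<close> in coordinate \<open>i\<close>, so the divisions are exact.
\<close>

definition coords :: "(nat \<Rightarrow> complex poly) \<Rightarrow> 'f" where
  "coords p = (\<Oplus>\<^bsub>F0\<^esub>i\<in>{..<n}. (p i div monom 1 (b i)) \<odot>\<^bsub>F0\<^esub> \<xi> i)"

lemma term_carrier: "(\<lambda>i. c i \<odot>\<^bsub>F0\<^esub> \<xi> i) \<in> {..<n} \<rightarrow> carrier F0"
  using \<xi>_carrier by simp

lemma coords_graded_hom: "coords \<in> graded_hom E F0"
proof (rule graded_homI)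
  show "coords p \<in> carrier F0" for p
    unfolding coords_def by (rule F.finsum_closed[OF term_carrier])
next
  fix p q assume p: "p \<in> carrier E" and q: "q \<in> carrier E"
  have "coords (p \<oplus>\<^bsub>E\<^esub> q) = (\<Oplus>\<^bsub>F0\<^esub>i\<in>{..<n}. (p i div monom 1 (b i)) \<odot>\<^bsub>F0\<^esub> \<xi> i
      \<oplus>\<^bsub>F0\<^esub> (q i div monom 1 (b i)) \<odot>\<^bsub>F0\<^esub> \<xi> i)"
    unfolding coords_def
  proof (intro F.finsum_cong' refl)
    fix i assume "i \<in> {..<n}"
    then show "((p \<oplus>\<^bsub>E\<^esub> q) i div monom 1 (b i)) \<odot>\<^bsub>F0\<^esub> \<xi> i = (p i div monom 1 (b i)) \<odot>\<^bsub>F0\<^esub> \<xi> i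
      \<oplus>\<^bsub>F0\<^esub> (q i div monom 1 (b i)) \<odot>\<^bsub>F0\<^esub> \<xi> i"
      using p q F.smult_l_distr[of "p i div monom 1 (b i)" "q i div monom 1 (b i)" "\<xi> i"] \<xi>_carrier[of i]
      by (simp add: div_add)
  qed (use \<xi>_carrier in auto)
  also have "\<dots> = coords p \<oplus>\<^bsub>F0\<^esub> coords q"
    unfolding coords_def by (rule F.finsum_addf[OF term_carrier term_carrier])
  finally show "coords (p \<oplus>\<^bsub>E\<^esub> q) = coords p \<oplus>\<^bsub>F0\<^esub> coords q" .
next
  fix r p assume p: "p \<in> carrier E"
  have "r \<odot>\<^bsub>F0\<^esub> coords p = (\<Oplus>\<^bsub>F0\<^esub>i\<in>{..<n}. r \<odot>\<^bsub>F0\<^esub> ((p i div monom 1 (b i)) \<odot>\<^bsub>F0\<^esub> \<xi> i))"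
    unfolding coords_def using term_carrier F.smult_r_distr[of r]
    by (intro additive_finsum F.is_abelian_group) auto
  also have "\<dots> = coords (r \<odot>\<^bsub>E\<^esub> p)"
    unfolding coords_def
  proof (intro F.finsum_cong' refl)
    fix i assume "i \<in> {..<n}"
    then show "r \<odot>\<^bsub>F0\<^esub> ((p i div monom 1 (b i)) \<odot>\<^bsub>F0\<^esub> \<xi> i) = ((r \<odot>\<^bsub>E\<^esub> p) i div monom 1 (b i)) \<odot>\<^bsub>F0\<^esub> \<xi> i"
      using p F.smult_assoc1[of r "p i div monom 1 (b i)" "\<xi> i"] \<xi>_carrier[of i]
      by (simp add: div_mult_swap)
  qed (use \<xi>_carrier in auto)
  finally show "coords (r \<odot>\<^bsub>E\<^esub> p) = r \<odot>\<^bsub>F0\<^esub> coords p" by simp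
next
  fix k p assume p: "p \<in> hcomp E k"
  have t: "(p i div monom 1 (b i)) \<odot>\<^bsub>F0\<^esub> \<xi> i \<in> hcomp F0 k" if i: "i < n" for i
  proof -
    obtain c where c: "p i = monom c k" using p i by auto
    have "monom 1 (b i) dvd monom c k" using p i c by auto
    then consider "c = 0" | "b i \<le> k" by (auto simp: monom_1_dvd_monom)
    then show ?thesis
    proof cases
      case 1
      then show ?thesis using c F.hcomp_zero F.smult_l_null[OF \<xi>_carrier[OF i]] by simp
    next
      case 2
      have "monom c k = monom c (k - b i) * monom 1 (b i)" using 2 by (simp add: mult_monom)
      then have "p i div monom 1 (b i) = monom c (k - b i)"
        unfolding c by (metis monom_eq_0_iff nonzero_mult_div_cancel_right zero_neq_one)
      then show ?thesis using F.smult_hcomp[OF \<xi>_hcomp[OF i], of c "k - b i"] 2 by simp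
    qed
  qed
  have "(\<Oplus>\<^bsub>F0\<^esub>i\<in>{..<m}. (p i div monom 1 (b i)) \<odot>\<^bsub>F0\<^esub> \<xi> i) \<in> hcomp F0 k" if "m \<le> n" for m
    using that
  proof (induction m)
    case (Suc m)
    have "(\<Oplus>\<^bsub>F0\<^esub>i\<in>insert m {..<m}. (p i div monom 1 (b i)) \<odot>\<^bsub>F0\<^esub> \<xi> i) =
      (p m div monom 1 (b m)) \<odot>\<^bsub>F0\<^esub> \<xi> m \<oplus>\<^bsub>F0\<^esub> (\<Oplus>\<^bsub>F0\<^esub>i\<in>{..<m}. (p i div monom 1 (b i)) \<odot>\<^bsub>F0\<^esub> \<xi> i)"
      using Suc.prems \<xi>_carrier by (intro F.finsum_insert) auto
    then show ?case using Suc t[of m] F.hcomp_add by (simp add: lessThan_Suc)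
  qed (simp add: F.hcomp_zero)
  then show "coords p \<in> hcomp F0 k" unfolding coords_def by simp
qed

lemma coords_closed: "p \<in> carrier E \<Longrightarrow> coords p \<in> carrier F0"
  by (rule graded_hom_closed[OF coords_graded_hom])

lemma coords_bij: "bij_betw coords (carrier E) (carrier F0)"
  unfolding bij_betw_def
proof
  have ex1: "\<exists>!p. p \<in> {..<n} \<rightarrow>\<^sub>E carrier Cz \<and> x = (\<Oplus>\<^bsub>F0\<^esub>i\<in>{..<n}. p i \<odot>\<^bsub>F0\<^esub> \<xi> i)"
    if "x \<in> carrier F0" for x
    using basis that by (simp add: homogeneous_basis_def)
  have coords_res: "coords p = (\<Oplus>\<^bsub>F0\<^esub>i\<in>{..<n}. (\<lambda>i\<in>{..<n}. p i div monom 1 (b i)) i \<odot>\<^bsub>F0\<^esub> \<xi> i)" for p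
    unfolding coords_def using \<xi>_carrier by (intro F.finsum_cong') auto
  show "inj_on coords (carrier E)"
  proof (rule inj_onI)
    fix p q assume p: "p \<in> carrier E" and q: "q \<in> carrier E" and eq: "coords p = coords q"
    have res_eq: "(\<lambda>i\<in>{..<n}. p i div monom 1 (b i)) = (\<lambda>i\<in>{..<n}. q i div monom 1 (b i))"
    proof (rule trans[OF the1_equality[OF ex1[OF coords_closed[OF p]], symmetric]
          the1_equality[OF ex1[OF coords_closed[OF p]]]])
      show "(\<lambda>i\<in>{..<n}. p i div monom 1 (b i)) \<in> {..<n} \<rightarrow>\<^sub>E carrier Cz \<and>
        coords p = (\<Oplus>\<^bsub>F0\<^esub>i\<in>{..<n}. (\<lambda>i\<in>{..<n}. p i div monom 1 (b i)) i \<odot>\<^bsub>F0\<^esub> \<xi> i)"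
        by (rule conjI[OF _ coords_res]) simp
      show "(\<lambda>i\<in>{..<n}. q i div monom 1 (b i)) \<in> {..<n} \<rightarrow>\<^sub>E carrier Cz \<and>
        coords p = (\<Oplus>\<^bsub>F0\<^esub>i\<in>{..<n}. (\<lambda>i\<in>{..<n}. q i div monom 1 (b i)) i \<odot>\<^bsub>F0\<^esub> \<xi> i)"
        unfolding eq by (rule conjI[OF _ coords_res]) simp
    qed
    have div_eq: "p i div monom 1 (b i) = q i div monom 1 (b i)" if "i < n" for i
      using fun_cong[OF res_eq, of i] that by simp
    show "p = q"
    proof
      fix i
      show "p i = q i"
      proof (cases "i < n")
        case True
        then have "monom 1 (b i) dvd p i" "monom 1 (b i) dvd q i" using p q by auto
        then have "monom 1 (b i) * (p i div monom 1 (b i)) = p i" "monom 1 (b i) * (q i div monom 1 (b i)) = q i"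
          by (simp_all only: dvd_mult_div_cancel)
        then show ?thesis unfolding div_eq[OF True] by simp
      qed (use p q in auto)
    qed
  qed
  show "coords ` carrier E = carrier F0"
  proof
    show "carrier F0 \<subseteq> coords ` carrier E"
    proof
      fix x assume "x \<in> carrier F0"
      then obtain p where p: "x = (\<Oplus>\<^bsub>F0\<^esub>i\<in>{..<n}. p i \<odot>\<^bsub>F0\<^esub> \<xi> i)" using ex1 by blast
      let ?q = "\<lambda>i. if i < n then p i * monom 1 (b i) else 0"
      have "coords ?q = x"
        unfolding p coords_def using \<xi>_carrier by (intro F.finsum_cong') auto
      moreover have "?q \<in> carrier E" by simp
      ultimately show "x \<in> coords ` carrier E" by (rule image_eqI[OF sym])
    qed
  qed (rule image_subsetI[OF coords_closed])
qed

lemma coords_inj: "inj_on coords (carrier E)"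
  using coords_bij by (simp add: bij_betw_def)

lemma coords_surj: "coords ` carrier E = carrier F0"
  using coords_bij by (simp add: bij_betw_def)

lemma coords_gen:
  assumes i: "i < n" shows "coords (free_gen b i) = \<xi> i"
proof -
  have "coords (free_gen b i) = (\<Oplus>\<^bsub>F0\<^esub>j\<in>{..<n}. if i = j then \<xi> j else \<zero>\<^bsub>F0\<^esub>)"
    unfolding coords_def
  proof (intro F.finsum_cong' refl)
    fix j assume "j \<in> {..<n}"
    then show "(free_gen b i j div monom 1 (b j)) \<odot>\<^bsub>F0\<^esub> \<xi> j = (if i = j then \<xi> j else \<zero>\<^bsub>F0\<^esub>)"
      using F.smult_one[OF \<xi>_carrier[of j]] F.smult_l_null[OF \<xi>_carrier[of j]]
      by (auto simp: free_gen_def)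
  qed (use \<xi>_carrier in auto)
  also have "\<dots> = \<xi> i" using i \<xi>_carrier by (intro F.finsum_singleton) auto
  finally show ?thesis .
qed

lemma act_D_E: "act n A \<in> graded_hom D E"
  using birth_less_death by (intro act_graded_hom) (simp add: less_imp_le)

lemma act_D_carrier: "x \<in> carrier D \<Longrightarrow> act n A x \<in> carrier E"
  by (rule graded_hom_closed[OF act_D_E])

text \<open>The homomorphism \<open>D \<rightarrow> F0\<close> with matrix \<open>A\<close>.\<close>

definition emb :: "complex mat \<Rightarrow> (nat \<Rightarrow> complex poly) \<Rightarrow> 'f" where
  "emb A x = coords (act n A x)"

lemma emb_graded_hom: "emb A \<in> graded_hom D F0"
  using graded_hom_comp[OF act_D_E coords_graded_hom] by (simp add: emb_def[abs_def])

lemma emb_inj: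
  assumes "A \<in> GL n" shows "inj_on (emb A) (carrier D)"
proof (rule inj_onI)
  fix x y assume x: "x \<in> carrier D" and y: "y \<in> carrier D" and "emb A x = emb A y"
  then have "act n A x = act n A y"
    using inj_onD[OF coords_inj, of "act n A x" "act n A y"] act_D_carrier by (simp add: emb_def del: free_simps)
  then show "x = y" using inj_onD[OF act_inj[OF assms, of d]] x y by blast
qed

text \<open>The submodule \<open>K_A\<close> of \<open>F0\<close> as the image of \<open>emb A\<close>; it is the kernel of \<open>F0 \<rightarrow> F0 / K_A\<close>.\<close>

definition ker :: "complex mat \<Rightarrow> 'f set" where
  "ker A = emb A ` carrier D"

lemma coords_in_ker_iff:
  assumes "p \<in> carrier E"
  shows "coords p \<in> ker A \<longleftrightarrow> p \<in> act n A ` carrier D"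
proof
  assume "coords p \<in> ker A"
  then obtain x where x: "x \<in> carrier D" "coords p = coords (act n A x)"
    unfolding ker_def emb_def by blast
  have "p = act n A x" by (rule inj_onD[OF coords_inj x(2) assms act_D_carrier[OF x(1)]])
  then show "p \<in> act n A ` carrier D" using x(1) by blast
next
  assume "p \<in> act n A ` carrier D"
  then show "coords p \<in> ker A" unfolding ker_def emb_def by blast
qed

lemma ker_graded_submodule: "graded_submodule (ker A) F0"
  unfolding ker_def by (rule graded_submodule_image[OF free_graded F0 emb_graded_hom])

lemma restrict_ker_iso:
  assumes "A \<in> GL n" shows "restrict_gmodule F0 (ker A) \<cong>\<^sub>g D"
proof -
  have "D \<cong>\<^sub>g restrict_gmodule F0 (ker A)"
    unfolding ker_def by (rule graded_iso_image[OF free_graded F0 emb_graded_hom emb_inj[OF assms]])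
  moreover have "graded_module (restrict_gmodule F0 (ker A))"
    using ker_graded_submodule by (simp add: graded_submodule_def)
  ultimately show ?thesis using graded_iso_sym[OF free_graded] by blast
qed

lemma ker_in_kernels: "A \<in> GL n \<Longrightarrow> ker A \<in> kernels F0 n d"
  unfolding kernels_def using ker_graded_submodule restrict_ker_iso by blast

lemma kernelsE:
  assumes K: "K \<in> kernels F0 n d"
  obtains A where "A \<in> GL n" "K = ker A"
proof -
  have KG: "graded_submodule K F0" and iso: "restrict_gmodule F0 K \<cong>\<^sub>g D"
    using K by (auto simp: kernels_def)
  have R: "graded_module (restrict_gmodule F0 K)" and KF: "K \<subseteq> carrier F0"
    using KG submodule.subset by (auto simp: graded_submodule_def)
  obtain f where f: "f \<in> graded_hom D (restrict_gmodule F0 K)" "bij_betw f (carrier D) K"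
    using graded_iso_sym[OF R free_graded iso] by (auto simp: graded_iso_def)
  have inc: "(\<lambda>x. x) \<in> graded_hom (restrict_gmodule F0 K) F0"
    using KF by (intro graded_homI) auto
  obtain g where g: "g \<in> graded_hom F0 E" "bij_betw g (carrier F0) (carrier E)"
    "\<And>y. y \<in> carrier F0 \<Longrightarrow> coords (g y) = y"
    using graded_inverse[OF free_graded F0 coords_graded_hom coords_bij] by metis
  have h: "(\<lambda>x. g (f x)) \<in> graded_hom D E"
    using graded_hom_comp[OF graded_hom_comp[OF f(1) inc] g(1)] .
  obtain A where A: "A \<in> carrier_mat n n" "\<And>p. p \<in> carrier D \<Longrightarrow> g (f p) = act n A p"
    using graded_hom_free_matrix[OF h] by metis
  have fc: "f x \<in> carrier F0" if "x \<in> carrier D" for x using f(2) KF that by (auto simp: bij_betw_def simp del: free_simps)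
  have emb: "emb A x = f x" if "x \<in> carrier D" for x
    using A(2)[OF that] g(3)[OF fc[OF that]] by (simp add: emb_def)
  have "inj_on (act n A) (carrier D)"
  proof (rule inj_onI)
    fix x y assume x: "x \<in> carrier D" and y: "y \<in> carrier D" and "act n A x = act n A y"
    then have "f x = f y" using emb[OF x] emb[OF y] by (simp add: emb_def)
    then show "x = y" using f(2) x y by (auto simp: bij_betw_def dest: inj_onD simp del: free_simps)
  qed
  then have "A \<in> GL n" by (rule act_inj_imp_GL[OF A(1)])
  moreover have "K = ker A"
    using f(2) image_cong[OF refl emb, of "carrier D" "\<lambda>x. x"] by (simp add: ker_def bij_betw_def del: free_simps)
  ultimately show thesis using that by blast
qed

lemma kernel_gen_eq: 
  assumes j: "j < n"
  shows "kernel_gen F0 n b d \<xi> A j = emb A (free_gen d j)"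
  unfolding kernel_gen_def emb_def coords_def
proof (intro F.finsum_cong' refl)
  fix i assume "i \<in> {..<n}"
  then have i: "i < n" by simp
  have "monom (A $$ (i, j)) (d j) = monom (A $$ (i, j)) (d j - b i) * monom 1 (b i)"
    using birth_less_death[OF i j] by (simp add: mult_monom)
  then have "act n A (free_gen d j) i div monom 1 (b i) = monom (A $$ (i, j)) (d j - b i)"
    unfolding act_free_gen[OF i j] by (metis monom_eq_0_iff nonzero_mult_div_cancel_right zero_neq_one)
  then show "monom (A $$ (i, j)) (d j - b i) \<odot>\<^bsub>F0\<^esub> \<xi> i = (act n A (free_gen d j) i div monom 1 (b i)) \<odot>\<^bsub>F0\<^esub> \<xi> i"
    by simp
qed (use \<xi>_carrier in auto)

lemma kernel_of_eq: "kernel_of F0 n b d \<xi> A = ker A"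
proof
  let ?S = "kernel_gen F0 n b d \<xi> A ` {..<n}"
  have S: "?S \<subseteq> ker A" using kernel_gen_eq free_gen_carrier unfolding ker_def by auto
  have kF: "ker A \<subseteq> carrier F0"
    unfolding ker_def using graded_hom_closed[OF emb_graded_hom] by blast
  have k: "LinearCombinations.submodule Cz (ker A) F0"
    using ker_graded_submodule by (simp add: graded_submodule_def)
  show "kernel_of F0 n b d \<xi> A \<subseteq> ker A"
    unfolding kernel_of_def by (rule F.span_is_subset[OF S k])
  let ?P = "LinearCombinations.module.span Cz F0 ?S"
  have P: "LinearCombinations.submodule Cz ?P F0"
    by (rule F.span_is_submodule[OF subset_trans[OF S kF]])
  have "emb A x \<in> ?P" if "x \<in> carrier D" for x
    using that
  proof (induction rule: free_induct)
    case zero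
    then show ?case
      using graded_hom_zero[OF free_graded F0 emb_graded_hom] LinearCombinations.submodule.zero_closed[OF P] by simp
  next
    case (add p q)
    then show ?case
      using graded_hom_add[OF emb_graded_hom add(1,2)] LinearCombinations.submodule.m_closed[OF P] by simp
  next
    case (gen r j)
    have "emb A (free_gen d j) \<in> ?P"
      unfolding kernel_gen_eq[OF gen, symmetric]
      using subsetD[OF F.in_own_span[OF subset_trans[OF S kF]]] gen by blast
    then show ?case
      using graded_hom_smult[OF emb_graded_hom free_gen_carrier[OF gen]]
        LinearCombinations.submodule.smult_closed[OF P, of r "emb A (free_gen d j)"] by simp
  qed
  then show "ker A \<subseteq> kernel_of F0 n b d \<xi> A" unfolding kernel_of_def ker_def by blast
qed

lemma ker_mult_Borel:
  assumes "A \<in> GL n" "C \<in> Borel n" shows "ker (A * C) = ker A"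
proof -
  have "emb (A * C) x = emb A (act n C x)" for x
    unfolding emb_def act_act[OF GL_carrier[OF assms(1)] Borel_carrier[OF assms(2)]] ..
  then have "ker (A * C) = emb A ` (act n C ` carrier D)"
    by (simp add: ker_def image_image del: free_simps)
  then show ?thesis unfolding act_Borel_image[OF assms(2) d] ker_def .
qed

text \<open>If \<open>A' D \<subseteq> A D\<close> then \<open>inverse A * A'\<close> maps \<open>D\<close> into itself.\<close>

lemma ker_subset_imp:
  assumes A: "A \<in> GL n" and A': "A' \<in> GL n" and sub: "act n A' ` carrier D \<subseteq> act n A ` carrier D"
  obtains C where "C \<in> Borel n" "A' = A * C"
proof -
  obtain B where B: "B \<in> GL n" "A * B = 1\<^sub>m n" "B * A = 1\<^sub>m n" using GL_inverse[OF A] by blast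
  note c = GL_carrier[OF A] GL_carrier[OF A'] GL_carrier[OF B(1)]
  have "act n (B * A') x \<in> carrier D" if x: "x \<in> carrier D" for x
  proof -
    obtain y where y: "y \<in> carrier D" "act n A' x = act n A y" using sub x by blast
    have "act n (B * A') x = act n B (act n A y)" unfolding y(2)[symmetric] act_act[OF c(3) c(2)] ..
    also have "\<dots> = y" unfolding act_act[OF c(3) c(1)] B(3) by (rule act_one[OF y(1)])
    finally show ?thesis using y(1) by (simp only:)
  qed
  then have "B * A' \<in> Borel n"
    using Borel_iff_act_closed[OF GL_mult[OF B(1) A'] d] by blast
  moreover have "A' = A * (B * A')"
    using c B(2) by (simp flip: assoc_mult_mat[of _ n n _ n _ n])
  ultimately show thesis using that by blast
qed

lemma ker_eq_imp:
  assumes A: "A \<in> GL n" and A': "A' \<in> GL n" and eq: "ker A = ker A'"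
  obtains C where "C \<in> Borel n" "A' = A * C"
proof -
  have "act n A' x \<in> act n A ` carrier D" if x: "x \<in> carrier D" for x
  proof -
    have "coords (act n A' x) \<in> ker A" unfolding eq unfolding ker_def emb_def using x by (rule imageI)
    then show ?thesis unfolding coords_in_ker_iff[OF act_D_carrier[OF x]] .
  qed
  then show thesis using ker_subset_imp[OF A A' image_subsetI that] by simp
qed

lemma ker_quotient: "graded_quotient F0 (ker A)"
  using F0 ker_graded_submodule by (auto intro!: graded_quotient.intro simp: graded_quotient_axioms_def)

text \<open>
  The automorphism \<open>C\<close> of \<open>E\<close> carries \<open>A D\<close> to \<open>C A D\<close>, hence induces an isomorphism of the
  quotients.
\<close>

lemma quotient_ker_mult:
  assumes A: "A \<in> GL n" and C: "C \<in> Borel n"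
  shows "E /\<^sub>g (act n A ` carrier D) \<cong>\<^sub>g F0 /\<^sub>g ker (C * A)"
proof (rule graded_first_isomorphism[OF free_graded])
  interpret Q: graded_quotient F0 "ker (C * A)" by (rule ker_quotient)
  show "graded_module (F0 /\<^sub>g ker (C * A))" by (rule Q.quotient_graded_module)
  let ?g = "\<lambda>p. ker (C * A) +>\<^bsub>F0\<^esub> coords (act n C p)"
  have c: "act n C p \<in> carrier E" if "p \<in> carrier E" for p
    by (rule subsetD[OF equalityD1[OF act_Borel_image[OF C b]] imageI[OF that]])
  have "b i \<le> b j" if "i < n" "j < n" "C $$ (i, j) \<noteq> 0" for i j
    using Borel_entry[OF C, of j i] that strict_mono_on_leD[OF b, of i j] by (meson lessThan_iff not_le)
  then have "act n C \<in> graded_hom E E" by (rule act_graded_hom)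
  then show "?g \<in> graded_hom E (F0 /\<^sub>g ker (C * A))"
    by (rule graded_hom_comp[OF graded_hom_comp[OF _ coords_graded_hom] Q.coset_graded_hom])
  have "?g ` carrier E = (\<lambda>x. ker (C * A) +>\<^bsub>F0\<^esub> x) ` coords ` act n C ` carrier E"
    by (simp only: image_image)
  then show "?g ` carrier E = carrier (F0 /\<^sub>g ker (C * A))"
    unfolding act_Borel_image[OF C b] coords_surj Q.quotient_carrier .
  have "p \<in> act n A ` carrier D \<longleftrightarrow> ?g p = ker (C * A)" if p: "p \<in> carrier E" for p
  proof -
    have "?g p = ker (C * A) \<longleftrightarrow> act n C p \<in> act n (C * A) ` carrier D"
      unfolding Q.coset_eq_K_iff[OF coords_closed[OF c[OF p]]] coords_in_ker_iff[OF c[OF p]] ..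
    also have "act n (C * A) ` carrier D = act n C ` act n A ` carrier D"
      by (simp add: image_image act_act[OF Borel_carrier[OF C] GL_carrier[OF A]] del: free_simps)
    also have "act n C p \<in> act n C ` act n A ` carrier D \<longleftrightarrow> p \<in> act n A ` carrier D"
      by (rule inj_on_image_mem_iff[OF act_inj[OF Borel_GL[OF C]] p image_subsetI[OF act_D_carrier]])
    finally show ?thesis by simp
  qed
  moreover have "act n A ` carrier D \<subseteq> carrier E" by (rule image_subsetI[OF act_D_carrier])
  ultimately show "act n A ` carrier D = {p \<in> carrier E. ?g p = \<zero>\<^bsub>F0 /\<^sub>g ker (C * A)\<^esub>}"
    unfolding Q.quotient_zero by blast
qed

lemma quotient_graded: "graded_module (F0 /\<^sub>g ker A)"
  by (rule graded_quotient.quotient_graded_module[OF ker_quotient])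

lemma quotient_iso_of_double_coset:
  assumes A: "A \<in> GL n" and C: "C \<in> Borel n" "C' \<in> Borel n"
  shows "F0 /\<^sub>g ker A \<cong>\<^sub>g F0 /\<^sub>g ker (C * A * C')"
proof -
  have "E /\<^sub>g (act n A ` carrier D) \<cong>\<^sub>g F0 /\<^sub>g ker (1\<^sub>m n * A)"
    by (rule quotient_ker_mult[OF A Borel_one])
  then have 1: "E /\<^sub>g (act n A ` carrier D) \<cong>\<^sub>g F0 /\<^sub>g ker A" using A by auto
  have "graded_module (E /\<^sub>g (act n A ` carrier D))"
    using graded_submodule_image[OF free_graded free_graded act_D_E]
    by (intro graded_quotient.quotient_graded_module graded_quotient.intro free_graded)
      (simp add: graded_quotient_axioms_def)
  then have "F0 /\<^sub>g ker A \<cong>\<^sub>g E /\<^sub>g (act n A ` carrier D)"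
    using graded_iso_sym quotient_graded 1 by blast
  then have "F0 /\<^sub>g ker A \<cong>\<^sub>g F0 /\<^sub>g ker (C * A)"
    by (rule graded_iso_trans[OF _ quotient_ker_mult[OF A C(1)]])
  then show ?thesis using ker_mult_Borel[OF GL_mult[OF Borel_GL[OF C(1)] A] C(2)] by simp
qed

text \<open>
  Homomorphisms of quotients lift to the free module: the images of the generators are chosen
  homogeneous, of the same degree.
\<close>

lemma quotient_hom_lift:
  assumes f: "f \<in> graded_hom (F0 /\<^sub>g ker A) (F0 /\<^sub>g ker A')"
  obtains C where "C \<in> carrier_mat n n" "\<And>i j. j < i \<Longrightarrow> i < n \<Longrightarrow> C $$ (i, j) = 0"
    "act n C \<in> graded_hom E E"
    "\<And>p. p \<in> carrier E \<Longrightarrow> f (ker A +>\<^bsub>F0\<^esub> coords p) = ker A' +>\<^bsub>F0\<^esub> coords (act n C p)"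
proof -
  interpret Q: graded_quotient F0 "ker A" by (rule ker_quotient)
  interpret Q': graded_quotient F0 "ker A'" by (rule ker_quotient)
  have "\<exists>y\<in>hcomp E (b j). f (ker A +>\<^bsub>F0\<^esub> coords (free_gen b j)) = ker A' +>\<^bsub>F0\<^esub> coords y" if j: "j < n" for j
  proof -
    have "f (ker A +>\<^bsub>F0\<^esub> coords (free_gen b j)) \<in> hcomp (F0 /\<^sub>g ker A') (b j)"
      by (rule graded_hom_hcomp[OF f graded_hom_hcomp[OF Q.coset_graded_hom
        graded_hom_hcomp[OF coords_graded_hom free_gen_hcomp[OF j]]]])
    then obtain z where z: "z \<in> hcomp F0 (b j)" "f (ker A +>\<^bsub>F0\<^esub> coords (free_gen b j)) = ker A' +>\<^bsub>F0\<^esub> z"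
      unfolding Q'.quotient_hcomp by blast
    obtain y where y: "y \<in> carrier E" "z = coords y"
      using subsetD[OF equalityD2[OF coords_surj] F.hcomp_carrier[OF z(1)]] by blast
    have "y \<in> hcomp E (b j)"
      by (rule graded_hom_reflects_hcomp[OF free_graded F0 coords_graded_hom coords_inj y(1)]) (use z y in simp)
    then show ?thesis using y z by blast
  qed
  then obtain y where y: "\<And>j. j < n \<Longrightarrow> y j \<in> hcomp E (b j)"
    "\<And>j. j < n \<Longrightarrow> f (ker A +>\<^bsub>F0\<^esub> coords (free_gen b j)) = ker A' +>\<^bsub>F0\<^esub> coords (y j)" by metis
  obtain C where C: "C \<in> carrier_mat n n" "\<And>i j. i < n \<Longrightarrow> j < n \<Longrightarrow> C $$ (i, j) \<noteq> 0 \<Longrightarrow> b i \<le> b j"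
    "\<And>j. j < n \<Longrightarrow> act n C (free_gen b j) = y j"
    using matrix_of_images[of n y b b] y(1) by metis
  have hC: "act n C \<in> graded_hom E E" using C(2) by (rule act_graded_hom)
  have upper: "C $$ (i, j) = 0" if "j < i" "i < n" for i j
    using C(2)[of i j] that strict_mono_onD[OF b, of j i] by force
  have "f (ker A +>\<^bsub>F0\<^esub> coords p) = ker A' +>\<^bsub>F0\<^esub> coords (act n C p)" if "p \<in> carrier E" for p
  proof (rule graded_hom_free_eqI[OF quotient_graded _ _ _ that])
    show "(\<lambda>p. f (ker A +>\<^bsub>F0\<^esub> coords p)) \<in> graded_hom E (F0 /\<^sub>g ker A')"
      by (rule graded_hom_comp[OF graded_hom_comp[OF coords_graded_hom Q.coset_graded_hom] f])
    show "(\<lambda>p. ker A' +>\<^bsub>F0\<^esub> coords (act n C p)) \<in> graded_hom E (F0 /\<^sub>g ker A')"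
      by (rule graded_hom_comp[OF graded_hom_comp[OF hC coords_graded_hom] Q'.coset_graded_hom])
  qed (simp add: y C)
  then show thesis using that C(1) upper hC by blast
qed

text \<open>Elements of \<open>K_A\<close> have parts only in degrees from the first death on.\<close>

lemma ker_hcomp_birth:
  assumes A: "A \<in> GL n" and j: "j < n" and x: "x \<in> ker A" "x \<in> hcomp F0 (b j)"
  shows "x = \<zero>\<^bsub>F0\<^esub>"
proof -
  obtain u where u: "u \<in> carrier D" "x = emb A u" using x(1) unfolding ker_def by blast
  have "u \<in> hcomp D (b j)"
    by (rule graded_hom_reflects_hcomp[OF free_graded F0 emb_graded_hom emb_inj[OF A] u(1)]) (use x u in simp)
  have "u i = 0" for i
  proof (cases "i < n")
    case True
    then obtain c where c: "u i = monom c (b j)" using \<open>u \<in> hcomp D (b j)\<close> by auto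
    have "monom 1 (d i) dvd u i" using u(1) True by simp
    then show ?thesis using birth_less_death[OF j True] unfolding c by (simp add: monom_1_dvd_monom)
  qed (use u in auto)
  then have "u = \<zero>\<^bsub>D\<^esub>" by auto
  then show ?thesis using u(2) graded_hom_zero[OF free_graded F0 emb_graded_hom] by simp
qed

lemma double_coset_of_quotient_iso:
  assumes A: "A \<in> GL n" and A': "A' \<in> GL n" and iso: "F0 /\<^sub>g ker A \<cong>\<^sub>g F0 /\<^sub>g ker A'"
  obtains C C' where "C \<in> Borel n" "C' \<in> Borel n" "A' = C * A * C'"
proof -
  interpret Q: graded_quotient F0 "ker A" by (rule ker_quotient)
  interpret Q': graded_quotient F0 "ker A'" by (rule ker_quotient)
  obtain f where f: "f \<in> graded_hom (F0 /\<^sub>g ker A) (F0 /\<^sub>g ker A')"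
    "bij_betw f (carrier (F0 /\<^sub>g ker A)) (carrier (F0 /\<^sub>g ker A'))"
    using iso by (auto simp: graded_iso_def)
  obtain g where g: "g \<in> graded_hom (F0 /\<^sub>g ker A') (F0 /\<^sub>g ker A)"
    "\<And>X. X \<in> carrier (F0 /\<^sub>g ker A) \<Longrightarrow> g (f X) = X"
    using graded_inverse[OF quotient_graded quotient_graded f] by metis
  obtain C where C: "C \<in> carrier_mat n n" "\<And>i j. j < i \<Longrightarrow> i < n \<Longrightarrow> C $$ (i, j) = 0" "act n C \<in> graded_hom E E"
    "\<And>p. p \<in> carrier E \<Longrightarrow> f (ker A +>\<^bsub>F0\<^esub> coords p) = ker A' +>\<^bsub>F0\<^esub> coords (act n C p)"
    using quotient_hom_lift[OF f(1)] by metis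
  obtain G where G: "G \<in> carrier_mat n n" "act n G \<in> graded_hom E E"
    "\<And>p. p \<in> carrier E \<Longrightarrow> g (ker A' +>\<^bsub>F0\<^esub> coords p) = ker A +>\<^bsub>F0\<^esub> coords (act n G p)"
    using quotient_hom_lift[OF g(1)] by metis
  \<comment> \<open>The composite of the two lifts is the identity modulo \<open>K_A\<close>, and \<open>K_A\<close> vanishes in birth degrees.\<close>
  have GC: "act n (G * C) (free_gen b j) = free_gen b j" if j: "j < n" for j
  proof -
    let ?e = "free_gen b j" and ?u = "act n G (act n C (free_gen b j))"
    have e: "?e \<in> hcomp E (b j)" "?e \<in> carrier E" using free_gen_hcomp free_gen_carrier j by blast+
    have u: "?u \<in> hcomp E (b j)" by (rule graded_hom_hcomp[OF G(2) graded_hom_hcomp[OF C(3) e(1)]])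
    have Ce: "act n C ?e \<in> carrier E" by (rule graded_hom_closed[OF C(3) e(2)])
    have uE: "?u \<in> carrier E" by (rule graded_hom_closed[OF G(2) Ce])
    have he: "coords ?e \<in> hcomp F0 (b j)" and hu: "coords ?u \<in> hcomp F0 (b j)"
      using graded_hom_hcomp[OF coords_graded_hom] e(1) u by blast+
    have eF: "coords ?e \<in> carrier F0" and uF: "coords ?u \<in> carrier F0"
      using coords_closed e(2) uE by blast+
    have "ker A +>\<^bsub>F0\<^esub> coords ?e \<in> carrier (F0 /\<^sub>g ker A)"
      unfolding Q.quotient_carrier using eF by (rule imageI)
    then have "ker A +>\<^bsub>F0\<^esub> coords ?u = ker A +>\<^bsub>F0\<^esub> coords ?e"
      using g(2) C(4)[OF e(2)] G(3)[OF Ce] by metis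
    then have "coords ?u \<ominus>\<^bsub>F0\<^esub> coords ?e \<in> ker A" using Q.coset_eq_iff[OF uF eF] by simp
    moreover have "coords ?u \<ominus>\<^bsub>F0\<^esub> coords ?e \<in> hcomp F0 (b j)"
      unfolding F.minus_eq
      by (rule F.hcomp_add[OF hu additive_subgroup.a_inv_closed[OF F.additive_subgroup_hcomp he]])
    ultimately have zero: "coords ?u \<ominus>\<^bsub>F0\<^esub> coords ?e = \<zero>\<^bsub>F0\<^esub>" by (rule ker_hcomp_birth[OF A j])
    have "coords ?u = (coords ?u \<ominus>\<^bsub>F0\<^esub> coords ?e) \<oplus>\<^bsub>F0\<^esub> coords ?e"
      using eF uF by (simp add: F.minus_eq F.a_assoc F.l_neg)
    also have "\<dots> = coords ?e" unfolding zero using eF by (rule F.l_zero)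
    finally have "coords ?u = coords ?e" .
    then have "?u = ?e" by (rule inj_onD[OF coords_inj _ uE e(2)])
    then show ?thesis using act_act[OF G(1) C(1)] by simp
  qed
  have "G * C = 1\<^sub>m n"
  proof (rule eq_matI)
    fix i j assume "i < dim_row (1\<^sub>m n :: complex mat)" "j < dim_col (1\<^sub>m n :: complex mat)"
    then have ij: "i < n" "j < n" by auto
    have "monom ((G * C) $$ (i, j)) (b j) = free_gen b j i"
      using act_free_gen[OF ij, of "G * C" b] GC[OF ij(2)] by simp
    then show "(G * C) $$ (i, j) = 1\<^sub>m n $$ (i, j)"
      using ij by (auto simp: free_gen_def monom_eq_iff split: if_splits simp del: index_mult_mat)
  qed (use G C in auto)
  then have "det G * det C = 1" using det_mult[OF G(1) C(1)] by simp
  then have CB: "C \<in> Borel n" using C(1,2) by (intro BorelI) (auto simp: GL_iff_det)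
  have CA: "C * A \<in> GL n" by (rule GL_mult[OF Borel_GL[OF CB] A])
  have "act n (C * A) x \<in> act n A' ` carrier D" if x: "x \<in> carrier D" for x
  proof -
    have xE: "act n A x \<in> carrier E" by (rule act_D_carrier[OF x])
    have "coords (act n A x) \<in> ker A" unfolding coords_in_ker_iff[OF xE] using x by (rule imageI)
    then have "ker A +>\<^bsub>F0\<^esub> coords (act n A x) = \<zero>\<^bsub>F0 /\<^sub>g ker A\<^esub>"
      unfolding Q.quotient_zero by (rule Q.a_rcos_const)
    then have "f (ker A +>\<^bsub>F0\<^esub> coords (act n A x)) = ker A'"
      using graded_hom_zero[OF quotient_graded quotient_graded f(1)] Q'.quotient_zero by simp
    then have "ker A' +>\<^bsub>F0\<^esub> coords (act n C (act n A x)) = ker A'" using C(4)[OF xE] by simp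
    moreover have cE: "act n C (act n A x) \<in> carrier E" by (rule graded_hom_closed[OF C(3) xE])
    ultimately have "coords (act n C (act n A x)) \<in> ker A'"
      using Q'.coset_eq_K_iff[OF coords_closed[OF cE]] by blast
    then have "act n C (act n A x) \<in> act n A' ` carrier D" using coords_in_ker_iff[OF cE] by blast
    then show ?thesis unfolding act_act[OF C(1) GL_carrier[OF A]] .
  qed
  then obtain H where H: "H \<in> Borel n" "C * A = A' * H"
    using ker_subset_imp[OF A' CA image_subsetI] by metis
  obtain H' where H': "H' \<in> Borel n" "H * H' = 1\<^sub>m n" using Borel_inverse[OF H(1)] by blast
  have "C * A * H' = A' * (H * H')"
    unfolding H(2) by (rule assoc_mult_mat[OF GL_carrier[OF A'] Borel_carrier[OF H(1)] Borel_carrier[OF H'(1)]])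
  also have "\<dots> = A'" unfolding H'(2) by (rule right_mult_one_mat[OF GL_carrier[OF A']])
  finally show thesis using that CB H'(1) by simp
qed



section \<open>Cells and isomorphism classes\<close>

lemma kernel_cell_eq:
  assumes w: "w permutes {..<n}"
  shows "kernel_cell F0 n b d \<xi> w = ker ` bruhat_cell n w"
proof -
  have "{A \<in> GL n. flag_of n A \<in> schubert_cell n w} = bruhat_cell n w"
    using flag_in_schubert_cell_iff[OF _ w] bruhat_cell_GL[OF w] by blast
  then show ?thesis unfolding kernel_cell_def kernel_of_eq[abs_def] by simp
qed

lemma kernels_eq_cells: "kernels F0 n d = (\<Union>w\<in>perms n. kernel_cell F0 n b d \<xi> w)"
proof (rule Set.set_eqI)
  fix K
  show "K \<in> kernels F0 n d \<longleftrightarrow> K \<in> (\<Union>w\<in>perms n. kernel_cell F0 n b d \<xi> w)"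
  proof
    assume "K \<in> kernels F0 n d"
    then obtain A where A: "A \<in> GL n" "K = ker A" by (rule kernelsE)
    obtain w where w: "w permutes {..<n}" "A \<in> bruhat_cell n w" using bruhat_cell_cover[OF A(1)] .
    show "K \<in> (\<Union>w\<in>perms n. kernel_cell F0 n b d \<xi> w)"
      using w A(2) by (intro UN_I[of w]) (simp_all add: kernel_cell_eq)
  next
    assume "K \<in> (\<Union>w\<in>perms n. kernel_cell F0 n b d \<xi> w)"
    then obtain w A where "w permutes {..<n}" "A \<in> bruhat_cell n w" "K = ker A"
      using kernel_cell_eq by auto
    then show "K \<in> kernels F0 n d" using ker_in_kernels bruhat_cell_GL by simp
  qed
qed

lemma kernel_cells_disjoint: "disjoint_family_on (kernel_cell F0 n b d \<xi>) (perms n)"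
  unfolding disjoint_family_on_def
proof (intro ballI impI)
  fix w w' assume w: "w \<in> perms n" "w' \<in> perms n" "w \<noteq> w'"
  show "kernel_cell F0 n b d \<xi> w \<inter> kernel_cell F0 n b d \<xi> w' = {}"
  proof (rule ccontr)
    assume "kernel_cell F0 n b d \<xi> w \<inter> kernel_cell F0 n b d \<xi> w' \<noteq> {}"
    then obtain A A' where A: "A \<in> bruhat_cell n w" "A' \<in> bruhat_cell n w'" "ker A = ker A'"
      using w by (auto simp: kernel_cell_eq)
    obtain C where C: "C \<in> Borel n" "A' = A * C"
      using ker_eq_imp[OF bruhat_cell_GL[OF _ A(1)] bruhat_cell_GL[OF _ A(2)] A(3)] w by auto
    have "A' \<in> bruhat_cell n w"
      using bruhat_cell_mult[OF A(1) Borel_one C(1)] bruhat_cell_GL[OF _ A(1)] w C(2) by auto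
    then show False using bruhat_cell_disjoint[OF _ _ _ A(2)] w by simp
  qed
qed

lemma quotient_iso_iff_bruhat_cell:
  assumes w: "w permutes {..<n}" and A: "A \<in> bruhat_cell n w" and A': "A' \<in> GL n"
  shows "F0 /\<^sub>g ker A \<cong>\<^sub>g F0 /\<^sub>g ker A' \<longleftrightarrow> A' \<in> bruhat_cell n w"
proof
  have AG: "A \<in> GL n" using bruhat_cell_GL[OF w A] .
  show "A' \<in> bruhat_cell n w" if iso: "F0 /\<^sub>g ker A \<cong>\<^sub>g F0 /\<^sub>g ker A'"
  proof -
    obtain C C' where "C \<in> Borel n" "C' \<in> Borel n" "A' = C * A * C'"
      using double_coset_of_quotient_iso[OF AG A' iso] .
    then show ?thesis using bruhat_cell_mult[OF A] by simp
  qed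
  show "F0 /\<^sub>g ker A \<cong>\<^sub>g F0 /\<^sub>g ker A'" if same: "A' \<in> bruhat_cell n w"
  proof -
    obtain C C' where "C \<in> Borel n" "C' \<in> Borel n" "A' = C * A * C'"
      using bruhat_cell_same[OF A same] .
    then show ?thesis using quotient_iso_of_double_coset[OF AG] by simp
  qed
qed

lemma quotient_iso_iff_same_cell:
  assumes K: "K \<in> kernels F0 n d" and K': "K' \<in> kernels F0 n d"
  shows "F0 /\<^sub>g K \<cong>\<^sub>g F0 /\<^sub>g K' \<longleftrightarrow>
    (\<exists>w\<in>perms n. K \<in> kernel_cell F0 n b d \<xi> w \<and> K' \<in> kernel_cell F0 n b d \<xi> w)"
proof
  assume iso: "F0 /\<^sub>g K \<cong>\<^sub>g F0 /\<^sub>g K'"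
  obtain A where A: "A \<in> GL n" "K = ker A" using K by (rule kernelsE)
  obtain A' where A': "A' \<in> GL n" "K' = ker A'" using K' by (rule kernelsE)
  obtain w where w: "w permutes {..<n}" "A \<in> bruhat_cell n w" using bruhat_cell_cover[OF A(1)] .
  have "A' \<in> bruhat_cell n w" using quotient_iso_iff_bruhat_cell[OF w A'(1)] iso A A' by simp
  then show "\<exists>w\<in>perms n. K \<in> kernel_cell F0 n b d \<xi> w \<and> K' \<in> kernel_cell F0 n b d \<xi> w"
    using w A A' by (intro bexI[of _ w]) (simp_all add: kernel_cell_eq)
next
  assume "\<exists>w\<in>perms n. K \<in> kernel_cell F0 n b d \<xi> w \<and> K' \<in> kernel_cell F0 n b d \<xi> w"
  then obtain w A A' where "w permutes {..<n}" "A \<in> bruhat_cell n w" "A' \<in> bruhat_cell n w"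
    "K = ker A" "K' = ker A'" by (auto simp: kernel_cell_eq)
  then show "F0 /\<^sub>g K \<cong>\<^sub>g F0 /\<^sub>g K'"
    using quotient_iso_iff_bruhat_cell bruhat_cell_GL by simp
qed

lemma E_iso_F0: "E \<cong>\<^sub>g F0"
  unfolding graded_iso_def using coords_graded_hom coords_bij by blast

text \<open>
  Composing the resolution with an isomorphism \<open>F0 \<cong> P0\<close> presents the module as a quotient of \<open>F0\<close>
  by a submodule isomorphic to \<open>P1\<close>.
\<close>

lemma persistence_module_is_quotient:
  fixes M :: "'m gmodule"
  assumes "has_births_deaths M n b d"
  shows "\<exists>K\<in>kernels F0 n d. M \<cong>\<^sub>g F0 /\<^sub>g K"
proof -
  obtain P1 P0 :: "(nat \<Rightarrow> complex poly) gmodule" and f g where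
    res: "minimal_graded_resolution P1 P0 M f g" and P: "P0 \<cong>\<^sub>g E" "P1 \<cong>\<^sub>g D"
    using assms by (auto simp: has_births_deaths_def)
  have gr: "graded_module P1" "graded_module P0" "graded_module M"
    and f: "f \<in> graded_hom P1 P0" "inj_on f (carrier P1)"
    and g: "g \<in> graded_hom P0 M" "g ` carrier P0 = carrier M"
    and ex: "f ` carrier P1 = {x \<in> carrier P0. g x = \<zero>\<^bsub>M\<^esub>}"
    using res unfolding minimal_graded_resolution_def by blast+
  have "P0 \<cong>\<^sub>g F0" by (rule graded_iso_trans[OF P(1) E_iso_F0])
  then obtain h where h: "h \<in> graded_hom P0 F0" "bij_betw h (carrier P0) (carrier F0)"
    unfolding graded_iso_def by blast
  obtain k where k: "k \<in> graded_hom F0 P0" "bij_betw k (carrier F0) (carrier P0)"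
    "\<And>x. x \<in> carrier P0 \<Longrightarrow> k (h x) = x" "\<And>y. y \<in> carrier F0 \<Longrightarrow> h (k y) = y"
    using graded_inverse[OF gr(2) F0 h] by metis
  let ?g = "\<lambda>x. g (k x)" and ?f = "\<lambda>x. h (f x)"
  have hg: "?g \<in> graded_hom F0 M" by (rule graded_hom_comp[OF k(1) g(1)])
  have hf: "?f \<in> graded_hom P1 F0" by (rule graded_hom_comp[OF f(1) h(1)])
  define K where "K = {x \<in> carrier F0. ?g x = \<zero>\<^bsub>M\<^esub>}"
  have K: "K = ?f ` carrier P1"
  proof
    show "K \<subseteq> ?f ` carrier P1"
    proof
      fix x assume "x \<in> K"
      then have x: "x \<in> carrier F0" "g (k x) = \<zero>\<^bsub>M\<^esub>" by (auto simp: K_def)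
      have "k x \<in> f ` carrier P1" unfolding ex using x graded_hom_closed[OF k(1)] by simp
      then obtain y where y: "y \<in> carrier P1" "k x = f y" by blast
      have "x = h (f y)" using k(4)[OF x(1)] y(2) by simp
      then show "x \<in> ?f ` carrier P1" using y(1) by (rule image_eqI)
    qed
    show "?f ` carrier P1 \<subseteq> K"
    proof (rule image_subsetI)
      fix y assume y: "y \<in> carrier P1"
      have "f y \<in> {x \<in> carrier P0. g x = \<zero>\<^bsub>M\<^esub>}" unfolding ex[symmetric] using y by (rule imageI)
      then show "h (f y) \<in> K" using k(3)[of "f y"] graded_hom_closed[OF h(1)] by (simp add: K_def)
    qed
  qed
  have "inj_on ?f (carrier P1)"
  proof (rule inj_onI)
    fix x y assume x: "x \<in> carrier P1" and y: "y \<in> carrier P1" and eq: "h (f x) = h (f y)"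
    have "k (h (f x)) = k (h (f y))" using eq by (rule arg_cong)
    then have "f x = f y"
      unfolding k(3)[OF graded_hom_closed[OF f(1) x]] k(3)[OF graded_hom_closed[OF f(1) y]] .
    then show "x = y" by (rule inj_onD[OF f(2) _ x y])
  qed
  then have "P1 \<cong>\<^sub>g restrict_gmodule F0 K" unfolding K by (rule graded_iso_image[OF gr(1) F0 hf])
  moreover have KG: "graded_submodule K F0" unfolding K by (rule graded_submodule_image[OF gr(1) F0 hf])
  ultimately have "restrict_gmodule F0 K \<cong>\<^sub>g P1"
    by (intro graded_iso_sym[OF gr(1)]) (simp_all add: graded_submodule_def)
  then have "restrict_gmodule F0 K \<cong>\<^sub>g D" using P(2) by (rule graded_iso_trans)
  then have KK: "K \<in> kernels F0 n d" using KG by (simp add: kernels_def)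
  have "?g ` carrier F0 = g ` k ` carrier F0" by (simp only: image_image)
  also have "\<dots> = carrier M" using k(2) g(2) by (simp add: bij_betw_def)
  finally have iso: "F0 /\<^sub>g K \<cong>\<^sub>g M" by (rule graded_first_isomorphism[OF F0 gr(3) hg _ K_def])
  have "graded_module (F0 /\<^sub>g K)"
    using KG F0 by (intro graded_quotient.quotient_graded_module graded_quotient.intro)
      (simp_all add: graded_quotient_axioms_def)
  then have "M \<cong>\<^sub>g F0 /\<^sub>g K" using graded_iso_sym gr(3) iso by blast
  then show ?thesis using KK by blast
qed

lemma submodule_gens:
  assumes N: "LinearCombinations.submodule Cz N F0" and gens: "\<xi> ` {..<n} \<subseteq> N"
  shows "N = carrier F0"
proof
  show "N \<subseteq> carrier F0" using N by (rule submodule.subset)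
  have "coords p \<in> N" if "p \<in> carrier E" for p
    using that
  proof (induction rule: free_induct)
    case zero
    then show ?case
      using graded_hom_zero[OF free_graded F0 coords_graded_hom] LinearCombinations.submodule.zero_closed[OF N] by simp
  next
    case (add p q)
    then show ?case
      using graded_hom_add[OF coords_graded_hom add(1,2)] LinearCombinations.submodule.m_closed[OF N] by simp
  next
    case (gen r j)
    have "\<xi> j \<in> N" using gens gen by auto
    then show ?case
      using graded_hom_smult[OF coords_graded_hom free_gen_carrier[OF gen]] coords_gen[OF gen]
        LinearCombinations.submodule.smult_closed[OF N, of r "\<xi> j"] by simp
  qed
  then show "carrier F0 \<subseteq> N" unfolding coords_surj[symmetric] by (rule image_subsetI)
qed

lemma quotient_persistence_module: "persistence_module (F0 /\<^sub>g ker A)"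
proof -
  interpret Q: graded_quotient F0 "ker A" by (rule ker_quotient)
  let ?S = "(\<lambda>x. ker A +>\<^bsub>F0\<^esub> x) ` \<xi> ` {..<n}"
  have "LinearCombinations.module.span Cz (F0 /\<^sub>g ker A) ?S = carrier (F0 /\<^sub>g ker A)"
    using \<xi>_carrier by (intro Q.quotient_span submodule_gens) auto
  moreover have "?S \<subseteq> carrier (F0 /\<^sub>g ker A)" using \<xi>_carrier by (auto simp: Q.quotient_carrier)
  ultimately show ?thesis
    using quotient_graded unfolding persistence_module_def by (intro conjI exI[of _ ?S]) auto
qed

text \<open>Minimality of the resolution: deaths exceed births strictly, so \<open>A D\<close> is contained in \<open>z E\<close>.\<close>

lemma act_D_minimal: "act n A ` carrier D \<subseteq> (\<lambda>y. monom 1 1 \<odot>\<^bsub>E\<^esub> y) ` carrier E"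
proof (rule image_subsetI)
  fix x assume x: "x \<in> carrier D"
  have "act n A \<in> graded_hom D (free_gmodule n (\<lambda>i. Suc (b i)))"
    using birth_less_death by (intro act_graded_hom) (simp add: Suc_le_eq)
  then have "act n A x \<in> carrier (free_gmodule n (\<lambda>i. Suc (b i)))" using x by (rule graded_hom_closed)
  then have dvd: "monom 1 1 * monom 1 (b i) dvd act n A x i" if "i < n" for i
    using that by (simp add: mult_monom)
  define y where "y i = act n A x i div monom 1 1" for i
  have y: "monom 1 1 * y i = act n A x i" if "i < n" for i
    unfolding y_def using dvd[OF that] by (metis dvd_mult_div_cancel dvd_mult_left)
  have "monom 1 (b i) dvd y i" if "i < n" for i
    using dvd[OF that] unfolding y[OF that, symmetric] by (simp add: monom_eq_0_iff)
  moreover have z: "y i = 0" "act n A x i = 0" if "n \<le> i" for i using that by (simp_all add: y_def act_def)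
  ultimately have "y \<in> carrier E" by simp
  moreover have "act n A x = monom 1 1 \<odot>\<^bsub>E\<^esub> y"
  proof
    fix i show "act n A x i = (monom 1 1 \<odot>\<^bsub>E\<^esub> y) i" using y[of i] z[of i] by (cases "i < n") auto
  qed
  ultimately show "act n A x \<in> (\<lambda>y. monom 1 1 \<odot>\<^bsub>E\<^esub> y) ` carrier E" by blast
qed

lemma quotient_births_deaths:
  assumes A: "A \<in> GL n"
  shows "has_births_deaths (F0 /\<^sub>g ker A) n b d"
proof -
  interpret Q: graded_quotient F0 "ker A" by (rule ker_quotient)
  let ?g = "\<lambda>p. ker A +>\<^bsub>F0\<^esub> coords p"
  have g: "?g \<in> graded_hom E (F0 /\<^sub>g ker A)" by (rule graded_hom_comp[OF coords_graded_hom Q.coset_graded_hom])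
  have surj: "?g ` carrier E = carrier (F0 /\<^sub>g ker A)"
    unfolding Q.quotient_carrier coords_surj[symmetric] by (simp only: image_image)
  have "p \<in> act n A ` carrier D \<longleftrightarrow> ?g p = ker A" if "p \<in> carrier E" for p
    unfolding Q.coset_eq_K_iff[OF coords_closed[OF that]] coords_in_ker_iff[OF that] ..
  moreover have "act n A ` carrier D \<subseteq> carrier E" by (rule image_subsetI[OF act_D_carrier])
  ultimately have "act n A ` carrier D = {p \<in> carrier E. ?g p = \<zero>\<^bsub>F0 /\<^sub>g ker A\<^esub>}"
    unfolding Q.quotient_zero by blast
  then have "minimal_graded_resolution D E (F0 /\<^sub>g ker A) (act n A) ?g"
    unfolding minimal_graded_resolution_def
    by (intro conjI free_graded quotient_graded act_D_E g act_inj[OF A] surj act_D_minimal)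
  then show ?thesis unfolding has_births_deaths_def using graded_iso_refl by blast
qed

lemma quotient_in_persistence_modules:
  "A \<in> GL n \<Longrightarrow> F0 /\<^sub>g ker A \<in> persistence_modules n b d"
  by (simp add: persistence_modules_def quotient_persistence_module quotient_births_deaths)

end

lemma equiv_iso_rel: "equiv (persistence_modules n b d) (iso_rel n b d)"
proof (rule equivI)
  have gr: "graded_module M" if "M \<in> persistence_modules n b d" for M :: "'m gmodule"
    using that by (simp add: persistence_modules_def persistence_module_def)
  show "sym (iso_rel n b d)"
    unfolding iso_rel_def by (rule symI) (use graded_iso_sym gr in blast)
  show "trans (iso_rel n b d)"
    unfolding iso_rel_def by (rule transI) (use graded_iso_trans in blast)
qed (auto simp: iso_rel_def refl_on_def graded_iso_refl)

lemma iso_rel_Image_eq_iff: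
  assumes "M \<in> persistence_modules n b d" "N \<in> persistence_modules n b d"
  shows "iso_rel n b d `` {M} = iso_rel n b d `` {N} \<longleftrightarrow> M \<cong>\<^sub>g N"
  using eq_equiv_class_iff[OF equiv_iso_rel assms] assms by (simp add: iso_rel_def)

text \<open>The class of a cell is represented by the quotient belonging to the permutation matrix.\<close>

lemma (in births_deaths) cells_biject_with_classes:
  "\<exists>\<Phi>. (\<forall>w\<in>perms n. kernel_cell F0 n b d \<xi> w \<noteq> {} \<and>
        (\<forall>K\<in>kernel_cell F0 n b d \<xi> w. \<Phi> (schubert_cell n w) = iso_rel n b d `` {F0 /\<^sub>g K})) \<and>
    bij_betw \<Phi> (schubert_cell n ` perms n)
      ((persistence_modules n b d :: 'f set gmodule set) // iso_rel n b d)"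
proof -
  define cls where "cls w = iso_rel n b d `` {F0 /\<^sub>g ker (perm_mat n w)}" for w
  define \<Phi> where "\<Phi> X = cls (inv_into (perms n) (schubert_cell n) X)" for X
  have \<Phi>: "\<Phi> (schubert_cell n w) = cls w" if "w \<in> perms n" for w
    unfolding \<Phi>_def inv_into_f_f[OF inj_on_schubert_cell that] ..
  have P: "F0 /\<^sub>g ker (perm_mat n w) \<in> persistence_modules n b d" if "w \<in> perms n" for w
    using quotient_in_persistence_modules[OF perm_mat_GL] that by simp
  have cls: "iso_rel n b d `` {F0 /\<^sub>g ker A} = cls w" if w: "w \<in> perms n" and A: "A \<in> bruhat_cell n w" for A w
  proof -
    have AG: "A \<in> GL n" using bruhat_cell_GL[OF _ A] w by simp
    have "F0 /\<^sub>g ker A \<cong>\<^sub>g F0 /\<^sub>g ker (perm_mat n w)"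
      using quotient_iso_iff_bruhat_cell[OF _ A perm_mat_GL] w perm_mat_bruhat_cell by simp
    then show ?thesis
      unfolding cls_def iso_rel_Image_eq_iff[OF quotient_in_persistence_modules[OF AG] P[OF w]] .
  qed
  have inj: "inj_on cls (perms n)"
  proof (rule inj_onI)
    fix w w' assume w: "w \<in> perms n" and w': "w' \<in> perms n" and eq: "cls w = cls w'"
    have "F0 /\<^sub>g ker (perm_mat n w) \<cong>\<^sub>g F0 /\<^sub>g ker (perm_mat n w')"
      using eq unfolding cls_def iso_rel_Image_eq_iff[OF P[OF w] P[OF w']] .
    then have "perm_mat n w' \<in> bruhat_cell n w"
      using quotient_iso_iff_bruhat_cell[OF _ perm_mat_bruhat_cell perm_mat_GL] w w' by simp
    then show "w = w'" using bruhat_cell_disjoint[OF _ _ _ perm_mat_bruhat_cell] w w' by simp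
  qed
  have img: "cls ` perms n = (persistence_modules n b d :: 'f set gmodule set) // iso_rel n b d"
  proof
    show "cls ` perms n \<subseteq> persistence_modules n b d // iso_rel n b d"
      unfolding cls_def by (rule image_subsetI) (rule quotientI[OF P])
    show "persistence_modules n b d // iso_rel n b d \<subseteq> cls ` perms n"
    proof
      fix X :: "'f set gmodule set" assume "X \<in> persistence_modules n b d // iso_rel n b d"
      then obtain M :: "'f set gmodule" where M: "M \<in> persistence_modules n b d" "X = iso_rel n b d `` {M}"
        by (rule quotientE)
      obtain K where K: "K \<in> kernels F0 n d" "M \<cong>\<^sub>g F0 /\<^sub>g K"
        using persistence_module_is_quotient[of M] M(1) by (auto simp: persistence_modules_def)
      obtain A where A: "A \<in> GL n" "K = ker A" using K(1) by (rule kernelsE)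
      obtain w where w: "w permutes {..<n}" "A \<in> bruhat_cell n w" using bruhat_cell_cover[OF A(1)] .
      have "X = iso_rel n b d `` {F0 /\<^sub>g ker A}"
        unfolding M(2) iso_rel_Image_eq_iff[OF M(1) quotient_in_persistence_modules[OF A(1)]]
        using K(2) A(2) by simp
      then have "X = cls w" using cls w by simp
      then show "X \<in> cls ` perms n" using w(1) by simp
    qed
  qed
  have cells: "kernel_cell F0 n b d \<xi> w \<noteq> {} \<and>
      (\<forall>K\<in>kernel_cell F0 n b d \<xi> w. \<Phi> (schubert_cell n w) = iso_rel n b d `` {F0 /\<^sub>g K})"
    if w: "w \<in> perms n" for w
  proof -
    have eq: "kernel_cell F0 n b d \<xi> w = ker ` bruhat_cell n w" using kernel_cell_eq w by simp
    show ?thesis unfolding eq \<Phi>[OF w] using cls[OF w] perm_mat_bruhat_cell[of n w] by auto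
  qed
  have "bij_betw (\<Phi> \<circ> schubert_cell n) (perms n) ((persistence_modules n b d :: 'f set gmodule set) // iso_rel n b d)"
    unfolding img[symmetric] using inj \<Phi> by (auto simp: bij_betw_def inj_on_def)
  then have "bij_betw \<Phi> (schubert_cell n ` perms n) ((persistence_modules n b d :: 'f set gmodule set) // iso_rel n b d)"
    using inj_on_schubert_cell bij_betw_comp_iff[of "schubert_cell n" "perms n" "schubert_cell n ` perms n" \<Phi>]
    by (simp add: bij_betw_def[of "schubert_cell n"])
  then show ?thesis using cells by blast
qed

theorem mainTheorem1:
  fixes n :: nat and b d :: "nat \<Rightarrow> nat" and F0 :: "'f gmodule" and \<xi> :: "nat \<Rightarrow> 'f"
  assumes "n \<ge> 1"
    and "strict_mono_on {..<n} b" and "b (n - 1) < d 0" and "strict_mono_on {..<n} d"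
    and "graded_module F0" and "homogeneous_basis F0 n b \<xi>"
  shows
    "kernels F0 n d = (\<Union>w\<in>perms n. kernel_cell F0 n b d \<xi> w)
      \<and> disjoint_family_on (kernel_cell F0 n b d \<xi>) (perms n)
    \<and> (\<forall>M :: 'm gmodule. persistence_module M \<and> has_births_deaths M n b d
        \<longrightarrow> (\<exists>K\<in>kernels F0 n d. M \<cong>\<^sub>g F0 /\<^sub>g K))
    \<and> (\<forall>K\<in>kernels F0 n d. \<forall>K'\<in>kernels F0 n d.
        F0 /\<^sub>g K \<cong>\<^sub>g F0 /\<^sub>g K' \<longleftrightarrow>
        (\<exists>w\<in>perms n. K \<in> kernel_cell F0 n b d \<xi> w \<and> K' \<in> kernel_cell F0 n b d \<xi> w))
    \<and> inj_on (schubert_cell n) (perms n)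
    \<and> (\<exists>\<Phi>. (\<forall>w\<in>perms n. kernel_cell F0 n b d \<xi> w \<noteq> {} \<and>
              (\<forall>K\<in>kernel_cell F0 n b d \<xi> w. \<Phi> (schubert_cell n w) = iso_rel n b d `` {F0 /\<^sub>g K})) \<and>
          bij_betw \<Phi> (schubert_cell n ` perms n)
            ((persistence_modules n b d :: 'f set gmodule set) // iso_rel n b d))"
proof -
  interpret births_deaths n b d F0 \<xi>
    using assms by (intro births_deaths.intro)
  show ?thesis
    using kernels_eq_cells kernel_cells_disjoint persistence_module_is_quotient
      quotient_iso_iff_same_cell inj_on_schubert_cell cells_biject_with_classes
    by (intro conjI allI impI ballI) auto
qed

end
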